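(* Let $G$ be a finite directed acyclic graph with a unique source $s$ and a unique sink $t$ and no idle edges. If $G$ is strongly planar and satisfies degree equality, then every route decomposition $\mathcal{R}$ of $G$ (with a linear ordering) induces a unimodular triangulation of the order polytope $\mathcal{O}(P_G)$, namely the image of the equatorial flow triangulation $T_{\mathrm{eq}}\ast\Delta_{\mathcal{R}}$ of $\mathcal{F}_1(G)$ under the integral equivalence $\mathcal{F}_1(G)\cong\mathcal{O}(P_G)$.
   Context: Graphs and flow polytopes. Directed graphs may have parallel edges. The vertices of $G$ are ordered $s<1<\cdots<n<t$ with every edge going from a smaller to a larger vertex; $1,\dots,n$ are the inner vertices. An edge is idle if it is the only incoming or the only outgoing edge of some inner vertex. A route is a directed path from $s$ to $t$ (a sequence of edges); $\chi_R\in\mathbb{R}^{E(G)}$ is the indicator vector of a route $R$. The flow polytope $\mathcal{F}_1(G)$ is the set of $x\in\mathbb{R}_{\ge 0}^{E(G)}$ with inflow equal to outflow at every inner vertex and total outflow $1$ at $s$; its vertices are the $\chi_R$. Degree equality: $\mathrm{indeg}_G(v)=\mathrm{outdeg}_G(v)$ for all inner $v$. A triangulation of a lattice polytope is unimodular if for each simplex with vertices $v_0,\dots,v_m$ of maximal dimension the vectors $v_1-v_0,\dots,v_m-v_0$ form a basis of the lattice of integer points in the linear space parallel to the affine span of the polytope. Strong planarity and duality. $G$ is strongly planar if it has a planar realization in which for each directed edge $(i,j)$ the $x$-coordinate of $i$ is strictly less than that of $j$ and each edge is embedded as the graph of a piecewise differentiable function of $x$. Fix such a realization. $P_G$ is the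 poset whose Hasse diagram is the dual graph of $G$ with the vertex of the infinite region deleted: its elements are the bounded regions, and $p$ is covered by $q$ when $p$ and $q$ share an edge of $G$ with $p$ directly below and $q$ directly above it. Let $\widehat{P_G}=P_G\cup\{\hat 0,\hat 1\}$, where $\hat 0$ and $\hat 1$ represent the parts of the infinite region below and above $G$; the edges of $G$ are in bijection with the cover relations of $\widehat{P_G}$. The order polytope $\mathcal{O}(P)$ of a finite poset is the set of order-preserving maps $f:P\to[0,1]$. The integral equivalence (Mészáros–Morales–Striker) $\phi:\mathcal{O}(P_G)\to\mathcal{F}_1(G)$ sends $f$ to the flow with value $f(y)-f(x)$ on the edge dual to the cover relation $x\prec y$ of $\widehat{P_G}$, where $f(\hat 0)=0$, $f(\hat 1)=1$; the induced triangulation is obtained by applying $\phi^{-1}$. Equatorial flow triangulations. A framing is a choice, for each inner vertex $v$, of linear orders on the set $\mathrm{in}(v)$ of incoming and the set $\mathrm{out}(v)$ of outgoing edges. For a route $P$ through $v$, $Pv$ is its part from $s$ to $v$ and $vP$ its part from $v$ to $t$. For distinct directed paths $P,Q$ from $v$ to $t$, let $w$ be the last vertex of their common initial segment; $P\prec_{\mathrm{Out}(v)}Q$ if the edge of $P$ leaving $w$ is smaller in $\mathrm{out}(w)$ than that of $Q$. For distinct directed paths $P,Q$ from $s$ to $v$, let $w$ be the first vertex of their common final segment; $P\prec_{\mathrm{In}(v)}Q$ if the edge of $P$ entering $w$ is smaller in $\mathrm{in}(w)$ than that of $Q$. Routes $P,Q$ sharing an inner vertex $v$ are in conflict at $v$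 if (up to exchanging them) $Pv\prec_{\mathrm{In}(v)}Qv$ and $vQ\prec_{\mathrm{Out}(v)}vP$; they are coherent if not in conflict at any common inner vertex; a clique is a set of pairwise coherent routes. The DKK triangulation induced by a framing is the triangulation of $\mathcal{F}_1(G)$ whose simplices are $\mathrm{conv}\{\chi_R:R\in C\}$ for cliques $C$. A route decomposition of $G$ is a set $\mathcal{R}$ of routes whose edge sets partition $E(G)$. Given a linear order $\mathcal{R}=\{R_1<\cdots<R_k\}$, the route decomposition framing orders the incoming edges, and likewise the outgoing edges, at each inner vertex by the order of the routes of $\mathcal{R}$ containing them; let $T$ be the induced DKK triangulation. $\Gamma$ is the polyhedral subcomplex of $\partial\mathcal{F}_1(G)$ generated by all faces $\bigcap_{R\in\mathcal{R}}F_R$ with each $F_R$ a facet of $\mathcal{F}_1(G)$ not containing $\chi_R$; $T_{\mathrm{eq}}=T|_\Gamma$ consists of the simplices of $T$ contained in a face of $\Gamma$; $\Delta_{\mathcal{R}}=\mathrm{conv}\{\chi_R:R\in\mathcal{R}\}$. The equatorial flow triangulation is the join $T_{\mathrm{eq}}\ast\Delta_{\mathcal{R}}$, generated by the simplices $\mathrm{conv}(F\cup\Delta_{\mathcal{R}})$ for $F$ a face of $T_{\mathrm{eq}}$. *)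

theory Defs
  imports "HOL-Analysis.Analysis" "Graph_Theory.Arc_Walk"
begin

section \<open>Graphs and flow polytopes\<close>

definition unique_source :: "('v, 'e) pre_digraph \<Rightarrow> 'v \<Rightarrow> bool" where
  "unique_source G s \<longleftrightarrow> {v \<in> verts G. in_arcs G v = {}} = {s}"

definition unique_sink :: "('v, 'e) pre_digraph \<Rightarrow> 'v \<Rightarrow> bool" where
  "unique_sink G t \<longleftrightarrow> {v \<in> verts G. out_arcs G v = {}} = {t}"

definition inner_verts :: "('v, 'e) pre_digraph \<Rightarrow> 'v \<Rightarrow> 'v \<Rightarrow> 'v set" where
  "inner_verts G s t = verts G - {s, t}"

definition idle :: "('v, 'e) pre_digraph \<Rightarrow> 'v \<Rightarrow> 'v \<Rightarrow> 'e \<Rightarrow> bool" where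
  "idle G s t e \<longleftrightarrow> (\<exists>v \<in> inner_verts G s t. in_arcs G v = {e} \<or> out_arcs G v = {e})"

definition degree_equality :: "('v, 'e) pre_digraph \<Rightarrow> 'v \<Rightarrow> 'v \<Rightarrow> bool" where
  "degree_equality G s t \<longleftrightarrow> (\<forall>v \<in> inner_verts G s t. in_degree G v = out_degree G v)"

definition route :: "('v, 'e) pre_digraph \<Rightarrow> 'v \<Rightarrow> 'v \<Rightarrow> 'e list \<Rightarrow> bool" where
  "route G s t R \<longleftrightarrow> pre_digraph.apath G s R t"

definition route_vec :: "'e list \<Rightarrow> real ^ 'e::finite" where
  "route_vec R = (\<chi> e. if e \<in> set R then 1 else 0)"

definition flow_polytope ::
    "('v, 'e::finite) pre_digraph \<Rightarrow> 'v \<Rightarrow> 'v \<Rightarrow> (real ^ 'e) set" where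
  "flow_polytope G s t = {x. (\<forall>e. 0 \<le> x $ e) \<and>
     (\<forall>v \<in> inner_verts G s t. (\<Sum>e\<in>in_arcs G v. x $ e) = (\<Sum>e\<in>out_arcs G v. x $ e)) \<and>
     (\<Sum>e\<in>out_arcs G s. x $ e) = 1}"


section \<open>Unimodular triangulations\<close>

text \<open>Integer points of the linear space parallel to the affine span of \<open>Q\<close>.\<close>

definition parallel_lattice :: "(real ^ 'n) set \<Rightarrow> (real ^ 'n) set" where
  "parallel_lattice Q =
     {x - y | x y. x \<in> affine hull Q \<and> y \<in> affine hull Q} \<inter> {z. \<forall>i. z $ i \<in> \<int>}"

definition lattice_basis :: "(real ^ 'n) set \<Rightarrow> (real ^ 'n) set \<Rightarrow> bool" where
  "lattice_basis B L \<longleftrightarrow>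
     independent B \<and> L = {(\<Sum>b\<in>B. real_of_int (c b) *\<^sub>R b) | c. True}"

definition unimodular_triangulation ::
    "(real ^ 'n) set set \<Rightarrow> (real ^ 'n) set \<Rightarrow> bool" where
  "unimodular_triangulation T Q \<longleftrightarrow>
     simplicial_complex T \<and> \<Union>T = Q \<and>
     (\<forall>C. \<not> affine_dependent C \<and> convex hull C \<in> T \<and>
          (\<forall>S\<in>T. aff_dim S \<le> aff_dim (convex hull C)) \<longrightarrow>
        (\<forall>v\<^sub>0\<in>C. lattice_basis ((\<lambda>v. v - v\<^sub>0) ` (C - {v\<^sub>0})) (parallel_lattice Q)))"


section \<open>Strongly planar realizations\<close>

text \<open>A realization places the vertex \<open>v\<close> at \<open>pos v\<close> and draws the edge \<open>e\<close> as the
  graph of \<open>g e\<close> between the abscissas of its end vertices.\<close>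

definition edge_dom :: "('v, 'e) pre_digraph \<Rightarrow> ('v \<Rightarrow> real \<times> real) \<Rightarrow> 'e \<Rightarrow> real set" where
  "edge_dom G pos e = {fst (pos (tail G e)) .. fst (pos (head G e))}"

definition edge_curve ::
    "('v, 'e) pre_digraph \<Rightarrow> ('v \<Rightarrow> real \<times> real) \<Rightarrow> ('e \<Rightarrow> real \<Rightarrow> real) \<Rightarrow> 'e
       \<Rightarrow> (real \<times> real) set" where
  "edge_curve G pos g e = (\<lambda>x. (x, g e x)) ` edge_dom G pos e"

definition strongly_planar_realization ::
    "('v, 'e) pre_digraph \<Rightarrow> ('v \<Rightarrow> real \<times> real) \<Rightarrow> ('e \<Rightarrow> real \<Rightarrow> real) \<Rightarrow> bool" where
  "strongly_planar_realization G pos g \<longleftrightarrow>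
     inj_on pos (verts G) \<and>
     (\<forall>e\<in>arcs G.
        fst (pos (tail G e)) < fst (pos (head G e)) \<and>
        g e piecewise_differentiable_on edge_dom G pos e \<and>
        g e (fst (pos (tail G e))) = snd (pos (tail G e)) \<and>
        g e (fst (pos (head G e))) = snd (pos (head G e))) \<and>
     (\<forall>v\<in>verts G. \<forall>e\<in>arcs G. pos v \<in> edge_curve G pos g e \<longrightarrow> v = tail G e \<or> v = head G e) \<and>
     (\<forall>e\<in>arcs G. \<forall>e'\<in>arcs G. e \<noteq> e' \<longrightarrow>
        edge_curve G pos g e \<inter> edge_curve G pos g e'
          \<subseteq> pos ` ({tail G e, head G e} \<inter> {tail G e', head G e'}))"

definition drawing ::
    "('v, 'e) pre_digraph \<Rightarrow> ('v \<Rightarrow> real \<times> real) \<Rightarrow> ('e \<Rightarrow> real \<Rightarrow> real) \<Rightarrow> (real \<times> real) set" where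
  "drawing G pos g = pos ` verts G \<union> (\<Union>e\<in>arcs G. edge_curve G pos g e)"

definition regions ::
    "('v, 'e) pre_digraph \<Rightarrow> ('v \<Rightarrow> real \<times> real) \<Rightarrow> ('e \<Rightarrow> real \<Rightarrow> real)
       \<Rightarrow> (real \<times> real) set set" where
  "regions G pos g = components (- drawing G pos g)"

definition directly_above ::
    "('v, 'e) pre_digraph \<Rightarrow> ('v \<Rightarrow> real \<times> real) \<Rightarrow> ('e \<Rightarrow> real \<Rightarrow> real) \<Rightarrow> 'e
       \<Rightarrow> (real \<times> real) set \<Rightarrow> bool" where
  "directly_above G pos g e c \<longleftrightarrow>
     (\<forall>x \<in> {fst (pos (tail G e)) <..< fst (pos (head G e))}.
        \<forall>\<^sub>F d in at_right 0. (x, g e x + d) \<in> c)"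

definition directly_below ::
    "('v, 'e) pre_digraph \<Rightarrow> ('v \<Rightarrow> real \<times> real) \<Rightarrow> ('e \<Rightarrow> real \<Rightarrow> real) \<Rightarrow> 'e
       \<Rightarrow> (real \<times> real) set \<Rightarrow> bool" where
  "directly_below G pos g e c \<longleftrightarrow>
     (\<forall>x \<in> {fst (pos (tail G e)) <..< fst (pos (head G e))}.
        \<forall>\<^sub>F d in at_right 0. (x, g e x - d) \<in> c)"


section \<open>The dual poset and the order polytope\<close>

text \<open>For coordinates indexed by a finite type, the regions are enumerated by a bijection
  \<open>reg\<close> from a finite type \<open>'r\<close> onto all regions. There is always an unbounded region,
  so such a type exists even if there is no bounded region; the poset \<open>P\<^sub>G\<close> consists
  of the indices of the bounded regions.\<close>

definition dual_poset :: "('r \<Rightarrow> (real \<times> real) set) \<Rightarrow> 'r set" where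
  "dual_poset reg = {r. bounded (reg r)}"

definition dual_le ::
    "('v, 'e) pre_digraph \<Rightarrow> ('v \<Rightarrow> real \<times> real) \<Rightarrow> ('e \<Rightarrow> real \<Rightarrow> real)
       \<Rightarrow> ('r \<Rightarrow> (real \<times> real) set) \<Rightarrow> ('r \<times> 'r) set" where
  "dual_le G pos g reg =
     {(p, q). p \<in> dual_poset reg \<and> q \<in> dual_poset reg \<and>
        (\<exists>e\<in>arcs G. directly_below G pos g e (reg p) \<and> directly_above G pos g e (reg q))}\<^sup>*"

text \<open>A map on \<open>P\<close> is represented by the vector that vanishes outside \<open>P\<close>.\<close>

definition order_polytope :: "'p set \<Rightarrow> ('p \<times> 'p) set \<Rightarrow> (real ^ 'p::finite) set" where
  "order_polytope P le = {f.
     (\<forall>p\<in>P. 0 \<le> f $ p \<and> f $ p \<le> 1) \<and>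
     (\<forall>p\<in>P. \<forall>q\<in>P. (p, q) \<in> le \<longrightarrow> f $ p \<le> f $ q) \<and>
     (\<forall>p. p \<notin> P \<longrightarrow> f $ p = 0)}"

text \<open>An edge with the infinite region directly above it is dual to a cover relation with
  upper element \<open>\<one>\<close>, and one with the infinite region directly below it to a cover relation
  with lower element \<open>\<zero>\<close> (the added top and bottom); their values are 1 and 0.\<close>

definition value_above ::
    "('v, 'e) pre_digraph \<Rightarrow> ('v \<Rightarrow> real \<times> real) \<Rightarrow> ('e \<Rightarrow> real \<Rightarrow> real)
       \<Rightarrow> ('r::finite \<Rightarrow> (real \<times> real) set) \<Rightarrow> real ^ 'r \<Rightarrow> 'e \<Rightarrow> real" where
  "value_above G pos g reg f e =
     (let q = (THE q. directly_above G pos g e (reg q))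
      in if q \<in> dual_poset reg then f $ q else 1)"

definition value_below ::
    "('v, 'e) pre_digraph \<Rightarrow> ('v \<Rightarrow> real \<times> real) \<Rightarrow> ('e \<Rightarrow> real \<Rightarrow> real)
       \<Rightarrow> ('r::finite \<Rightarrow> (real \<times> real) set) \<Rightarrow> real ^ 'r \<Rightarrow> 'e \<Rightarrow> real" where
  "value_below G pos g reg f e =
     (let p = (THE p. directly_below G pos g e (reg p))
      in if p \<in> dual_poset reg then f $ p else 0)"

definition flow_of_map ::
    "('v, 'e::finite) pre_digraph \<Rightarrow> ('v \<Rightarrow> real \<times> real) \<Rightarrow> ('e \<Rightarrow> real \<Rightarrow> real)
       \<Rightarrow> ('r::finite \<Rightarrow> (real \<times> real) set) \<Rightarrow> real ^ 'r \<Rightarrow> real ^ 'e" where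
  "flow_of_map G pos g reg f =
     (\<chi> e. value_above G pos g reg f e - value_below G pos g reg f e)"


section \<open>DKK triangulations\<close>

text \<open>A framing is given by two families of reflexive linear orders: \<open>I v\<close> on the incoming
  and \<open>O' v\<close> on the outgoing edges of each inner vertex \<open>v\<close>.\<close>

definition path_upto :: "('v, 'e) pre_digraph \<Rightarrow> 'v \<Rightarrow> 'e list \<Rightarrow> 'e list" where
  "path_upto G v P = takeWhile (\<lambda>e. tail G e \<noteq> v) P"

definition path_from :: "('v, 'e) pre_digraph \<Rightarrow> 'v \<Rightarrow> 'e list \<Rightarrow> 'e list" where
  "path_from G v P = dropWhile (\<lambda>e. tail G e \<noteq> v) P"

definition prec_Out ::
    "('v, 'e) pre_digraph \<Rightarrow> ('v \<Rightarrow> ('e \<times> 'e) set) \<Rightarrow> 'e list \<Rightarrow> 'e list \<Rightarrow> bool" where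
  "prec_Out G O' P Q \<longleftrightarrow> (\<exists>xs a b ps qs.
     P = xs @ a # ps \<and> Q = xs @ b # qs \<and> a \<noteq> b \<and> (a, b) \<in> O' (tail G a))"

definition prec_In ::
    "('v, 'e) pre_digraph \<Rightarrow> ('v \<Rightarrow> ('e \<times> 'e) set) \<Rightarrow> 'e list \<Rightarrow> 'e list \<Rightarrow> bool" where
  "prec_In G I P Q \<longleftrightarrow> (\<exists>xs a b ps qs.
     P = ps @ a # xs \<and> Q = qs @ b # xs \<and> a \<noteq> b \<and> (a, b) \<in> I (head G a))"

definition in_conflict ::
    "('v, 'e) pre_digraph \<Rightarrow> ('v \<Rightarrow> ('e \<times> 'e) set) \<Rightarrow> ('v \<Rightarrow> ('e \<times> 'e) set)
       \<Rightarrow> 'v \<Rightarrow> 'e list \<Rightarrow> 'e list \<Rightarrow> bool" where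
  "in_conflict G I O' v P Q \<longleftrightarrow>
     prec_In G I (path_upto G v P) (path_upto G v Q) \<and>
       prec_Out G O' (path_from G v Q) (path_from G v P) \<or>
     prec_In G I (path_upto G v Q) (path_upto G v P) \<and>
       prec_Out G O' (path_from G v P) (path_from G v Q)"

definition coherent ::
    "('v, 'e) pre_digraph \<Rightarrow> 'v \<Rightarrow> 'v \<Rightarrow> ('v \<Rightarrow> ('e \<times> 'e) set) \<Rightarrow> ('v \<Rightarrow> ('e \<times> 'e) set)
       \<Rightarrow> 'e list \<Rightarrow> 'e list \<Rightarrow> bool" where
  "coherent G s t I O' P Q \<longleftrightarrow>
     (\<forall>v \<in> inner_verts G s t.
        v \<in> set (pre_digraph.awalk_verts G s P) \<and> v \<in> set (pre_digraph.awalk_verts G s Q)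
          \<longrightarrow> \<not> in_conflict G I O' v P Q)"

definition clique ::
    "('v, 'e) pre_digraph \<Rightarrow> 'v \<Rightarrow> 'v \<Rightarrow> ('v \<Rightarrow> ('e \<times> 'e) set) \<Rightarrow> ('v \<Rightarrow> ('e \<times> 'e) set)
       \<Rightarrow> 'e list set \<Rightarrow> bool" where
  "clique G s t I O' C \<longleftrightarrow>
     (\<forall>R\<in>C. route G s t R) \<and> (\<forall>P\<in>C. \<forall>Q\<in>C. coherent G s t I O' P Q)"

text \<open>The empty clique is allowed, so the empty face belongs to the triangulation.\<close>

definition DKK_triangulation ::
    "('v, 'e::finite) pre_digraph \<Rightarrow> 'v \<Rightarrow> 'v \<Rightarrow> ('v \<Rightarrow> ('e \<times> 'e) set)
       \<Rightarrow> ('v \<Rightarrow> ('e \<times> 'e) set) \<Rightarrow> (real ^ 'e) set set" where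
  "DKK_triangulation G s t I O' = {convex hull (route_vec ` C) | C. clique G s t I O' C}"


section \<open>Equatorial flow triangulations\<close>

text \<open>A linearly ordered set of routes \<open>R\<^sub>1 < \<dots> < R\<^sub>k\<close> is a list of distinct routes.\<close>

definition route_decomposition ::
    "('v, 'e) pre_digraph \<Rightarrow> 'v \<Rightarrow> 'v \<Rightarrow> 'e list list \<Rightarrow> bool" where
  "route_decomposition G s t Rs \<longleftrightarrow>
     distinct Rs \<and> (\<forall>R \<in> set Rs. route G s t R) \<and>
     (\<forall>e \<in> arcs G. \<exists>!R. R \<in> set Rs \<and> e \<in> set R)"

definition route_order :: "'e list list \<Rightarrow> ('e \<times> 'e) set" where
  "route_order Rs =
     {(a, b). \<exists>i j. i \<le> j \<and> j < length Rs \<and> a \<in> set (Rs ! i) \<and> b \<in> set (Rs ! j)}"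

definition route_framing_in ::
    "('v, 'e) pre_digraph \<Rightarrow> 'e list list \<Rightarrow> 'v \<Rightarrow> ('e \<times> 'e) set" where
  "route_framing_in G Rs v = route_order Rs \<inter> in_arcs G v \<times> in_arcs G v"

definition route_framing_out ::
    "('v, 'e) pre_digraph \<Rightarrow> 'e list list \<Rightarrow> 'v \<Rightarrow> ('e \<times> 'e) set" where
  "route_framing_out G Rs v = route_order Rs \<inter> out_arcs G v \<times> out_arcs G v"

text \<open>Unlike \<open>facet_of\<close>, this admits the empty face, of dimension -1, as the facet of a
  single point. This matters exactly when \<open>G\<close> is a single edge.\<close>

definition polytope_facet :: "'a::euclidean_space set \<Rightarrow> 'a set \<Rightarrow> bool" where
  "polytope_facet F Q \<longleftrightarrow> F face_of Q \<and> aff_dim F = aff_dim Q - 1"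

definition equatorial_complex ::
    "('v, 'e::finite) pre_digraph \<Rightarrow> 'v \<Rightarrow> 'v \<Rightarrow> 'e list list \<Rightarrow> (real ^ 'e) set set" where
  "equatorial_complex G s t Rs =
     {F. \<exists>facet. (\<forall>R \<in> set Rs. polytope_facet (facet R) (flow_polytope G s t) \<and>
                               route_vec R \<notin> facet R) \<and>
           F face_of (\<Inter>R \<in> set Rs. facet R)}"

definition equatorial_part ::
    "('v, 'e::finite) pre_digraph \<Rightarrow> 'v \<Rightarrow> 'v \<Rightarrow> 'e list list \<Rightarrow> (real ^ 'e) set set" where
  "equatorial_part G s t Rs =
     {S \<in> DKK_triangulation G s t (route_framing_in G Rs) (route_framing_out G Rs).
        \<exists>F \<in> equatorial_complex G s t Rs. S \<subseteq> F}"

definition decomposition_simplex :: "'e list list \<Rightarrow> (real ^ 'e::finite) set" where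
  "decomposition_simplex Rs = convex hull (route_vec ` set Rs)"

definition equatorial_flow_triangulation ::
    "('v, 'e::finite) pre_digraph \<Rightarrow> 'v \<Rightarrow> 'v \<Rightarrow> 'e list list \<Rightarrow> (real ^ 'e) set set" where
  "equatorial_flow_triangulation G s t Rs =
     {S. \<exists>F \<in> equatorial_part G s t Rs. S face_of (convex hull (F \<union> decomposition_simplex Rs))}"

text \<open>The triangulation of the order polytope obtained by applying the inverse of
  \<open>flow_of_map\<close>, regarded as a map from the order polytope to the flow polytope.\<close>

definition induced_triangulation ::
    "('v, 'e::finite) pre_digraph \<Rightarrow> 'v \<Rightarrow> 'v \<Rightarrow> ('v \<Rightarrow> real \<times> real) \<Rightarrow> ('e \<Rightarrow> real \<Rightarrow> real)
       \<Rightarrow> ('r::finite \<Rightarrow> (real \<times> real) set) \<Rightarrow> 'e list list \<Rightarrow> (real ^ 'r) set set" where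
  "induced_triangulation G s t pos g reg Rs =
     (\<lambda>S. {f \<in> order_polytope (dual_poset reg) (dual_le G pos g reg).
              flow_of_map G pos g reg f \<in> S})
       ` equatorial_flow_triangulation G s t Rs"

end

theory Submission
  imports Defs
begin

text \<open>
  Let \<open>m\<close> be the minimum of a flow on a route \<open>R\<close> of the decomposition. Subtracting \<open>m\<close> times the
  indicator of \<open>R\<close>, for every \<open>R\<close>, leaves a flow that vanishes on some edge of each \<open>R\<close>; this flow is
  a unique nonnegative combination of the routes of a clique. Conversely the coefficient of \<open>R\<close> in
  any combination allowed by the equatorial triangulation is this minimum. So every flow has a
  unique decomposition, integral for integral flows, and this alone yields a unimodular
  triangulation.

  Clique decompositions exist and are unique because coherence forces the coupling of incoming
  partial paths with outgoing edges at each vertex to be the monotone one.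

  Of the drawing one only needs that a region is bounded iff there is drawing above and below each
  of its points. Summing along vertical lines then shows that maps on the regions
  give flows and are determined by them, and the indicator of the regions above a route is mapped
  to the indicator of the route, so the flow polytope is exhausted.
\<close>

section \<open>Triangulations from unique decompositions\<close>

text \<open>Why unique decompositions suffice: a point in two simplices has one weight function,
  supported in both vertex sets, so simplices meet in common faces; the positive and negative parts
  of an affine dependence would decompose one point twice; and integral coefficients for lattice
  vectors say that the edge vectors of a simplex generate the lattice. The coefficient of a
  decomposition route \<open>R\<close> is forced since some edge of \<open>R\<close> is avoided by
  every other route of the combination: the flow there equals the coefficient, and on the rest of
  \<open>R\<close> it is at least as large. Clique decompositions are produced by moving particles:
  the flow through a vertex is an interval cut into slots in framing order, and a route weighs the
  length of the set of particles that follow it. Integral flows are cut at integers only. On the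
  planar side, the parts above and below the drawing belong to one unbounded region, so the values 1
  and 0 cannot be attached to regions and are attached to points. The top value 1 makes the flow map
  affine rather than linear, hence uniqueness is asked only among weights of equal total.\<close>

lemma convex_hull_image_finite:
  fixes w :: "'i \<Rightarrow> 'a::real_vector"
  assumes "finite I"
  shows "z \<in> convex hull (w ` I) \<longleftrightarrow>
    (\<exists>a. (\<forall>i\<in>I. 0 \<le> a i) \<and> sum a I = 1 \<and> (\<Sum>i\<in>I. a i *\<^sub>R w i) = z)"
proof
  assume z: "z \<in> convex hull (w ` I)"
  \<comment> \<open>The family \<open>w\<close> may repeat values. Weights on the set of values are
    carried by one index for each value and are 0 at the other indices.\<close>
  obtain J where J: "J \<subseteq> I" "inj_on w J" "w ` I = w ` J"
    using subset_image_inj[of "w ` I" w I] by blast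
  have fin: "finite J" using J(1) assms by (rule finite_subset)
  obtain u where u: "\<forall>x\<in>w ` J. 0 \<le> u x" "sum u (w ` J) = 1" "(\<Sum>x\<in>w ` J. u x *\<^sub>R x) = z"
    using z fin unfolding J(3) by (auto simp: convex_hull_finite)
  define a where "a i = (if i \<in> J then u (w i) else 0)" for i
  have "sum a I = sum a J" "(\<Sum>i\<in>I. a i *\<^sub>R w i) = (\<Sum>i\<in>J. a i *\<^sub>R w i)"
    using J(1) assms by (intro sum.mono_neutral_right; auto simp: a_def)+
  then have "sum a I = 1" "(\<Sum>i\<in>I. a i *\<^sub>R w i) = z"
    using u(2,3) by (simp_all add: a_def sum.reindex[OF J(2)])
  moreover have "\<forall>i\<in>I. 0 \<le> a i" using u(1) by (simp add: a_def)
  ultimately show "\<exists>a. (\<forall>i\<in>I. 0 \<le> a i) \<and> sum a I = 1 \<and> (\<Sum>i\<in>I. a i *\<^sub>R w i) = z" by blast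
next
  assume "\<exists>a. (\<forall>i\<in>I. 0 \<le> a i) \<and> sum a I = 1 \<and> (\<Sum>i\<in>I. a i *\<^sub>R w i) = z"
  then show "z \<in> convex hull (w ` I)"
    using convex_sum[OF assms convex_convex_hull, of _ w "w ` I"] by (auto simp: hull_inc)
qed

text \<open>Baire's theorem: a closed piece of smaller dimension has a relatively open dense
  complement in \<open>Q\<close>, and finitely many such complements would have a dense, hence
  nonempty, intersection. Through this, a simplex of maximal dimension is seen to have the dimension
  of \<open>Q\<close>.\<close>

lemma convex_finite_cover_aff_dim:
  fixes Q :: "'a::euclidean_space set"
  assumes "convex Q" "Q \<noteq> {}" "finite \<T>" "\<Union>\<T> = Q" "\<And>S. S \<in> \<T> \<Longrightarrow> compact S"
  shows "\<exists>S\<in>\<T>. aff_dim S = aff_dim Q"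
proof (rule ccontr)
  assume "\<not> ?thesis"
  moreover have "aff_dim S \<le> aff_dim Q" if "S \<in> \<T>" for S
    using that assms(4) by (intro aff_dim_subset) auto
  ultimately have low: "aff_dim S < aff_dim Q" if "S \<in> \<T>" for S
    using that by force
  have clQ: "closed Q"
    using assms(3-5) by (metis closed_Union compact_imp_closed)
  have "Q \<subseteq> closure (\<Inter>((\<lambda>S. Q - S) ` \<T>))"
  proof (rule Baire[OF clQ])
    show "countable ((\<lambda>S. Q - S) ` \<T>)"
      using assms(3) by (simp add: countable_finite)
    fix T assume "T \<in> (\<lambda>S. Q - S) ` \<T>"
    then obtain S where S: "S \<in> \<T>" "T = Q - S" by blast
    have "closed S"
      using assms(5) S by (simp add: compact_imp_closed)
    then have "openin (top_of_set Q) T"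
      unfolding S(2) openin_open by (intro exI[of _ "- S"]) auto
    moreover have "closure (Q - S) = closure Q"
      by (rule dense_complement_convex[OF low[OF S(1)] assms(1)])
    then have "Q \<subseteq> closure T"
      unfolding S(2) using closure_subset[of Q] by (metis (full_types))
    ultimately show "openin (top_of_set Q) T \<and> Q \<subseteq> closure T" by (rule conjI)
  qed
  moreover have "\<Inter>((\<lambda>S. Q - S) ` \<T>) \<subseteq> Q - \<Union>\<T>"
    using assms(2,4) by blast
  then have "\<Inter>((\<lambda>S. Q - S) ` \<T>) = {}"
    using assms(4) by simp
  ultimately show False
    using assms(2) by simp
qed

text \<open>The positive and the negative part of an affine dependence are two nonnegative
  combinations with the same total and the same value. Uniqueness identifies them, and a number
  whose positive and negative parts agree is 0. Only weights of equal total are compared because the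
  points may be linearly dependent; one of them can be the origin.\<close>

lemma affine_independent_of_unique_decompositions:
  fixes w :: "'a \<Rightarrow> real ^ 'n" and \<D> :: "'a set set"
  assumes fin: "finite (\<Union>\<D>)"
    and down: "\<And>D D'. D \<in> \<D> \<Longrightarrow> D' \<subseteq> D \<Longrightarrow> D' \<in> \<D>"
    and unique: "\<And>a b. (\<forall>P. 0 \<le> a P) \<Longrightarrow> (\<forall>P. 0 \<le> b P) \<Longrightarrow>
        {P. a P \<noteq> 0} \<in> \<D> \<Longrightarrow> {P. b P \<noteq> 0} \<in> \<D> \<Longrightarrow>
        (\<Sum>P\<in>\<Union>\<D>. a P *\<^sub>R w P) = (\<Sum>P\<in>\<Union>\<D>. b P *\<^sub>R w P) \<Longrightarrow>
        sum a (\<Union>\<D>) = sum b (\<Union>\<D>) \<Longrightarrow> a = b"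
  shows "inj_on w (\<Union>\<D>)" and "\<And>D. D \<in> \<D> \<Longrightarrow> \<not> affine_dependent (w ` D)"
proof -
  define X where "X = \<Union>\<D>"
  have finX: "finite X" using fin by (simp add: X_def)
  have sub: "D \<subseteq> X" and finD: "finite D" if "D \<in> \<D>" for D
    using that finX by (auto simp: X_def intro: finite_subset)
  have restr: "(\<Sum>P\<in>X. (if P \<in> D then c P else 0) *\<^sub>R w P) = (\<Sum>P\<in>D. c P *\<^sub>R w P)"
    "(\<Sum>P\<in>X. if P \<in> D then c P else 0) = sum c D" if "D \<in> \<D>" for D and c :: "'a \<Rightarrow> real"
    using sub[OF that] finX
    by (auto intro!: sum.mono_neutral_cong_right)
  have injX: "inj_on w X"
  proof (rule inj_onI)
    fix P P' assume P: "P \<in> X" "P' \<in> X" "w P = w P'"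
    then have in\<D>: "{P} \<in> \<D>" "{P'} \<in> \<D>" by (auto simp: X_def intro: down)
    have "(\<lambda>x. if x \<in> {P} then 1 else 0) = (\<lambda>x. if x \<in> {P'} then 1 else 0::real)"
      by (rule unique, unfold X_def[symmetric])
        (use in\<D> P restr[of "{P}" "\<lambda>_. 1"] restr[of "{P'}" "\<lambda>_. 1"] in auto)
    then show "P = P'"
      by (metis (no_types, lifting) singletonD singletonI zero_neq_one)
  qed
  have injD: "inj_on w D" if "D \<in> \<D>" for D
    using injX sub[OF that] by (rule inj_on_subset)
  have indep: "\<not> affine_dependent (w ` D)" if D: "D \<in> \<D>" for D
  proof
    assume "affine_dependent (w ` D)"
    then obtain U where U: "sum U (w ` D) = 0" "\<exists>v\<in>w ` D. U v \<noteq> 0"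
        "(\<Sum>v\<in>w ` D. U v *\<^sub>R v) = 0"
      using finD[OF D] by (auto simp: affine_dependent_explicit_finite)
    define c where "c P = U (w P)" for P
    have c: "sum c D = 0" "(\<Sum>P\<in>D. c P *\<^sub>R w P) = 0"
      using U(1,3) injD[OF D] by (simp_all add: sum.reindex c_def)
    have "(\<lambda>P. if P \<in> D then max (c P) 0 else 0) = (\<lambda>P. if P \<in> D then max (- c P) 0 else 0)"
    proof (rule unique, unfold X_def[symmetric])
      show "{P. (if P \<in> D then max (c P) 0 else 0) \<noteq> 0} \<in> \<D>"
        "{P. (if P \<in> D then max (- c P) 0 else 0) \<noteq> 0} \<in> \<D>"
        by (rule down[OF D], auto split: if_splits)+
      have eq: "max r 0 - max (- r) 0 = r" for r :: real by linarith
      have "(\<Sum>P\<in>D. max (c P) 0 *\<^sub>R w P) - (\<Sum>P\<in>D. max (- c P) 0 *\<^sub>R w P) = 0"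
        by (simp add: sum_subtractf[symmetric] scaleR_diff_left[symmetric] eq c)
      then show "(\<Sum>P\<in>X. (if P \<in> D then max (c P) 0 else 0) *\<^sub>R w P) =
          (\<Sum>P\<in>X. (if P \<in> D then max (- c P) 0 else 0) *\<^sub>R w P)"
        by (simp add: restr[OF D])
      have "(\<Sum>P\<in>D. max (c P) 0) - (\<Sum>P\<in>D. max (- c P) 0) = 0"
        by (simp add: sum_subtractf[symmetric] eq c)
      then show "(\<Sum>P\<in>X. if P \<in> D then max (c P) 0 else 0) =
          (\<Sum>P\<in>X. if P \<in> D then max (- c P) 0 else 0)"
        by (simp add: restr[OF D])
    qed auto
    then have "c P = 0" if "P \<in> D" for P
      using that by (drule_tac x = P in fun_cong) (auto simp: max_def split: if_splits)
    with U(2) show False by (auto simp: c_def)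
  qed
  show "inj_on w (\<Union>\<D>)" using injX by (simp add: X_def)
  show "\<not> affine_dependent (w ` D)" if "D \<in> \<D>" for D using that by (rule indep)
qed

text \<open>Uniqueness makes two simplices meet in the hull of their common vertices. For the
  lattice condition, a simplex of maximal dimension spans the affine hull of \<open>Q\<close>, so
  each lattice vector is a combination of its vertices with total 0, and \<open>integral\<close>
  makes the coefficients integers.\<close>

lemma unimodular_triangulation_of_unique_decompositions:
  fixes w :: "'a \<Rightarrow> real ^ 'n" and \<D> :: "'a set set"
  assumes fin: "finite (\<Union>\<D>)"
    and down: "\<And>D D'. D \<in> \<D> \<Longrightarrow> D' \<subseteq> D \<Longrightarrow> D' \<in> \<D>"
    and convQ: "convex Q" and neQ: "Q \<noteq> {}"
    and inQ: "\<And>P. P \<in> \<Union>\<D> \<Longrightarrow> w P \<in> Q"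
    and int: "\<And>P i. P \<in> \<Union>\<D> \<Longrightarrow> w P $ i \<in> \<int>"
    and cover: "\<And>x. x \<in> Q \<Longrightarrow> \<exists>D\<in>\<D>. x \<in> convex hull (w ` D)"
    and unique: "\<And>a b. (\<forall>P. 0 \<le> a P) \<Longrightarrow> (\<forall>P. 0 \<le> b P) \<Longrightarrow>
        {P. a P \<noteq> 0} \<in> \<D> \<Longrightarrow> {P. b P \<noteq> 0} \<in> \<D> \<Longrightarrow>
        (\<Sum>P\<in>\<Union>\<D>. a P *\<^sub>R w P) = (\<Sum>P\<in>\<Union>\<D>. b P *\<^sub>R w P) \<Longrightarrow>
        sum a (\<Union>\<D>) = sum b (\<Union>\<D>) \<Longrightarrow> a = b"
    and integral: "\<And>D c P. D \<in> \<D> \<Longrightarrow> sum c D = 0 \<Longrightarrow>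
        (\<forall>i. (\<Sum>P\<in>D. c P *\<^sub>R w P) $ i \<in> \<int>) \<Longrightarrow> P \<in> D \<Longrightarrow> c P \<in> \<int>"
  shows "unimodular_triangulation {convex hull (w ` D) | D. D \<in> \<D>} Q"
proof -
  define X where "X = \<Union>\<D>"
  let ?T = "{convex hull (w ` D) | D. D \<in> \<D>}"
  have finX: "finite X" using fin by (simp add: X_def)
  have sub: "D \<subseteq> X" and finD: "finite D" if "D \<in> \<D>" for D
    using that finX by (auto simp: X_def intro: finite_subset)
  have restr: "(\<Sum>P\<in>X. (if P \<in> D then c P else 0) *\<^sub>R w P) = (\<Sum>P\<in>D. c P *\<^sub>R w P)"
    "(\<Sum>P\<in>X. if P \<in> D then c P else 0) = sum c D" if "D \<in> \<D>" for D and c :: "'a \<Rightarrow> real"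
    using sub[OF that] finX
    by (auto intro!: sum.mono_neutral_cong_right)
  have injX: "inj_on w X"
    unfolding X_def by (rule affine_independent_of_unique_decompositions(1)[OF fin down unique])
  have injD: "inj_on w D" if "D \<in> \<D>" for D
    using injX sub[OF that] by (rule inj_on_subset)
  have indep: "\<not> affine_dependent (w ` D)" if "D \<in> \<D>" for D
    by (rule affine_independent_of_unique_decompositions(2)[OF fin down unique that])
  have hull: "x \<in> convex hull (w ` D) \<longleftrightarrow>
      (\<exists>a. (\<forall>P. 0 \<le> a P) \<and> {P. a P \<noteq> 0} \<subseteq> D \<and> sum a X = 1 \<and> (\<Sum>P\<in>X. a P *\<^sub>R w P) = x)"
    if D: "D \<in> \<D>" for D x
  proof
    assume "x \<in> convex hull (w ` D)"
    then obtain u where u: "\<forall>v\<in>w ` D. 0 \<le> u v" "sum u (w ` D) = 1" "(\<Sum>v\<in>w ` D. u v *\<^sub>R v) = x"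
      using finD[OF D] by (auto simp: convex_hull_finite)
    let ?a = "\<lambda>P. if P \<in> D then u (w P) else 0"
    have "(\<forall>P. 0 \<le> ?a P) \<and> {P. ?a P \<noteq> 0} \<subseteq> D \<and> sum ?a X = 1 \<and> (\<Sum>P\<in>X. ?a P *\<^sub>R w P) = x"
      using u injD[OF D] by (simp add: restr[OF D] sum.reindex) auto
    then show "\<exists>a. (\<forall>P. 0 \<le> a P) \<and> {P. a P \<noteq> 0} \<subseteq> D \<and> sum a X = 1 \<and> (\<Sum>P\<in>X. a P *\<^sub>R w P) = x"
      by (intro exI[of _ ?a])
  next
    assume "\<exists>a. (\<forall>P. 0 \<le> a P) \<and> {P. a P \<noteq> 0} \<subseteq> D \<and> sum a X = 1 \<and> (\<Sum>P\<in>X. a P *\<^sub>R w P) = x"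
    then obtain a where a: "\<forall>P. 0 \<le> a P" "{P. a P \<noteq> 0} \<subseteq> D" "sum a X = 1"
        "(\<Sum>P\<in>X. a P *\<^sub>R w P) = x" by (elim exE conjE)
    have "sum a D = sum a X" "(\<Sum>P\<in>D. a P *\<^sub>R w P) = (\<Sum>P\<in>X. a P *\<^sub>R w P)"
      using a(2) sub[OF D] finX by (auto intro!: sum.mono_neutral_left)
    with a(3,4) have "sum a D = 1" "(\<Sum>P\<in>D. a P *\<^sub>R w P) = x"
      by simp_all
    then show "x \<in> convex hull (w ` D)"
      using convex_sum[OF finD[OF D] convex_convex_hull, of a w "w ` D"] a(1)
      by (simp add: hull_inc)
  qed
  have inter: "convex hull (w ` D1) \<inter> convex hull (w ` D2) = convex hull (w ` (D1 \<inter> D2))"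
    if D: "D1 \<in> \<D>" "D2 \<in> \<D>" for D1 D2
  proof
    show "convex hull (w ` (D1 \<inter> D2)) \<subseteq> convex hull (w ` D1) \<inter> convex hull (w ` D2)"
      by (intro Int_greatest hull_mono) auto
    show "convex hull (w ` D1) \<inter> convex hull (w ` D2) \<subseteq> convex hull (w ` (D1 \<inter> D2))"
    proof
      fix x assume "x \<in> convex hull (w ` D1) \<inter> convex hull (w ` D2)"
      then obtain a b where a: "\<forall>P. 0 \<le> a P" "{P. a P \<noteq> 0} \<subseteq> D1" "sum a X = 1"
          "(\<Sum>P\<in>X. a P *\<^sub>R w P) = x"
        and b: "\<forall>P. 0 \<le> b P" "{P. b P \<noteq> 0} \<subseteq> D2" "sum b X = 1"
          "(\<Sum>P\<in>X. b P *\<^sub>R w P) = x"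
        using hull[OF D(1)] hull[OF D(2)] by blast
      have "a = b"
        by (rule unique, unfold X_def[symmetric]) (use a b down D in auto)
      moreover have "D1 \<inter> D2 \<in> \<D>" using D by (auto intro: down)
      ultimately show "x \<in> convex hull (w ` (D1 \<inter> D2))"
        using a b by (subst hull) auto
    qed
  qed
  have finT: "finite ?T"
  proof -
    have "\<D> \<subseteq> Pow X" by (auto simp: X_def)
    then have "finite \<D>" using finX by (meson finite_Pow_iff finite_subset)
    then show ?thesis by (simp add: Setcompr_eq_image)
  qed
  have UT: "\<Union>?T = Q"
  proof
    show "Q \<subseteq> \<Union>?T" using cover by blast
    have "convex hull (w ` D) \<subseteq> Q" if "D \<in> \<D>" for D
      using that inQ by (intro hull_minimal convQ) auto
    then show "\<Union>?T \<subseteq> Q" by blast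
  qed
  have simpl: "simplicial_complex ?T"
    unfolding simplicial_complex_def
  proof (intro conjI ballI allI impI)
    show "finite ?T" by (fact finT)
  next
    fix S assume "S \<in> ?T"
    then obtain D where D: "D \<in> \<D>" "S = convex hull (w ` D)" by blast
    show "\<exists>n. n simplex S"
      unfolding simplex_def
      by (rule exI[of _ "int (card (w ` D)) - 1"], rule exI[of _ "w ` D"])
        (use D indep in auto)
  next
    fix F S assume "S \<in> ?T \<and> F face_of S"
    then obtain D where D: "D \<in> \<D>" "F face_of convex hull (w ` D)" by blast
    then obtain c where c: "c \<subseteq> w ` D" "F = convex hull c"
      using face_of_convex_hull_affine_independent[OF indep] by blast
    then obtain D' where "D' \<subseteq> D" "c = w ` D'" by (auto simp: subset_image_iff)
    with D c show "F \<in> ?T" using down by blast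
  next
    fix S S' assume "S \<in> ?T \<and> S' \<in> ?T"
    then obtain D D' where D: "D \<in> \<D>" "D' \<in> \<D>"
      and S: "S = convex hull (w ` D)" "S' = convex hull (w ` D')" by blast
    have "w ` (D \<inter> D') \<subseteq> w ` D" by blast
    then show "S \<inter> S' face_of S"
      unfolding S inter[OF D] face_of_convex_hull_affine_independent[OF indep[OF D(1)]]
      by auto
  qed
  have "lattice_basis ((\<lambda>v. v - v0) ` (C - {v0})) (parallel_lattice Q)"
    if C: "\<not> affine_dependent C" "convex hull C \<in> ?T"
      and maximal: "\<forall>S\<in>?T. aff_dim S \<le> aff_dim (convex hull C)" and v0: "v0 \<in> C" for C v0
  proof -
    obtain D where D: "D \<in> \<D>" "convex hull C = convex hull (w ` D)" using C(2) by blast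
    \<comment> \<open>The vertices are recovered from the hull as its extreme points.\<close>
    have CD: "C = w ` D"
      using extreme_point_of_convex_hull_affine_independent[OF C(1)]
        extreme_point_of_convex_hull_affine_independent[OF indep[OF D(1)]] D(2) by auto
    obtain P0 where P0: "P0 \<in> D" "v0 = w P0" using v0 CD by blast
    obtain S where S: "S \<in> ?T" "aff_dim S = aff_dim Q"
    proof -
      have "compact S" if "S \<in> ?T" for S
        using that finD by (auto intro: finite_imp_compact_convex_hull)
      then show thesis
        using convex_finite_cover_aff_dim[OF convQ neQ finT UT] that by blast
    qed
    have CQ: "C \<subseteq> Q"
      using inQ D(1) CD by blast
    have "aff_dim Q \<le> aff_dim C"
      using maximal[rule_format, OF S(1)] S(2) by (simp only: aff_dim_convex_hull)
    then have aff: "affine hull C = affine hull Q"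
      using v0 aff_dim_subset[OF CQ] hull_mono[OF CQ, of affine]
      by (intro affine_dim_equal) auto
    let ?B = "(\<lambda>v. v - v0) ` (C - {v0})"
    have Beq: "(\<lambda>x. - v0 + x) ` (C - {v0}) = ?B" by simp
    have indB: "independent ?B"
      using affine_dependent_iff_dependent2[OF v0] C(1) by (simp add: Beq)
    have affB: "affine hull Q = (+) v0 ` span ?B"
      using affine_hull_span2[OF v0] by (simp add: Beq aff)
    have finB: "finite ?B"
      using finD[OF D(1)] CD by simp
    have injB: "inj_on (\<lambda>P. w P - v0) (D - {P0})"
      using injD[OF D(1)] by (auto simp: inj_on_def)
    have BD: "?B = (\<lambda>P. w P - v0) ` (D - {P0})"
      using injD[OF D(1)] P0 CD by (auto simp: inj_on_def)
    have "parallel_lattice Q = {(\<Sum>b\<in>?B. real_of_int (c b) *\<^sub>R b) | c. True}"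
    proof (intro equalityI subsetI)
      fix z assume "z \<in> parallel_lattice Q"
      then obtain x y where z: "z = x - y" "x \<in> affine hull Q" "y \<in> affine hull Q"
        "\<forall>i. z $ i \<in> \<int>" by (auto simp: parallel_lattice_def)
      then have "z \<in> span ?B"
        by (auto simp: affB intro: span_diff)
      then obtain u where u: "z = (\<Sum>b\<in>?B. u b *\<^sub>R b)"
        using span_finite[OF finB] by auto
      define u' where "u' P = u (w P - v0)" for P
      \<comment> \<open>A combination of difference vectors becomes one of the vertices themselves
        once \<open>P0\<close> takes minus the sum of the other coefficients. The total is then 0,
        as \<open>integral\<close> asks.\<close>
      define c where "c P = (if P = P0 then - sum u' (D - {P0}) else u' P)" for P
      have c0: "sum c D = 0"
        using P0(1) finD[OF D(1)] by (simp add: c_def sum.remove)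
      have zsum: "z = (\<Sum>P\<in>D - {P0}. u' P *\<^sub>R (w P - v0))"
        using u unfolding BD sum.reindex[OF injB] by (simp add: u'_def)
      also have "\<dots> = (\<Sum>P\<in>D. c P *\<^sub>R w P)"
        using P0 finD[OF D(1)]
        by (simp add: c_def sum.remove scaleR_diff_right sum_subtractf scaleR_left.sum)
      finally have "c P \<in> \<int>" if "P \<in> D" for P
        using integral[OF D(1) c0 _ that] z(4) by simp
      then have "u' P \<in> \<int>" if "P \<in> D - {P0}" for P
        using that by (metis Diff_iff c_def singletonI)
      then have "u b \<in> \<int>" if "b \<in> ?B" for b
        using that unfolding BD u'_def by blast
      then have "u b = real_of_int \<lfloor>u b\<rfloor>" if "b \<in> ?B" for b
        using that by simp
      then have "z = (\<Sum>b\<in>?B. real_of_int \<lfloor>u b\<rfloor> *\<^sub>R b)"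
        unfolding u by (intro sum.cong refl) presburger
      then show "z \<in> {(\<Sum>b\<in>?B. real_of_int (c b) *\<^sub>R b) | c. True}"
        by (auto intro: exI[of _ "\<lambda>b. \<lfloor>u b\<rfloor>"])
    next
      fix z assume "z \<in> {(\<Sum>b\<in>?B. real_of_int (c b) *\<^sub>R b) | c. True}"
      then obtain c where z: "z = (\<Sum>b\<in>?B. real_of_int (c b) *\<^sub>R b)" by blast
      have "z \<in> span ?B" unfolding z by (intro span_sum span_scale span_base)
      then have "v0 + z \<in> affine hull Q" unfolding affB by (rule imageI)
      moreover have "v0 \<in> affine hull Q"
        using v0 aff by (metis hull_inc)
      moreover have "z $ i \<in> \<int>" for i
      proof -
        have "w P $ i \<in> \<int>" if "P \<in> D" for P
          using that D(1) int by blast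
        then have "b $ i \<in> \<int>" if "b \<in> ?B" for b
          using that P0 unfolding BD by (auto intro!: Ints_diff)
        then show ?thesis
          unfolding z by (simp add: Ints_sum Ints_mult)
      qed
      ultimately show "z \<in> parallel_lattice Q"
        unfolding parallel_lattice_def
        by (intro IntI CollectI exI[of _ "v0 + z"] exI[of _ v0]) auto
    qed
    with indB show ?thesis by (simp add: lattice_basis_def)
  qed
  with simpl UT show ?thesis
    unfolding unimodular_triangulation_def by blast
qed

text \<open>A nonempty proper face is the intersection of the facets containing it, so one of these
  misses \<open>v\<close>. The empty face is first enlarged to a vertex other than \<open>v\<close>;
  if \<open>Q\<close> is the single point \<open>v\<close>, the empty set itself is a facet in the
  sense of \<open>polytope_facet\<close>.\<close>

lemma polytope_facet_avoiding:
  fixes Q :: "'a::euclidean_space set"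
  assumes "polytope Q" "c face_of Q" "v \<in> Q" "v \<notin> c"
  shows "\<exists>F. polytope_facet F Q \<and> c \<subseteq> F \<and> v \<notin> F"
proof -
  have avoid: "\<exists>F. polytope_facet F Q \<and> c' \<subseteq> F \<and> v \<notin> F"
    if c': "c' face_of Q" "v \<notin> c'" "c' \<noteq> {}" for c'
  proof -
    have "c' = \<Inter>{F. F facet_of Q \<and> c' \<subseteq> F}"
      using c' assms by (intro face_of_polyhedron polytope_imp_polyhedron) auto
    then obtain F where "F facet_of Q" "c' \<subseteq> F" "v \<notin> F" using c'(2) by blast
    then show ?thesis by (auto simp: polytope_facet_def facet_of_def)
  qed
  show ?thesis
  proof (cases "c = {}")
    case False then show ?thesis using avoid assms by blast
  next
    case True
    show ?thesis
    proof (cases "Q = {v}")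
      case True
      then show ?thesis using \<open>c = {}\<close>
        by (auto simp: polytope_facet_def intro!: exI[of _ "{}"])
    next
      case False
      have "\<exists>u. u extreme_point_of Q \<and> u \<noteq> v"
      proof (rule ccontr)
        assume "\<not> ?thesis"
        then have "{x. x extreme_point_of Q} \<subseteq> {v}" by blast
        moreover have "Q = convex hull {x. x extreme_point_of Q}"
          using assms(1) by (intro Krein_Milman_Minkowski polytope_imp_compact polytope_imp_convex)
        ultimately have "Q \<subseteq> {v}" by (metis convex_hull_singleton hull_mono)
        with False assms(3) show False by blast
      qed
      then obtain u where "u extreme_point_of Q" "u \<noteq> v" by blast
      then show ?thesis
        using avoid[of "{u}"] \<open>c = {}\<close> by (auto simp: face_of_singleton)
    qed
  qed
qed

section \<open>Monotone decompositions of flows\<close>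

text \<open>Induction by increasing label: the new element has the largest label, so its interval is
  appended at the right end and the earlier intervals do not move.\<close>

lemma finite_consecutive_intervals:
  fixes y :: "'a \<Rightarrow> real" and l :: "'a \<Rightarrow> nat"
  assumes "finite F" "inj_on l F" "\<And>e. e \<in> F \<Longrightarrow> 0 \<le> y e"
  shows "(\<Union>e\<in>F. {\<Sum>e' | e' \<in> F \<and> l e' < l e. y e' ..<
      (\<Sum>e' | e' \<in> F \<and> l e' < l e. y e') + y e}) = {0..<sum y F}"
  using assms
proof (induction F rule: finite_ranking_induct[where f = l])
  case (insert x F)
  show ?case
  proof (cases "x \<in> F")
    case True
    with insert show ?thesis by (simp add: insert_absorb)
  next
    case False
    then have less: "l e < l x" if "e \<in> F" for e
      using that insert.hyps(2)[OF that] insert.prems(1) by (auto simp: inj_on_def le_less)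
    then have 1: "{e'. e' \<in> insert x F \<and> l e' < l e} = {e'. e' \<in> F \<and> l e' < l e}" if "e \<in> F" for e
      using that by force
    have IH: "(\<Union>e\<in>F. {\<Sum>e' | e' \<in> F \<and> l e' < l e. y e' ..<
        (\<Sum>e' | e' \<in> F \<and> l e' < l e. y e') + y e}) = {0..<sum y F}"
      using insert.prems by (intro insert.IH) auto
    have 2: "{e'. e' \<in> insert x F \<and> l e' < l x} = F"
      using less by auto
    have "(\<Union>e\<in>insert x F. {\<Sum>e' | e' \<in> insert x F \<and> l e' < l e. y e' ..<
        (\<Sum>e' | e' \<in> insert x F \<and> l e' < l e. y e') + y e}) =
        {sum y F..<sum y F + y x} \<union> {0..<sum y F}"
    proof -
      have "(\<Union>e\<in>F. {\<Sum>e' | e' \<in> insert x F \<and> l e' < l e. y e' ..<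
          (\<Sum>e' | e' \<in> insert x F \<and> l e' < l e. y e') + y e}) = {0..<sum y F}"
        using IH by (simp add: 1 del: insert_iff)
      then show ?thesis by (simp only: UN_insert 2)
    qed
    also have "\<dots> = {0..<sum y (insert x F)}"
    proof -
      have "0 \<le> sum y F" "0 \<le> y x" using insert.prems by (auto intro: sum_nonneg)
      then show ?thesis using insert.hyps(1) False by auto
    qed
    finally show ?thesis .
  qed
qed simp

text \<open>Uniqueness of the monotone (northwest corner) coupling with given marginals, at the
  first entry where two couplings differ. An excess of \<open>M\<close> there is compensated by an
  entry where \<open>M'\<close> is larger further along the row, and by another further down the
  column. Both entries of \<open>M'\<close> are positive, and their positions contradict its
  monotonicity.\<close>

lemma coupling_not_greater:
  fixes M M' :: "'a \<Rightarrow> 'b \<Rightarrow> real" and l :: "'b \<Rightarrow> nat" and lt :: "'a \<Rightarrow> 'a \<Rightarrow> bool"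
  assumes fin: "finite S" "finite F"
    and nonneg: "\<And>q h. q \<in> S \<Longrightarrow> h \<in> F \<Longrightarrow> 0 \<le> M q h"
    and rows: "(\<Sum>h\<in>F. M q h) = (\<Sum>h\<in>F. M' q h)"
    and cols: "(\<Sum>q\<in>S. M q h) = (\<Sum>q\<in>S. M' q h)"
    and mono: "\<And>q q' h h'. q \<in> S \<Longrightarrow> q' \<in> S \<Longrightarrow> h \<in> F \<Longrightarrow> h' \<in> F \<Longrightarrow> lt q q' \<Longrightarrow>
      0 < M' q h \<Longrightarrow> 0 < M' q' h' \<Longrightarrow> l h \<le> l h'"
    and q: "q \<in> S" "\<And>q'. q' \<in> S \<Longrightarrow> q' \<noteq> q \<Longrightarrow> M q' h \<noteq> M' q' h \<Longrightarrow> lt q q'"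
    and h: "h \<in> F" "\<And>h'. h' \<in> F \<Longrightarrow> h' \<noteq> h \<Longrightarrow> M q h' \<noteq> M' q h' \<Longrightarrow> l h < l h'"
  shows "M q h \<le> M' q h"
proof (rule ccontr)
  assume "\<not> ?thesis"
  then have gt: "M' q h < M q h" by simp
  have "\<exists>h'\<in>F. M q h' < M' q h'"
  proof (rule ccontr)
    assume "\<not> ?thesis"
    then have "(\<Sum>h\<in>F. M' q h) < (\<Sum>h\<in>F. M q h)"
      using gt h(1) fin by (intro sum_strict_mono_ex1) (auto simp: not_less)
    with rows show False by simp
  qed
  then obtain h' where h': "h' \<in> F" "M q h' < M' q h'" by blast
  have "\<exists>q'\<in>S. M q' h < M' q' h"
  proof (rule ccontr)
    assume "\<not> ?thesis"
    then have "(\<Sum>q\<in>S. M' q h) < (\<Sum>q\<in>S. M q h)"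
      using gt q(1) fin by (intro sum_strict_mono_ex1) (auto simp: not_less)
    with cols show False by simp
  qed
  then obtain q' where q': "q' \<in> S" "M q' h < M' q' h" by blast
  have "0 < M' q h'" "0 < M' q' h"
    using nonneg[OF q(1) h'(1)] nonneg[OF q'(1) h(1)] h'(2) q'(2) by linarith+
  moreover have "lt q q'"
    using q(2)[OF q'(1)] gt q'(2) by (cases "q' = q") auto
  ultimately have "l h' \<le> l h"
    using mono[OF q(1) q'(1) h'(1) h(1)] by blast
  moreover have "l h < l h'"
    using h(2)[OF h'(1)] gt h'(2) by (cases "h' = h") auto
  ultimately show False by simp
qed

section \<open>Paths in an acyclic graph with one source and one sink\<close>

locale st_dag = fin_digraph G for G :: "('v, 'e::finite) pre_digraph" +
  fixes s t :: 'v
  assumes arcs_UNIV: "arcs G = UNIV"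
    and acyc: "acyclic (arcs_ends G)"
    and source: "unique_source G s"
    and sink: "unique_sink G t"
begin

declare awalk_append_iff [simp del]

lemma awalk_append: "awalk u (p @ q) v \<longleftrightarrow> (\<exists>w. awalk u p w \<and> awalk w q v)"
  by (metis awalk_append_iff awalk_appendI)

lemma awalk_Cons: "awalk u (e # q) v \<longleftrightarrow> tail G e = u \<and> awalk (head G e) q v"
  by (auto simp: awalk_Cons_iff arcs_UNIV)

lemma arc_in_ends: "(tail G e, head G e) \<in> arcs_ends G"
  by (rule in_arcs_imp_in_arcs_ends) (simp add: arcs_UNIV)

lemma awalk_snoc: "awalk u (p @ [e]) v \<longleftrightarrow> awalk u p (tail G e) \<and> head G e = v"
  by (auto simp: awalk_append awalk_Cons awalk_Nil_iff arcs_UNIV)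

lemma awalk_trancl:
  assumes "awalk u p v" "p \<noteq> []"
  shows "(u, v) \<in> (arcs_ends G)\<^sup>+"
  using assms
proof (induction p arbitrary: v rule: rev_induct)
  case (snoc e p)
  show ?case
    using snoc arc_in_ends[of e] by (cases "p = []") (auto simp: awalk_snoc awalk_Nil_iff intro: trancl_into_trancl)
qed simp

lemma awalk_loop: "awalk u p u \<Longrightarrow> p = []"
  using awalk_trancl acyc by (auto simp: acyclic_def)

text \<open>A repeated vertex would enclose a nonempty closed walk.\<close>

lemma awalk_apath: "apath u p v \<longleftrightarrow> awalk u p v"
proof
  assume p: "awalk u p v"
  have "distinct (awalk_verts u p)"
  proof (rule ccontr)
    assume "\<not> ?thesis"
    from awalk_not_distinct_decomp[OF p this]
    obtain q r s where "r \<noteq> []" "\<exists>w. awalk w r w"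
      by (auto simp: closed_w_def)
    then show False using awalk_loop by blast
  qed
  with p show "apath u p v" by (simp add: apath_def)
qed (rule awalkI_apath)

lemma route_iff: "route G s t R \<longleftrightarrow> awalk s R t"
  by (simp add: route_def awalk_apath)

lemma finite_awalks: "finite {p. awalk u p v}"
  using apaths_finite by (simp add: awalk_apath)

lemma s_in: "s \<in> verts G" "in_arcs G s = {}"
  using source unfolding unique_source_def by blast+

lemma t_in: "t \<in> verts G" "out_arcs G t = {}"
  using sink unfolding unique_sink_def by blast+

lemma head_ne_s: "head G e \<noteq> s"
  using s_in(2) by (auto simp: in_arcs_def arcs_UNIV)

lemma tail_ne_t: "tail G e \<noteq> t"
  using t_in(2) by (auto simp: out_arcs_def arcs_UNIV)

lemma in_verts: "head G e \<in> verts G" "tail G e \<in> verts G"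
  by (simp_all add: arcs_UNIV)

lemma in_out_iff: "e \<in> in_arcs G v \<longleftrightarrow> head G e = v" "e \<in> out_arcs G v \<longleftrightarrow> tail G e = v"
  by (auto simp: arcs_UNIV)

lemma arc_into: "v \<in> verts G \<Longrightarrow> v \<noteq> s \<Longrightarrow> \<exists>e. head G e = v"
  using source in_out_iff(1)[of _ v] unfolding unique_source_def by blast

lemma arc_out_of: "v \<in> verts G \<Longrightarrow> v \<noteq> t \<Longrightarrow> \<exists>e. tail G e = v"
  using sink in_out_iff(2)[of _ v] unfolding unique_sink_def by blast

lemma wf_arcs: "wf (arcs_ends G)" "wf ((arcs_ends G)\<inverse>)"
  using acyc by (auto intro: finite_acyclic_wf finite_acyclic_wf_converse simp: arcs_ends_def)

lemma vertex_induct_up: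
  assumes "\<And>v. (\<And>e. head G e = v \<Longrightarrow> P (tail G e)) \<Longrightarrow> P v"
  shows "P v"
proof (induction v rule: wf_induct_rule[OF wf_arcs(1)])
  case (1 v)
  show ?case
  proof (rule assms)
    fix e assume "head G e = v"
    then show "P (tail G e)" using 1 arc_in_ends[of e] by auto
  qed
qed

lemma vertex_induct_down:
  assumes "\<And>v. (\<And>e. tail G e = v \<Longrightarrow> P (head G e)) \<Longrightarrow> P v"
  shows "P v"
proof (induction v rule: wf_induct_rule[OF wf_arcs(2)])
  case (1 v)
  show ?case
  proof (rule assms)
    fix e assume "tail G e = v"
    then show "P (head G e)" using 1 arc_in_ends[of e] by auto
  qed
qed

lemma awalk_from_s: "v \<in> verts G \<Longrightarrow> \<exists>p. awalk s p v"
proof (induction v rule: vertex_induct_up)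
  case (1 v)
  show ?case
  proof (cases "v = s")
    case True
    then show ?thesis using s_in by (auto simp: awalk_simps intro: exI[of _ "[]"])
  next
    case False
    then obtain e where e: "head G e = v" using arc_into[OF 1(2)] by blast
    then obtain p where "awalk s p (tail G e)" using 1(1) in_verts by blast
    with e have "awalk s (p @ [e]) v" by (simp add: awalk_snoc)
    then show ?thesis by blast
  qed
qed

lemma awalk_to_t: "v \<in> verts G \<Longrightarrow> \<exists>p. awalk v p t"
proof (induction v rule: vertex_induct_down)
  case (1 v)
  show ?case
  proof (cases "v = t")
    case True
    then show ?thesis using t_in by (auto simp: awalk_simps intro: exI[of _ "[]"])
  next
    case False
    then obtain e where e: "tail G e = v" using arc_out_of[OF 1(2)] by blast
    then obtain p where "awalk (head G e) p t" using 1(1) in_verts by blast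
    with e have "awalk v (e # p) t" by (simp add: awalk_simps arcs_UNIV)
    then show ?thesis by blast
  qed
qed

lemma s_ne_t: "s \<noteq> t"
proof -
  \<comment> \<open>Types are nonempty, so there is an edge. A route through it is a nonempty walk,
    and by acyclicity it cannot be closed.\<close>
  obtain e :: 'e where True by blast
  obtain p where "awalk s p (tail G e)" using awalk_from_s in_verts by blast
  moreover obtain q where "awalk (head G e) q t" using awalk_to_t in_verts by blast
  ultimately have "awalk s (p @ e # q) t"
    by (auto simp: awalk_append awalk_Cons)
  then show ?thesis using awalk_loop[of s "p @ e # q"] by auto
qed

lemma awalk_from_s_Nil: "awalk s p s \<longleftrightarrow> p = []"
  using awalk_loop s_in by (auto simp: awalk_simps)

lemma awalk_distinct: "awalk u p v \<Longrightarrow> distinct p"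
  by (metis distinct_verts_imp_distinct awalk_apath apath_def)

lemma awalk_split_unique:
  assumes "awalk u (p @ e # q) v" "p @ e # q = p' @ e # q'"
  shows "p = p' \<and> q = q'"
proof -
  have "distinct (p @ e # q)"
    using assms(1) by (rule awalk_distinct)
  then have "e \<notin> set p" "e \<notin> set q" by auto
  then show ?thesis
    using assms(2) append_Cons_eq_iff[of e p q p' q'] by simp
qed

definition conserved :: "('e \<Rightarrow> real) \<Rightarrow> bool" where
  "conserved y \<longleftrightarrow> (\<forall>v\<in>inner_verts G s t. sum y (in_arcs G v) = sum y (out_arcs G v))"

text \<open>The quantity on which both inductions run: it interpolates between the total weight, at
  the empty path, and the weight of a single route, at a complete one.\<close>

definition prefix_weight :: "('e list \<Rightarrow> real) \<Rightarrow> 'e list \<Rightarrow> real" where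
  "prefix_weight a p = (\<Sum>R | awalk s R t \<and> (\<exists>q. R = p @ q). a R)"

text \<open>Prolonging a complete route to another route would give a nonempty closed walk at
  \<open>t\<close>.\<close>

lemma prefix_weight_route:
  assumes "awalk s R t"
  shows "prefix_weight a R = a R"
proof -
  have "{R'. awalk s R' t \<and> (\<exists>q. R' = R @ q)} = {R}"
    using assms by (auto simp: awalk_append) (metis awalk_ends_eqD awalk_loop awalk_ends)
  then show ?thesis by (simp add: prefix_weight_def)
qed

lemma prefix_weight_step:
  assumes "awalk s p v" "v \<noteq> t"
  shows "prefix_weight a p = (\<Sum>e\<in>out_arcs G v. prefix_weight a (p @ [e]))"
proof -
  have "{R. awalk s R t \<and> (\<exists>q. R = p @ q)} =
      (\<Union>e\<in>out_arcs G v. {R. awalk s R t \<and> (\<exists>q. R = (p @ [e]) @ q)})"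
    (is "?L = ?R")
  proof
    show "?L \<subseteq> ?R"
    proof
      fix R assume "R \<in> ?L"
      then obtain q where q: "awalk s (p @ q) t" "R = p @ q" by auto
      moreover from q have "awalk v q t"
        using assms by (auto simp: awalk_append dest: awalk_ends)
      then obtain e q' where "q = e # q'" "tail G e = v"
        using assms(2) by (cases q) (auto simp: awalk_simps)
      ultimately show "R \<in> ?R" by (auto simp: in_out_iff)
    qed
  qed auto
  then show ?thesis
    unfolding prefix_weight_def
    by (simp, subst sum.UNION_disjoint) (auto intro: finite_subset[OF _ finite_awalks])
qed

text \<open>A route uses \<open>e\<close> at most once, so its part before \<open>e\<close> is
  determined and classifies the routes through \<open>e\<close>.\<close>

lemma edge_weight:
  "(\<Sum>R | awalk s R t \<and> e \<in> set R. a R) = (\<Sum>p | awalk s p (tail G e). prefix_weight a (p @ [e]))"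
proof -
  have "{R. awalk s R t \<and> e \<in> set R} =
      (\<Union>p\<in>{p. awalk s p (tail G e)}. {R. awalk s R t \<and> (\<exists>q. R = (p @ [e]) @ q)})"
    (is "?L = ?R")
  proof
    show "?L \<subseteq> ?R"
    proof
      fix R assume "R \<in> ?L"
      then obtain p q where R: "awalk s R t" "R = (p @ [e]) @ q"
        by (auto dest: split_list)
      then have "awalk s p (tail G e)" by (auto simp: awalk_append awalk_Cons)
      with R show "R \<in> ?R" by blast
    qed
    show "?R \<subseteq> ?L" by auto
  qed
  then show ?thesis
    unfolding prefix_weight_def
    by (simp, subst sum.UNION_disjoint)
      (auto intro: finite_subset[OF _ finite_awalks] finite_awalks dest!: awalk_split_unique)
qed

end

text \<open>Both orders of a framing are encoded by a single labelling of the edges.\<close>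

locale labelled_st_dag = st_dag G s t for G :: "('v, 'e::finite) pre_digraph" and s t +
  fixes l :: "'e \<Rightarrow> nat"
  assumes label_in: "head G e = head G e' \<Longrightarrow> l e = l e' \<Longrightarrow> e = e'"
    and label_out: "tail G e = tail G e' \<Longrightarrow> l e = l e' \<Longrightarrow> e = e'"
begin

text \<open>The order on paths into a common vertex, without naming the vertex. The equality of
  heads matters when \<open>xs\<close> is empty, where nothing else forces the two last edges to end
  together.\<close>

definition in_less :: "'e list \<Rightarrow> 'e list \<Rightarrow> bool" where
  "in_less p q \<longleftrightarrow> (\<exists>xs a b ps qs. p = ps @ a # xs \<and> q = qs @ b # xs \<and>
     head G a = head G b \<and> l a < l b)"

text \<open>A conflict anywhere along a common segment shows at the vertex where the two routes separate.\<close>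

definition crossfree :: "'e list set \<Rightarrow> bool" where
  "crossfree C \<longleftrightarrow> (\<forall>p f p' q h q'. p @ f # p' \<in> C \<longrightarrow> q @ h # q' \<in> C \<longrightarrow>
     tail G f = tail G h \<longrightarrow> in_less p q \<longrightarrow> l f \<le> l h)"

lemma crossfree_mono: "crossfree C \<Longrightarrow> D \<subseteq> C \<Longrightarrow> crossfree D"
  unfolding crossfree_def by blast

lemma in_less_append: "in_less p q \<Longrightarrow> in_less (p @ xs) (q @ xs)"
  unfolding in_less_def by (metis append.assoc append_Cons)

lemma in_less_total:
  assumes "awalk s p v" "awalk s q v" "p \<noteq> q"
  shows "in_less p q \<or> in_less q p"
  using assms
proof (induction p arbitrary: q v rule: rev_induct)
  case Nil
  then show ?case using awalk_loop[of s q] awalk_ends by (auto simp: awalk_Nil_iff)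
next
  case (snoc e p)
  show ?case
  proof (cases q rule: rev_cases)
    case Nil
    then show ?thesis using snoc.prems awalk_loop[of s "p @ [e]"] by (auto simp: awalk_Nil_iff)
  next
    case q: (snoc q' e')
    have w: "awalk s p (tail G e)" "awalk s q' (tail G e')" "head G e = head G e'"
      using snoc.prems q by (auto simp: awalk_snoc)
    show ?thesis
    proof (cases "e = e'")
      case True
      then show ?thesis
        using snoc.IH[of "tail G e" q'] w snoc.prems(3) q by (auto intro: in_less_append)
    next
      case False
      then have "l e < l e' \<or> l e' < l e" using label_in w(3) by force
      then show ?thesis unfolding in_less_def q using w(3) by fastforce
    qed
  qed
qed

text \<open>Reading labels from the end turns \<open>in_less\<close> into a lexicographic
  comparison, whose transitivity and irreflexivity provide minimal elements of finite sets.\<close>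

lemma in_less_key: "in_less p q \<Longrightarrow> (map l (rev p), map l (rev q)) \<in> lexord less_than"
  unfolding in_less_def lexord_def by fastforce

lemma ex_in_less_minimal:
  assumes "finite S" "S \<noteq> {}"
  shows "\<exists>p\<in>S. \<forall>q\<in>S. \<not> in_less q p"
proof -
  define r where "r = {(p, q). p \<in> S \<and> q \<in> S \<and> (map l (rev p), map l (rev q)) \<in> lexord less_than}"
  have "finite r" using assms(1) by (rule_tac finite_subset[of _ "S \<times> S"]) (auto simp: r_def)
  moreover have "trans r"
    unfolding r_def trans_def using lexord_trans[OF _ _ trans_less_than] by blast
  then have "acyclic r"
    unfolding acyclic_def using lexord_irreflexive[of less_than]
    by (simp add: trancl_id) (auto simp: r_def)
  ultimately have "wf r" by (rule finite_acyclic_wf)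
  then obtain p where p: "p \<in> S" "\<And>q. (q, p) \<in> r \<Longrightarrow> q \<notin> S"
    using assms(2) by (metis all_not_in_conv wfE_min)
  have "\<not> in_less q p" if "q \<in> S" for q
  proof
    assume "in_less q p"
    then have "(q, p) \<in> r" using that p(1) in_less_key by (simp add: r_def)
    with p(2) that show False by blast
  qed
  with p(1) show ?thesis by blast
qed

lemma prefix_weight_pos:
  assumes "\<forall>R. 0 \<le> a R" "0 < prefix_weight a p"
  shows "\<exists>q. a (p @ q) \<noteq> 0 \<and> awalk s (p @ q) t"
proof (rule ccontr)
  assume "\<not> ?thesis"
  then have "prefix_weight a p = 0"
    unfolding prefix_weight_def by (intro sum.neutral) blast
  with assms(2) show False by simp
qed

lemma prefix_weight_nonneg: "\<forall>R. 0 \<le> a R \<Longrightarrow> 0 \<le> prefix_weight a p"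
  unfolding prefix_weight_def by (intro sum_nonneg) simp

lemma crossfree_prefix_weight:
  assumes "\<forall>R. 0 \<le> a R" "crossfree {R. a R \<noteq> 0}" "in_less p q" "tail G f = tail G h"
    "0 < prefix_weight a (p @ [f])" "0 < prefix_weight a (q @ [h])"
  shows "l f \<le> l h"
proof -
  obtain p' q' where "a ((p @ [f]) @ p') \<noteq> 0" "a ((q @ [h]) @ q') \<noteq> 0"
    using prefix_weight_pos[OF assms(1)] assms(5,6) by blast
  then show ?thesis
    using assms(2)[unfolded crossfree_def, rule_format, of p f p' q h q'] assms(3,4) by simp
qed

text \<open>All prefix weights agree, by induction upwards along the graph. For walks
  \<open>q\<close> to a vertex and edges \<open>h\<close> leaving it, the weights of
  \<open>q @ [h]\<close> form a matrix: its row sums are prefix weights known by induction, its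
  column sums are the given edge sums, and \<open>crossfree\<close> says that its support is
  monotone.\<close>

theorem crossfree_weights_unique:
  fixes a b :: "'e list \<Rightarrow> real"
  assumes a: "\<forall>R. 0 \<le> a R" "{R. a R \<noteq> 0} \<subseteq> {R. awalk s R t}" "crossfree {R. a R \<noteq> 0}"
    and b: "\<forall>R. 0 \<le> b R" "{R. b R \<noteq> 0} \<subseteq> {R. awalk s R t}" "crossfree {R. b R \<noteq> 0}"
    and eq: "\<And>e. (\<Sum>R | awalk s R t \<and> e \<in> set R. a R) = (\<Sum>R | awalk s R t \<and> e \<in> set R. b R)"
  shows "a = b"
proof -
  have "\<forall>p. awalk s p v \<longrightarrow> prefix_weight a p = prefix_weight b p" for v
  proof (induction v rule: vertex_induct_up)
    case (1 v)
    show ?case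
    proof (intro allI impI)
      fix p assume p: "awalk s p v"
      show "prefix_weight a p = prefix_weight b p"
      proof (cases p rule: rev_cases)
        case Nil
        then have "v = s" using p by (simp add: awalk_Nil_iff)
        \<comment> \<open>Only the empty walk ends at \<open>s\<close>, so the matrix has one row
          and its entries are the edge sums themselves.\<close>
        have "{p. awalk s p s} = {[]}" by (auto simp: awalk_from_s_Nil)
        then have "prefix_weight a [e] = prefix_weight b [e]" if "e \<in> out_arcs G s" for e
          using that eq[of e] unfolding edge_weight by (simp add: in_out_iff)
        then show ?thesis
          using prefix_weight_step[OF p] s_ne_t \<open>v = s\<close> Nil by simp
      next
        case (snoc p0 f)
        define u where "u = tail G f"
        define S where "S = {q. awalk s q u}"
        define F where "F = out_arcs G u"
        define M where "M q h = prefix_weight a (q @ [h])" for q h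
        define M' where "M' q h = prefix_weight b (q @ [h])" for q h
        have fin: "finite S" "finite F" by (simp_all add: S_def finite_awalks F_def)
        have IH: "prefix_weight a q = prefix_weight b q" if "q \<in> S" for q
          using 1[of f] p that snoc by (auto simp: awalk_snoc S_def u_def)
        have "u \<noteq> t" using tail_ne_t by (simp add: u_def)
        then have rows: "(\<Sum>h\<in>F. M q h) = (\<Sum>h\<in>F. M' q h)" if "q \<in> S" for q
          using that IH[OF that] prefix_weight_step[of q u]
          by (simp add: S_def M_def M'_def F_def)
        have cols: "(\<Sum>q\<in>S. M q h) = (\<Sum>q\<in>S. M' q h)" if "h \<in> F" for h
          using eq[of h] that unfolding edge_weight by (simp add: in_out_iff F_def S_def M_def M'_def)
        have nonneg: "0 \<le> M q h" "0 \<le> M' q h" for q h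
          using prefix_weight_nonneg a(1) b(1) by (simp_all add: M_def M'_def)
        have mono: "l h \<le> l h'" if "h \<in> F" "h' \<in> F" "in_less q q'"
          "0 < M q h \<and> 0 < M q' h' \<or> 0 < M' q h \<and> 0 < M' q' h'" for q q' h h'
          using that crossfree_prefix_weight[OF a(1,3)] crossfree_prefix_weight[OF b(1,3)]
          by (auto simp: F_def in_out_iff M_def M'_def)
        have "M q h = M' q h" if "q \<in> S" "h \<in> F" for q h
        proof (rule ccontr)
          assume neq: "M q h \<noteq> M' q h"
          \<comment> \<open>In the first row that contains a difference, at its first difference,
            the two matrices are compared in both directions.\<close>
          define S' where "S' = {q \<in> S. \<exists>h\<in>F. M q h \<noteq> M' q h}"
          have "finite S'" "S' \<noteq> {}" using fin that neq by (auto simp: S'_def)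
          from ex_in_less_minimal[OF this]
          obtain q0 where q0: "q0 \<in> S'" "\<forall>q\<in>S'. \<not> in_less q q0" by (elim bexE)
          define F' where "F' = {h \<in> F. M q0 h \<noteq> M' q0 h}"
          obtain h1 where "h1 \<in> F'" using q0(1) unfolding F'_def S'_def by blast
          from ex_has_least_nat[of "\<lambda>h. h \<in> F'", OF this, of l]
          obtain h0 where h0: "h0 \<in> F'" "\<forall>h. h \<in> F' \<longrightarrow> l h0 \<le> l h" by (elim exE conjE)
          have q0S: "q0 \<in> S" and h0F: "h0 \<in> F" using q0(1) h0(1) by (auto simp: S'_def F'_def)
          have qmin: "in_less q0 q'" if "q' \<in> S" "q' \<noteq> q0" "M q' h0 \<noteq> M' q' h0" for q'
            using that q0(2) in_less_total[of q0 u q'] q0S h0F by (auto simp: S'_def S_def)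
          have hmin: "l h0 < l h'" if "h' \<in> F" "h' \<noteq> h0" "M q0 h' \<noteq> M' q0 h'" for h'
          proof -
            have "l h0 \<le> l h'" using that h0(2) by (simp add: F'_def)
            moreover have "l h0 \<noteq> l h'" using that h0F label_out[of h0 h'] by (auto simp: F_def in_out_iff)
            ultimately show ?thesis by simp
          qed
          have "M q0 h0 \<le> M' q0 h0"
            by (rule coupling_not_greater[where S = S and F = F and lt = in_less and l = l])
              (use fin nonneg rows cols mono q0S h0F qmin hmin in auto)
          moreover have "M' q0 h0 \<le> M q0 h0"
            by (rule coupling_not_greater[where S = S and F = F and lt = in_less and l = l])
              (use fin nonneg rows cols mono q0S h0F qmin hmin in \<open>auto 4 3\<close>)
          ultimately show False using h0(1) by (simp add: F'_def)
        qed
        moreover have "p0 \<in> S" "f \<in> F"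
          using p snoc by (simp_all add: awalk_snoc S_def F_def u_def arcs_UNIV)
        ultimately show ?thesis unfolding snoc M_def M'_def by blast
      qed
    qed
  qed
  then have "a R = b R" if "awalk s R t" for R
    using prefix_weight_route[OF that] that by metis
  moreover have "a R = b R" if "\<not> awalk s R t" for R
    using that a(2) b(2) by (metis (mono_tags, lifting) mem_Collect_eq subsetD)
  ultimately show ?thesis by blast
qed

section \<open>Existence of crossfree weights: particles moving through intervals\<close>

definition lo_in :: "('e \<Rightarrow> real) \<Rightarrow> 'e \<Rightarrow> real" where
  "lo_in y e = (\<Sum>e' | e' \<in> in_arcs G (head G e) \<and> l e' < l e. y e')"

definition lo_out :: "('e \<Rightarrow> real) \<Rightarrow> 'e \<Rightarrow> real" where
  "lo_out y e = (\<Sum>e' | e' \<in> out_arcs G (tail G e) \<and> l e' < l e. y e')"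

text \<open>Half-open, so that the slots at a vertex tile an interval without overlap and an edge
  without flow has the empty slot.\<close>

definition slot_out :: "('e \<Rightarrow> real) \<Rightarrow> 'e \<Rightarrow> real set" where
  "slot_out y e = {lo_out y e..<lo_out y e + y e}"

definition slot_in :: "('e \<Rightarrow> real) \<Rightarrow> 'e \<Rightarrow> real set" where
  "slot_in y e = {lo_in y e..<lo_in y e + y e}"

definition transport :: "('e \<Rightarrow> real) \<Rightarrow> real set \<Rightarrow> 'e \<Rightarrow> real set" where
  "transport y S e = (\<lambda>x. x + (lo_in y e - lo_out y e)) ` (S \<inter> slot_out y e)"

text \<open>No edge enters \<open>s\<close>, so there the outflow takes the place of the
  inflow.\<close>

definition through :: "('e \<Rightarrow> real) \<Rightarrow> 'v \<Rightarrow> real" where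
  "through y v = (if v = s then sum y (out_arcs G s) else sum y (in_arcs G v))"

text \<open>The flow through a vertex \<open>v\<close> is spread over the interval from 0 to \<open>through y v\<close>, where
  both the incoming and the outgoing edges occupy consecutive slots in the order of their labels.
  Particles keep their relative position within an edge; \<open>share y p\<close> is the set of final positions
  of the particles that travel along \<open>p\<close>.\<close>

definition share :: "('e \<Rightarrow> real) \<Rightarrow> 'e list \<Rightarrow> real set" where
  "share y p = foldl (transport y) {0..<through y s} p"

lemma share_Nil: "share y [] = {0..<through y s}"
  by (simp add: share_def)

lemma share_snoc: "share y (p @ [e]) = transport y (share y p) e"
  by (simp add: share_def)

lemma share_append_empty: "share y p = {} \<Longrightarrow> share y (p @ q) = {}"
  by (induction q rule: rev_induct)
    (simp_all add: share_snoc transport_def flip: append_assoc)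

lemma transport_subset: "transport y S e \<subseteq> slot_in y e"
  by (auto simp: transport_def slot_in_def slot_out_def)

lemma transport_slot_out: "slot_out y e \<subseteq> S \<Longrightarrow> transport y S e = slot_in y e"
proof -
  assume "slot_out y e \<subseteq> S"
  then have "S \<inter> slot_out y e = slot_out y e" by blast
  moreover have "x \<in> (\<lambda>x. x + (lo_in y e - lo_out y e)) ` slot_out y e" if "x \<in> slot_in y e" for x
    by (rule image_eqI[of _ _ "x - (lo_in y e - lo_out y e)"])
      (use that in \<open>auto simp: slot_in_def slot_out_def\<close>)
  ultimately show ?thesis
    using transport_subset[of y S e] unfolding transport_def by auto
qed

lemma slots_less:
  assumes "\<forall>e. 0 \<le> y e" "l e < l e'"
  shows "head G e = head G e' \<Longrightarrow> lo_in y e + y e \<le> lo_in y e'"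
    and "tail G e = tail G e' \<Longrightarrow> lo_out y e + y e \<le> lo_out y e'"
proof -
  have key: "(\<Sum>x | x \<in> F \<and> l x < l e. y x) + y e \<le> (\<Sum>x | x \<in> F \<and> l x < l e'. y x)"
    if "e \<in> F" "finite F" for F
  proof -
    have "(\<Sum>x | x \<in> F \<and> l x < l e. y x) + y e = sum y (insert e {x. x \<in> F \<and> l x < l e})"
      using that by simp
    also have "\<dots> \<le> (\<Sum>x | x \<in> F \<and> l x < l e'. y x)"
      using that assms by (intro sum_mono2) auto
    finally show ?thesis .
  qed
  show "head G e = head G e' \<Longrightarrow> lo_in y e + y e \<le> lo_in y e'"
    "tail G e = tail G e' \<Longrightarrow> lo_out y e + y e \<le> lo_out y e'"
    using key[of "in_arcs G (head G e)"] key[of "out_arcs G (tail G e)"] in_out_iff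
    by (simp_all add: lo_in_def lo_out_def del: in_in_arcs_conv in_out_arcs_conv)
qed

text \<open>Where the two walks merge for good they arrive in disjoint slots, ordered by label.
  Along the common end segment \<open>xs\<close> both are translated by the same amounts, which
  keeps the order.\<close>

lemma share_less:
  assumes y: "\<forall>e. 0 \<le> y e" and "in_less p q" "x \<in> share y p" "z \<in> share y q"
  shows "x < z"
proof -
  from assms(2) obtain xs a b ps qs where *: "p = (ps @ [a]) @ xs" "q = (qs @ [b]) @ xs"
      "head G a = head G b" "l a < l b"
    unfolding in_less_def by auto
  have "x < z" if "x \<in> share y ((ps @ [a]) @ xs)" "z \<in> share y ((qs @ [b]) @ xs)" for x z
    using that
  proof (induction xs arbitrary: x z rule: rev_induct)
    case Nil
    then have "x \<in> slot_in y a" "z \<in> slot_in y b"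
      using transport_subset share_snoc by (metis append_Nil2 subsetD)+
    then show ?case
      using slots_less(1)[OF y *(4,3)] by (auto simp: slot_in_def)
  next
    case (snoc e xs)
    let ?k = "lo_in y e - lo_out y e"
    from snoc.prems have "x - ?k \<in> share y ((ps @ [a]) @ xs)" "z - ?k \<in> share y ((qs @ [b]) @ xs)"
      unfolding append_assoc[symmetric] share_snoc by (auto simp: transport_def)
    from snoc.IH[OF this] show ?case by simp
  qed
  with * assms show ?thesis by blast
qed

lemma UN_slots:
  assumes "\<forall>e. 0 \<le> y e"
  shows "(\<Union>e\<in>in_arcs G v. slot_in y e) = {0..<sum y (in_arcs G v)}"
    and "(\<Union>e\<in>out_arcs G v. slot_out y e) = {0..<sum y (out_arcs G v)}"
proof -
  have "inj_on l (in_arcs G v)" "inj_on l (out_arcs G v)"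
    using label_in label_out by (auto simp: inj_on_def)
  from this(1)[THEN finite_consecutive_intervals[OF finite_in_arcs], of y]
    this(2)[THEN finite_consecutive_intervals[OF finite_out_arcs], of y]
  show "(\<Union>e\<in>in_arcs G v. slot_in y e) = {0..<sum y (in_arcs G v)}"
    "(\<Union>e\<in>out_arcs G v. slot_out y e) = {0..<sum y (out_arcs G v)}"
    using assms by (auto simp: slot_in_def slot_out_def lo_in_def lo_out_def)
qed

lemma through_out:
  assumes "conserved y" "v \<in> verts G" "v \<noteq> t"
  shows "through y v = sum y (out_arcs G v)"
  using assms by (auto simp: conserved_def through_def inner_verts_def)

text \<open>No particle is lost: if the interval at the tail of an edge is full, the whole slot of
  the edge is transported, and the arriving slots tile the interval at the next vertex. Conservation
  makes the outgoing slots tile the same interval as the incoming ones.\<close>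

lemma UN_share:
  assumes y: "\<forall>e. 0 \<le> y e" "conserved y"
  shows "(\<Union>p\<in>{p. awalk s p v}. share y p) = (if v \<in> verts G then {0..<through y v} else {})"
proof (induction v rule: vertex_induct_up)
  case (1 v)
  show ?case
  proof (cases "v = s \<or> v \<notin> verts G")
    case True
    then show ?thesis
      using s_in(1) by (auto simp: awalk_from_s_Nil share_Nil)
  next
    case False
    have "{p. awalk s p v} = (\<Union>e\<in>in_arcs G v. (\<lambda>p. p @ [e]) ` {p. awalk s p (tail G e)})"
      (is "?L = ?R")
    proof
      show "?L \<subseteq> ?R"
      proof
        fix p assume p: "p \<in> ?L"
        then show "p \<in> ?R"
          using False by (cases p rule: rev_cases) (auto simp: awalk_snoc awalk_Nil_iff arcs_UNIV)
      qed
      show "?R \<subseteq> ?L" by (auto simp: awalk_snoc)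
    qed
    then have "(\<Union>p\<in>{p. awalk s p v}. share y p) =
        (\<Union>e\<in>in_arcs G v. \<Union>p\<in>{p. awalk s p (tail G e)}. share y (p @ [e]))"
      by simp
    also have "\<dots> = (\<Union>e\<in>in_arcs G v. transport y (\<Union>p\<in>{p. awalk s p (tail G e)}. share y p) e)"
      by (auto simp: share_snoc transport_def)
    also have "\<dots> = (\<Union>e\<in>in_arcs G v. slot_in y e)"
    proof (intro SUP_cong refl transport_slot_out)
      fix e assume "e \<in> in_arcs G v"
      then have "(\<Union>p\<in>{p. awalk s p (tail G e)}. share y p) = {0..<through y (tail G e)}"
        using 1[of e] in_verts by simp
      also have "\<dots> = (\<Union>e\<in>out_arcs G (tail G e). slot_out y e)"
        using UN_slots(2)[OF y(1)] through_out[OF y(2) in_verts(2) tail_ne_t] by simp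
      finally show "slot_out y e \<subseteq> (\<Union>p\<in>{p. awalk s p (tail G e)}. share y p)"
        using in_out_iff(2)[of e "tail G e"] by auto
    qed
    also have "\<dots> = {0..<through y v}"
      using UN_slots(1)[OF y(1)] False by (simp add: through_def)
    finally show ?thesis using False by simp
  qed
qed

text \<open>Cutting by a slot and translating preserve half-open intervals, with
  \<open>b \<le> a\<close> for the empty one. The cuts are sums of flow values, hence integers for
  an integral flow; this is where the integrality of the weights comes from.\<close>

lemma share_interval:
  "\<exists>a b. share y p = {a..<b} \<and> ((\<forall>e. y e \<in> \<int>) \<longrightarrow> a \<in> \<int> \<and> b \<in> \<int>)"
proof (induction p rule: rev_induct)
  case Nil
  show ?case
    by (rule exI[of _ 0], rule exI[of _ "through y s"]) (simp add: share_Nil through_def Ints_sum)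
next
  case (snoc e p)
  then obtain a b where ab: "share y p = {a..<b}" "(\<forall>e. y e \<in> \<int>) \<longrightarrow> a \<in> \<int> \<and> b \<in> \<int>" by blast
  let ?a = "max a (lo_out y e) + (lo_in y e - lo_out y e)"
  let ?b = "min b (lo_out y e + y e) + (lo_in y e - lo_out y e)"
  have "share y (p @ [e]) = {?a..<?b}"
    unfolding share_snoc transport_def ab(1) slot_out_def
    by (simp add: Int_atLeastLessThan image_add_atLeastLessThan')
  moreover have "?a \<in> \<int> \<and> ?b \<in> \<int>" if "\<forall>e. y e \<in> \<int>"
    using that ab(2)
    by (auto simp: max_def min_def lo_in_def lo_out_def intro!: Ints_sum Ints_add Ints_diff)
  ultimately show ?case by blast
qed

lemma share_measurable: "share y p \<in> sets lborel"
  using share_interval[of y p] by auto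

lemma measure_Ico: "measure lborel {a..<b::real} = max 0 (b - a)"
  by (cases "a \<le> b") auto

lemma emeasure_Ico_finite: "emeasure lborel {a..<b::real} \<noteq> \<infinity>"
  by (cases "a \<le> b") auto

lemma share_finite: "emeasure lborel (share y p) \<noteq> \<infinity>"
  using share_interval[of y p] emeasure_Ico_finite by auto

lemma measure_transport:
  "measure lborel (share y (p @ [e])) = measure lborel (share y p \<inter> slot_out y e)"
proof -
  obtain a b where ab: "share y p = {a..<b}" using share_interval by blast
  have "share y (p @ [e]) = {max a (lo_out y e) + (lo_in y e - lo_out y e)..<
      min b (lo_out y e + y e) + (lo_in y e - lo_out y e)}"
    unfolding share_snoc transport_def ab(1) slot_out_def
    by (simp add: Int_atLeastLessThan image_add_atLeastLessThan')
  then show ?thesis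
    by (simp add: ab slot_out_def Int_atLeastLessThan measure_Ico)
qed

lemma measure_eq_sum_pieces:
  assumes "finite I" "disjoint_family_on B I" "\<And>i. i \<in> I \<Longrightarrow> B i \<in> sets lborel"
    "A \<in> sets lborel" "emeasure lborel A \<noteq> \<infinity>" "A \<subseteq> (\<Union>i\<in>I. B i)"
  shows "measure lborel A = (\<Sum>i\<in>I. measure lborel (A \<inter> B i))"
proof -
  have "measure lborel (\<Union>i\<in>I. A \<inter> B i) = (\<Sum>i\<in>I. measure lborel (A \<inter> B i))"
  proof (rule measure_finite_Union)
    show "(\<lambda>i. A \<inter> B i) ` I \<subseteq> sets lborel" using assms(3,4) by blast
    show "disjoint_family_on (\<lambda>i. A \<inter> B i) I" using assms(2) by (auto simp: disjoint_family_on_def)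
    fix i assume i: "i \<in> I"
    have "emeasure lborel (A \<inter> B i) \<le> emeasure lborel A"
      using assms(4) by (intro emeasure_mono) auto
    then show "emeasure lborel (A \<inter> B i) \<noteq> \<infinity>"
      using assms(5) by (metis infinity_ennreal_def top.extremum_unique)
  qed (fact assms(1))
  moreover have "(\<Union>i\<in>I. A \<inter> B i) = A" using assms(6) by blast
  ultimately show ?thesis by simp
qed

lemma slot_out_disjoint: "\<forall>e. 0 \<le> y e \<Longrightarrow> disjoint_family_on (slot_out y) (out_arcs G v)"
proof -
  assume y: "\<forall>e. 0 \<le> y e"
  have disj: "slot_out y e \<inter> slot_out y e' = {}" if "l e < l e'" "tail G e = tail G e'" for e e'
    using slots_less(2)[OF y that] by (auto simp: slot_out_def)
  show ?thesis
    unfolding disjoint_family_on_def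
  proof (intro ballI impI)
    fix e e' assume "e \<in> out_arcs G v" "e' \<in> out_arcs G v" "e \<noteq> e'"
    then have "tail G e = tail G e'" "l e \<noteq> l e'"
      using label_out[of e e'] by (auto simp: in_out_iff)
    then have "tail G e = tail G e'" "l e < l e' \<or> l e' < l e"
      by auto
    then show "slot_out y e \<inter> slot_out y e' = {}"
      using disj[of e e'] disj[of e' e] by auto
  qed
qed

text \<open>The weight of a route is the length of its \<open>share\<close>. Going back from
  \<open>t\<close>, these lengths add up to the lengths of the shares of initial parts, because the
  outgoing slots partition each share. The shares of the walks that reach the tail of
  \<open>e\<close> partition its slot, whose length is \<open>y e\<close>.\<close>

theorem crossfree_weights_exist:
  fixes y :: "'e \<Rightarrow> real"
  assumes y: "\<forall>e. 0 \<le> y e" "conserved y"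
  shows "\<exists>a. (\<forall>R. 0 \<le> a R) \<and> {R. a R \<noteq> 0} \<subseteq> {R. awalk s R t} \<and> crossfree {R. a R \<noteq> 0} \<and>
    (\<forall>e. (\<Sum>R | awalk s R t \<and> e \<in> set R. a R) = y e) \<and>
    ((\<forall>e. y e \<in> \<int>) \<longrightarrow> (\<forall>R. a R \<in> \<int>))"
proof -
  define a where "a R = (if awalk s R t then measure lborel (share y R) else 0)" for R
  have weight: "\<forall>p. awalk s p v \<longrightarrow> prefix_weight a p = measure lborel (share y p)" for v
  proof (induction v rule: vertex_induct_down)
    case (1 v)
    show ?case
    proof (intro allI impI)
      fix p assume p: "awalk s p v"
      show "prefix_weight a p = measure lborel (share y p)"
      proof (cases "v = t")
        case True
        then show ?thesis using p prefix_weight_route[of p a] by (simp add: a_def)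
      next
        case False
        have v: "v \<in> verts G" using p by blast
        have "prefix_weight a p = (\<Sum>e\<in>out_arcs G v. measure lborel (share y (p @ [e])))"
          using 1 p unfolding prefix_weight_step[OF p False]
          by (intro sum.cong refl) (auto simp: awalk_snoc in_out_iff)
        also have "\<dots> = (\<Sum>e\<in>out_arcs G v. measure lborel (share y p \<inter> slot_out y e))"
          by (simp add: measure_transport)
        also have "\<dots> = measure lborel (share y p)"
        proof (rule measure_eq_sum_pieces[symmetric])
          show "share y p \<subseteq> (\<Union>e\<in>out_arcs G v. slot_out y e)"
            unfolding UN_slots(2)[OF y(1)] through_out[OF y(2) v False, symmetric]
            using UN_share[OF y, of v] p v by auto
          show "disjoint_family_on (slot_out y) (out_arcs G v)" by (rule slot_out_disjoint[OF y(1)])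
          show "slot_out y e \<in> sets lborel" for e by (simp add: slot_out_def)
        qed (simp_all only: share_measurable share_finite finite_out_arcs not_False_eq_True)
        finally show ?thesis .
      qed
    qed
  qed
  have "(\<Sum>R | awalk s R t \<and> e \<in> set R. a R) = y e" for e
  proof -
    have "(\<Sum>R | awalk s R t \<and> e \<in> set R. a R) =
        (\<Sum>p | awalk s p (tail G e). measure lborel (slot_out y e \<inter> share y p))"
      unfolding edge_weight using weight[of "head G e"]
      by (intro sum.cong refl) (simp add: awalk_snoc measure_transport Int_commute)
    also have "\<dots> = measure lborel (slot_out y e)"
    proof (rule measure_eq_sum_pieces[symmetric])
      show "disjoint_family_on (share y) {p. awalk s p (tail G e)}"
        unfolding disjoint_family_on_def
      proof (intro ballI impI)
        fix p q assume "p \<in> {p. awalk s p (tail G e)}" "q \<in> {p. awalk s p (tail G e)}" "p \<noteq> q"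
        then have "in_less p q \<or> in_less q p" using in_less_total by blast
        then show "share y p \<inter> share y q = {}"
          using share_less[OF y(1)] less_irrefl by blast
      qed
      have "slot_out y e \<subseteq> (\<Union>e\<in>out_arcs G (tail G e). slot_out y e)"
        using in_out_iff(2)[of e "tail G e"] by auto
      then show "slot_out y e \<subseteq> (\<Union>p\<in>{p. awalk s p (tail G e)}. share y p)"
        unfolding UN_slots(2)[OF y(1)] UN_share[OF y] using in_verts
        by (simp add: through_out[OF y(2) in_verts(2) tail_ne_t])
      show "slot_out y e \<in> sets lborel" by (simp add: slot_out_def)
      show "emeasure lborel (slot_out y e) \<noteq> \<infinity>"
        unfolding slot_out_def by (rule emeasure_Ico_finite)
    qed (simp_all only: share_measurable finite_awalks)
    also have "\<dots> = y e" using y(1) by (simp add: slot_out_def measure_Ico)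
    finally show ?thesis .
  qed
  moreover have "crossfree {R. a R \<noteq> 0}"
    unfolding crossfree_def mem_Collect_eq
  proof (intro allI impI)
    fix p f p' q h q'
    assume *: "a (p @ f # p') \<noteq> 0" "a (q @ h # q') \<noteq> 0" "tail G f = tail G h" "in_less p q"
    \<comment> \<open>A route of nonzero weight carries a particle, and so does each of its initial
      parts. The order of two such particles at the vertex of separation decides the order of the
      slots through which they leave.\<close>
    have "share y (p @ [f]) \<noteq> {}" "share y (q @ [h]) \<noteq> {}"
      using *(1,2) share_append_empty[of y "p @ [f]" p'] share_append_empty[of y "q @ [h]" q']
      by (auto simp: a_def split: if_splits)
    then obtain x z where x: "x \<in> share y p" "x \<in> slot_out y f" and z: "z \<in> share y q" "z \<in> slot_out y h"
      by (auto simp: share_snoc transport_def)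
    have "x < z" by (rule share_less[OF y(1) *(4) x(1) z(1)])
    then show "l f \<le> l h"
      using slots_less(2)[OF y(1), of h f] *(3) x(2) z(2) by (force simp: slot_out_def)
  qed
  moreover have "a R \<in> \<int>" if "\<forall>e. y e \<in> \<int>" for R
    using share_interval[of y R] that by (auto simp: a_def measure_Ico max_def)
  ultimately show ?thesis
    by (intro exI[of _ a]) (auto simp: a_def)
qed

end

section \<open>Flows as weighted sums of routes\<close>

context st_dag
begin

text \<open>The corrections at both ends make the balance valid for every walk and every vertex, so
  that the induction can peel off the first edge.\<close>

lemma route_vec_balance:
  assumes "awalk u p w"
  shows "(\<Sum>e\<in>in_arcs G v. route_vec p $ e) + (if v = u then 1 else 0) =
    (\<Sum>e\<in>out_arcs G v. route_vec p $ e) + (if v = w then 1 else (0::real))"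
  using assms
proof (induction p arbitrary: u)
  case Nil
  then show ?case by (simp add: route_vec_def awalk_Nil_iff)
next
  case (Cons e p)
  have "e \<notin> set p" using awalk_distinct[OF Cons.prems] by simp
  then have "route_vec (e # p) $ e' = route_vec p $ e' + (if e' = e then 1 else (0::real))" for e'
    by (auto simp: route_vec_def)
  then show ?case
    using Cons.IH[of "head G e"] Cons.prems
    by (auto simp: sum.distrib sum.delta awalk_Cons arcs_UNIV split: if_splits)
qed

definition edge_sum :: "('e list \<Rightarrow> real) \<Rightarrow> 'e \<Rightarrow> real" where
  "edge_sum a e = (\<Sum>R | awalk s R t \<and> e \<in> set R. a R)"

lemma edge_sum_route_vec: "edge_sum a e = (\<Sum>R | awalk s R t. a R * route_vec R $ e)"
proof -
  have "(\<Sum>R | awalk s R t. a R * route_vec R $ e) = (\<Sum>R | awalk s R t. if e \<in> set R then a R else 0)"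
    by (intro sum.cong refl) (simp add: route_vec_def)
  also have "\<dots> = edge_sum a e"
    unfolding edge_sum_def by (subst sum.inter_filter[symmetric]) (simp_all add: finite_awalks)
  finally show ?thesis by simp
qed

lemma edge_sum_vec: "(\<Sum>R | awalk s R t. a R *\<^sub>R route_vec R) = (\<chi> e. edge_sum a e)"
  by (simp add: vec_eq_iff edge_sum_route_vec)

lemma edge_sum_balance:
  "(\<Sum>e\<in>in_arcs G v. edge_sum a e) + (if v = s then sum a {R. awalk s R t} else 0) =
   (\<Sum>e\<in>out_arcs G v. edge_sum a e) + (if v = t then sum a {R. awalk s R t} else 0)"
proof -
  have "(\<Sum>e\<in>F. edge_sum a e) = (\<Sum>R | awalk s R t. a R * (\<Sum>e\<in>F. route_vec R $ e))" for F
    unfolding edge_sum_route_vec by (subst sum.swap) (simp add: sum_distrib_left)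
  then have "(\<Sum>e\<in>in_arcs G v. edge_sum a e) + (if v = s then sum a {R. awalk s R t} else 0) =
      (\<Sum>R | awalk s R t. a R * ((\<Sum>e\<in>in_arcs G v. route_vec R $ e) + (if v = s then 1 else 0)))"
    by (simp add: distrib_left sum.distrib)
  also have "\<dots> = (\<Sum>R | awalk s R t. a R * ((\<Sum>e\<in>out_arcs G v. route_vec R $ e) + (if v = t then 1 else 0)))"
    using route_vec_balance[of s _ t v] by (intro sum.cong refl) simp
  also have "\<dots> = (\<Sum>e\<in>out_arcs G v. edge_sum a e) + (if v = t then sum a {R. awalk s R t} else 0)"
    using \<open>\<And>F. (\<Sum>e\<in>F. edge_sum a e) = _\<close> by (simp add: distrib_left sum.distrib)
  finally show ?thesis .
qed

lemma edge_sum_total: "(\<Sum>e\<in>out_arcs G s. edge_sum a e) = sum a {R. awalk s R t}"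
  using edge_sum_balance[of a s] s_ne_t s_in by simp

lemma conserved_edge_sum: "conserved (edge_sum a)"
  unfolding conserved_def
proof
  fix v assume "v \<in> inner_verts G s t"
  then show "sum (edge_sum a) (in_arcs G v) = sum (edge_sum a) (out_arcs G v)"
    using edge_sum_balance[of a v] by (auto simp: inner_verts_def)
qed

lemma conserved_diff: "conserved y \<Longrightarrow> conserved z \<Longrightarrow> conserved (\<lambda>e. y e - z e)"
  by (simp add: conserved_def sum_subtractf)

lemma flow_polytope_iff:
  "x \<in> flow_polytope G s t \<longleftrightarrow> (\<forall>e. 0 \<le> x $ e) \<and> conserved (\<lambda>e. x $ e) \<and> (\<Sum>e\<in>out_arcs G s. x $ e) = 1"
  by (simp add: flow_polytope_def conserved_def)

lemma edge_sum_nonneg: "\<forall>R. 0 \<le> a R \<Longrightarrow> 0 \<le> edge_sum a e"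
  by (simp add: edge_sum_def sum_nonneg)

lemma edge_sum_in_flow_polytope:
  assumes "\<forall>R. 0 \<le> a R" "sum a {R. awalk s R t} = 1"
  shows "(\<chi> e. edge_sum a e) \<in> flow_polytope G s t"
  using assms by (simp add: flow_polytope_iff edge_sum_nonneg conserved_edge_sum edge_sum_total)

lemma edge_sum_indicator:
  assumes "awalk s R t"
  shows "edge_sum (\<lambda>R'. if R' = R then 1 else 0) e = route_vec R $ e"
  unfolding edge_sum_route_vec using assms finite_awalks
  by (subst sum.mono_neutral_cong_right[of _ "{R}" _ "\<lambda>R. route_vec R $ e"]) auto

lemma route_vec_in_flow_polytope:
  assumes "awalk s R t"
  shows "route_vec R \<in> flow_polytope G s t"
proof -
  have "(\<chi> e. edge_sum (\<lambda>R'. if R' = R then 1 else 0) e) \<in> flow_polytope G s t"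
    using assms finite_awalks by (intro edge_sum_in_flow_polytope) (simp_all add: sum.delta)
  then show ?thesis by (simp add: edge_sum_indicator[OF assms] vec_lambda_eta)
qed

lemma convex_flow_polytope: "convex (flow_polytope G s t)"
proof (rule convexI)
  fix x y :: "real ^ 'e" and u v :: real
  assume "x \<in> flow_polytope G s t" "y \<in> flow_polytope G s t" "0 \<le> u" "0 \<le> v" "u + v = 1"
  then show "u *\<^sub>R x + v *\<^sub>R y \<in> flow_polytope G s t"
    by (simp add: flow_polytope_iff conserved_def sum.distrib flip: sum_distrib_left)
qed

text \<open>Of two distinct edges of a walk, one is followed by a walk from its head to the tail of
  the other. A common head or a common tail would close this into a nonempty cycle.\<close>

lemma awalk_arc_unique:
  assumes "awalk u p v" "e \<in> set p" "e' \<in> set p"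
  shows "head G e = head G e' \<Longrightarrow> e = e'" and "tail G e = tail G e' \<Longrightarrow> e = e'"
proof -
  have reach: "\<exists>q. awalk (head G e) q (tail G e')" if "awalk u p v" "p = x @ e # z" "e' \<in> set z" for x z e e'
    using that by (auto simp: awalk_append awalk_Cons dest!: split_list)
  have order: "\<exists>q. awalk (head G e) q (tail G e') \<or> awalk (head G e') q (tail G e)" if "e \<noteq> e'"
  proof -
    obtain x z where p: "p = x @ e # z" using assms(2) by (auto dest: split_list)
    with assms(3) that consider "e' \<in> set z" | "e' \<in> set x" by auto
    then show ?thesis
    proof cases
      case 1
      then show ?thesis using reach[OF assms(1) p] by blast
    next
      case 2
      then obtain x1 x2 where "x = x1 @ e' # x2" by (auto dest: split_list)
      then have "p = x1 @ e' # (x2 @ e # z)" using p by simp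
      then show ?thesis using reach[OF assms(1), of x1 e' "x2 @ e # z" e] by auto
    qed
  qed
  have no: "\<not> awalk (head G e') q (tail G e)" if "head G e = head G e' \<or> tail G e = tail G e'" for q and e e' :: 'e
  proof
    assume q: "awalk (head G e') q (tail G e)"
    then have "awalk (head G e') (q @ [e]) (head G e)" "awalk (tail G e') (e' # q) (tail G e)"
      by (simp_all add: awalk_snoc awalk_Cons)
    then show False
      using that awalk_loop[of "head G e" "q @ [e]"] awalk_loop[of "tail G e" "e' # q"] by auto
  qed
  show "head G e = head G e' \<Longrightarrow> e = e'" "tail G e = tail G e' \<Longrightarrow> e = e'"
    using order no[of e e'] no[of e' e] by auto
qed

end

section \<open>The equatorial triangulation of the flow polytope\<close>

locale decomposed_st_dag = st_dag G s t for G :: "('v, 'e::finite) pre_digraph" and s t +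
  fixes Rs :: "'e list list"
  assumes decomposition: "route_decomposition G s t Rs"
begin

lemma Rs_route: "R \<in> set Rs \<Longrightarrow> awalk s R t"
  using decomposition by (simp add: route_decomposition_def route_iff)

lemma ex1_Rs: "\<exists>!R. R \<in> set Rs \<and> e \<in> set R"
  using decomposition by (simp add: route_decomposition_def arcs_UNIV)

definition route_of :: "'e \<Rightarrow> 'e list" where
  "route_of e = (THE R. R \<in> set Rs \<and> e \<in> set R)"

lemma route_of: "route_of e \<in> set Rs" "e \<in> set (route_of e)"
  using theI'[OF ex1_Rs[of e]] by (simp_all add: route_of_def)

lemma route_of_eq: "R \<in> set Rs \<Longrightarrow> e \<in> set R \<Longrightarrow> route_of e = R"
  using ex1_Rs route_of by blast

definition index :: "'e \<Rightarrow> nat" where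
  "index e = (THE i. i < length Rs \<and> Rs ! i = route_of e)"

lemma index: "index e < length Rs" "Rs ! index e = route_of e"
proof -
  have "\<exists>!i. i < length Rs \<and> Rs ! i = route_of e"
    using route_of(1)[of e] decomposition unfolding route_decomposition_def
    by (metis in_set_conv_nth nth_eq_iff_index_eq)
  then show "index e < length Rs" "Rs ! index e = route_of e"
    using theI'[of "\<lambda>i. i < length Rs \<and> Rs ! i = route_of e"] by (simp_all add: index_def)
qed

lemma index_eq: "i < length Rs \<Longrightarrow> e \<in> set (Rs ! i) \<Longrightarrow> index e = i"
  using route_of_eq[of "Rs ! i" e] index[of e] decomposition
  by (auto simp: route_decomposition_def nth_eq_iff_index_eq)

lemma route_order_iff: "(a, b) \<in> route_order Rs \<longleftrightarrow> index a \<le> index b"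
proof
  assume "(a, b) \<in> route_order Rs"
  then obtain i j where "i \<le> j" "j < length Rs" "a \<in> set (Rs ! i)" "b \<in> set (Rs ! j)"
    by (auto simp: route_order_def)
  then show "index a \<le> index b"
    using index_eq[of i a] index_eq[of j b] by simp
next
  assume "index a \<le> index b"
  moreover have "x \<in> set (Rs ! index x)" for x
    using index(2) route_of(2) by metis
  ultimately show "(a, b) \<in> route_order Rs"
    using index(1) by (auto simp: route_order_def)
qed

end

text \<open>Edges of equal index lie on one route, and a route has at most one edge into and one
  edge out of each vertex.\<close>

sublocale decomposed_st_dag \<subseteq> labelled_st_dag G s t index
proof
  fix e e' assume "index e = index e'"
  then have "route_of e = route_of e'" using index(2) by metis
  then have "e \<in> set (route_of e)" "e' \<in> set (route_of e)" "awalk s (route_of e) t"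
    using route_of Rs_route by metis+
  then show "head G e = head G e' \<Longrightarrow> e = e'" "tail G e = tail G e' \<Longrightarrow> e = e'"
    using awalk_arc_unique by blast+
qed

section \<open>Cliques of the route decomposition framing and the equatorial simplices\<close>

context decomposed_st_dag
begin

lemma prec_In_iff: "prec_In G (route_framing_in G Rs) P Q \<longleftrightarrow> in_less P Q"
proof -
  have "a \<noteq> b \<and> (a, b) \<in> route_framing_in G Rs (head G a) \<longleftrightarrow> head G a = head G b \<and> index a < index b" for a b
    using label_in[of a b] by (auto simp: route_framing_in_def route_order_iff arcs_UNIV le_less)
  then show ?thesis unfolding prec_In_def in_less_def by (simp only:)
qed

lemma prec_Out_iff: "prec_Out G (route_framing_out G Rs) P Q \<longleftrightarrow>
    (\<exists>xs a b ps qs. P = xs @ a # ps \<and> Q = xs @ b # qs \<and> tail G a = tail G b \<and> index a < index b)"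
proof -
  have "a \<noteq> b \<and> (a, b) \<in> route_framing_out G Rs (tail G a) \<longleftrightarrow> tail G a = tail G b \<and> index a < index b" for a b
    using label_out[of a b] by (auto simp: route_framing_out_def route_order_iff arcs_UNIV le_less)
  then show ?thesis unfolding prec_Out_def by (simp only:)
qed

lemma path_split:
  assumes "awalk s (p @ f # p') t"
  shows "path_upto G (tail G f) (p @ f # p') = p" "path_from G (tail G f) (p @ f # p') = f # p'"
proof -
  have "\<forall>e\<in>set p. tail G e \<noteq> tail G f"
    using assms awalk_arc_unique(2)[OF assms, of _ f] awalk_distinct[OF assms] by auto
  then show "path_upto G (tail G f) (p @ f # p') = p" "path_from G (tail G f) (p @ f # p') = f # p'"
    by (simp_all add: path_upto_def path_from_def takeWhile_append2 dropWhile_append2)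
qed

text \<open>A conflict at \<open>v\<close> can be moved to the vertex where the routes separate
  after \<open>v\<close>: the common segment \<open>xs\<close> is appended to both initial parts,
  and \<open>in_less\<close> survives this. Conversely, a violation of \<open>crossfree\<close> is a
  conflict at the vertex of separation itself.\<close>

lemma clique_iff:
  "clique G s t (route_framing_in G Rs) (route_framing_out G Rs) C \<longleftrightarrow>
    C \<subseteq> {R. awalk s R t} \<and> crossfree C"
proof (intro iffI conjI)
  assume cl: "clique G s t (route_framing_in G Rs) (route_framing_out G Rs) C"
  then show C: "C \<subseteq> {R. awalk s R t}" by (auto simp: clique_def route_iff)
  show "crossfree C"
    unfolding crossfree_def
  proof (intro allI impI)
    fix p f p' q h q'
    assume P: "p @ f # p' \<in> C" and Q: "q @ h # q' \<in> C" and v: "tail G f = tail G h" and less: "in_less p q"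
    have w: "awalk s (p @ f # p') t" "awalk s (q @ h # q') t" using C P Q by auto
    have "awalk s p (tail G f)" using w(1) by (auto simp: awalk_append awalk_Cons)
    \<comment> \<open>Conflicts are tested at inner vertices only. A nonempty walk from
      \<open>s\<close> does not end at \<open>s\<close>, and a vertex with an outgoing edge is not
      \<open>t\<close>.\<close>
    moreover have "p \<noteq> []" using less by (auto simp: in_less_def)
    ultimately have "tail G f \<noteq> s" using awalk_loop by blast
    then have inner: "tail G f \<in> inner_verts G s t"
      using in_verts tail_ne_t by (simp add: inner_verts_def)
    have "tail G f \<in> set (awalk_verts s (p @ f # p'))" "tail G f \<in> set (awalk_verts s (q @ h # q'))"
      using awalk_verts_arc1[of f "p @ f # p'"] awalk_verts_arc1[of h "q @ h # q'"] v by auto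
    then have "\<not> in_conflict G (route_framing_in G Rs) (route_framing_out G Rs) (tail G f) (p @ f # p') (q @ h # q')"
      using cl P Q inner unfolding clique_def coherent_def by blast
    then have "\<not> prec_Out G (route_framing_out G Rs) (h # q') (f # p')"
      using path_split[OF w(1)] path_split[OF w(2)] less v by (simp add: in_conflict_def prec_In_iff)
    then have "\<not> index h < index f"
      using v unfolding prec_Out_iff by (metis append_Nil)
    then show "index f \<le> index h" by simp
  qed
next
  assume C: "C \<subseteq> {R. awalk s R t} \<and> crossfree C"
  have no: "\<not> (prec_In G (route_framing_in G Rs) (path_upto G v P) (path_upto G v Q) \<and>
      prec_Out G (route_framing_out G Rs) (path_from G v Q) (path_from G v P))"
    if "P \<in> C" "Q \<in> C" for P Q v
  proof
    assume "prec_In G (route_framing_in G Rs) (path_upto G v P) (path_upto G v Q) \<and>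
      prec_Out G (route_framing_out G Rs) (path_from G v Q) (path_from G v P)"
    then obtain xs a b ps qs where less: "in_less (path_upto G v P) (path_upto G v Q)"
      and ab: "path_from G v Q = xs @ a # ps" "path_from G v P = xs @ b # qs" "tail G a = tail G b"
        "index a < index b"
      unfolding prec_In_iff prec_Out_iff by blast
    have "P = path_upto G v P @ path_from G v P" "Q = path_upto G v Q @ path_from G v Q"
      by (simp_all add: path_upto_def path_from_def)
    then have "(path_upto G v P @ xs) @ b # qs \<in> C" "(path_upto G v Q @ xs) @ a # ps \<in> C"
      using that ab by simp_all
    then have "index b \<le> index a"
      using C in_less_append[OF less] ab(3) unfolding crossfree_def by metis
    with ab(4) show False by simp
  qed
  then have "\<not> in_conflict G (route_framing_in G Rs) (route_framing_out G Rs) v P Q"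
    if "P \<in> C" "Q \<in> C" for P Q v
    using that unfolding in_conflict_def by blast
  then show "clique G s t (route_framing_in G Rs) (route_framing_out G Rs) C"
    using C unfolding clique_def coherent_def route_iff by blast
qed

text \<open>The vertex sets of the simplices: routes of the decomposition may be added freely, the other
  routes form a clique that covers no route of the decomposition.\<close>

definition covers_no_route :: "'e list set \<Rightarrow> bool" where
  "covers_no_route C \<longleftrightarrow> (\<forall>R\<in>set Rs. \<exists>e\<in>set R. \<forall>P\<in>C. e \<notin> set P)"

definition equatorial_sets :: "'e list set set" where
  "equatorial_sets = {D. D \<subseteq> {R. awalk s R t} \<and> crossfree (D - set Rs) \<and> covers_no_route (D - set Rs)}"

lemma equatorial_sets_mono: "D \<in> equatorial_sets \<Longrightarrow> D' \<subseteq> D \<Longrightarrow> D' \<in> equatorial_sets"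
  unfolding equatorial_sets_def covers_no_route_def
  by (auto intro: crossfree_mono[of "D - set Rs" "D' - set Rs"]) blast

lemma Union_equatorial_sets: "\<Union>equatorial_sets \<subseteq> {R. awalk s R t}"
  by (auto simp: equatorial_sets_def)

lemma finite_equatorial: "finite (\<Union>equatorial_sets)"
  using Union_equatorial_sets finite_awalks by (rule finite_subset)

lemma edge_sum_Rs:
  "edge_sum (\<lambda>R. if R \<in> set Rs then a R else 0) e = a (route_of e)"
proof -
  have "edge_sum (\<lambda>R. if R \<in> set Rs then a R else 0) e =
      (\<Sum>R\<in>{route_of e}. if R \<in> set Rs then a R else 0)"
    unfolding edge_sum_def using route_of route_of_eq Rs_route finite_awalks
    by (intro sum.mono_neutral_right) auto
  then show ?thesis using route_of by simp
qed

theorem equatorial_weights_exist: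
  fixes y :: "'e \<Rightarrow> real"
  assumes y: "\<forall>e. 0 \<le> y e" "conserved y"
  shows "\<exists>a. (\<forall>R. 0 \<le> a R) \<and> {R. a R \<noteq> 0} \<in> equatorial_sets \<and> edge_sum a = y \<and>
    ((\<forall>e. y e \<in> \<int>) \<longrightarrow> (\<forall>R. a R \<in> \<int>))"
proof -
  define m where "m R = Min (y ` set R)" for R
  define M where "M R = (if R \<in> set Rs then m R else 0)" for R
  have ne: "set R \<noteq> {}" if "R \<in> set Rs" for R
    using Rs_route[OF that] s_ne_t by (auto simp: awalk_Nil_iff)
  have m_le: "m R \<le> y e" if "e \<in> set R" for R e
    using that by (simp add: m_def)
  have m_attained: "\<exists>e\<in>set R. y e = m R" if "R \<in> set Rs" for R
  proof -
    have "m R \<in> y ` set R" unfolding m_def using ne[OF that] by (intro Min_in) auto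
    then show ?thesis by auto
  qed
  have m_nonneg: "0 \<le> m R" if "R \<in> set Rs" for R
    using m_attained[OF that] y(1) by metis
  have ew_M: "edge_sum M e = m (route_of e)" for e
    unfolding M_def by (rule edge_sum_Rs)
  define y' where "y' e = y e - edge_sum M e" for e
  have y': "\<forall>e. 0 \<le> y' e"
    using m_le[OF route_of(2)] by (simp add: y'_def ew_M)
  moreover have "conserved y'"
    using conserved_diff[OF y(2) conserved_edge_sum[of M]] by (simp add: y'_def[abs_def])
  ultimately have "\<forall>e. 0 \<le> y' e" "conserved y'" by blast+
  from crossfree_weights_exist[OF this] obtain b where b: "\<forall>R. 0 \<le> b R"
      "{R. b R \<noteq> 0} \<subseteq> {R. awalk s R t}" "crossfree {R. b R \<noteq> 0}" "edge_sum b = y'"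
      "(\<forall>e. y' e \<in> \<int>) \<longrightarrow> (\<forall>R. b R \<in> \<int>)"
    unfolding edge_sum_def fun_eq_iff by blast
  define a where "a R = b R + M R" for R
  have "\<forall>R. 0 \<le> a R"
    using b(1) m_nonneg by (simp add: a_def M_def)
  moreover have "edge_sum a = y"
  proof
    fix e
    have "edge_sum a e = edge_sum b e + edge_sum M e"
      by (simp add: a_def edge_sum_def sum.distrib)
    then show "edge_sum a e = y e" using b(4) by (simp add: y'_def)
  qed
  moreover have "{R. a R \<noteq> 0} \<in> equatorial_sets"
    unfolding equatorial_sets_def mem_Collect_eq
  proof (intro conjI)
    show "{R. a R \<noteq> 0} \<subseteq> {R. awalk s R t}"
      using b(2) Rs_route by (auto simp: a_def M_def split: if_splits)
    have sub: "{R. a R \<noteq> 0} - set Rs \<subseteq> {R. b R \<noteq> 0}"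
      by (auto simp: a_def M_def)
    then show "crossfree ({R. a R \<noteq> 0} - set Rs)" by (rule crossfree_mono[OF b(3)])
    \<comment> \<open>At an edge of \<open>R\<close> where the minimum is attained the remaining
      flow vanishes, so no route in its decomposition uses that edge.\<close>
    have "\<exists>e\<in>set R. \<forall>P\<in>{R. b R \<noteq> 0}. e \<notin> set P" if R: "R \<in> set Rs" for R
    proof -
      obtain e where e: "e \<in> set R" "y e = m R" using m_attained[OF R] by blast
      then have "edge_sum b e = 0"
        using b(4) route_of_eq[OF R e(1)] by (simp add: y'_def ew_M)
      then have "\<forall>P\<in>{R. awalk s R t \<and> e \<in> set R}. b P = 0"
        unfolding edge_sum_def using b(1) finite_awalks
        by (subst (asm) sum_nonneg_eq_0_iff) auto
      then show ?thesis using e(1) b(2) by (intro bexI[of _ e]) auto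
    qed
    then show "covers_no_route ({R. a R \<noteq> 0} - set Rs)"
      using sub unfolding covers_no_route_def by (meson subsetD)
  qed
  moreover have "\<forall>R. a R \<in> \<int>" if int: "\<forall>e. y e \<in> \<int>"
  proof -
    \<comment> \<open>The minimum is one of the flow values, so subtracting it keeps an integral
      flow integral.\<close>
    have mint: "m R \<in> \<int>" if "R \<in> set Rs" for R
      using m_attained[OF that] int by metis
    then have "\<forall>e. y' e \<in> \<int>"
      using int route_of(1) by (simp add: y'_def ew_M)
    then show ?thesis using b(5) mint by (simp add: a_def M_def)
  qed
  ultimately show ?thesis by blast
qed

text \<open>The inequality \<open>le\<close> uses the support condition for \<open>b\<close> only;
  exchanging the roles gives equality on the decomposition. What remains after removing those routes
  is crossfree with equal edge sums on both sides.\<close>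

theorem equatorial_weights_unique:
  assumes a: "\<forall>R. 0 \<le> a R" "{R. a R \<noteq> 0} \<in> equatorial_sets"
    and b: "\<forall>R. 0 \<le> b R" "{R. b R \<noteq> 0} \<in> equatorial_sets"
    and eq: "edge_sum a = edge_sum b"
  shows "a = b"
proof -
  have le: "a R \<le> b R" if h: "R \<in> set Rs" "edge_sum a = edge_sum b" "\<forall>R. 0 \<le> a R"
    "{R. b R \<noteq> 0} \<in> equatorial_sets" for R and a b :: "'e list \<Rightarrow> real"
  proof -
    obtain e where e: "e \<in> set R" "\<forall>P\<in>{R. b R \<noteq> 0} - set Rs. e \<notin> set P"
      using h(1,4) unfolding equatorial_sets_def covers_no_route_def by blast
    have "a R \<le> edge_sum a e"
      unfolding edge_sum_def using h(1,3) e(1) Rs_route finite_awalks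
      by (intro member_le_sum) auto
    also have "\<dots> = edge_sum b e" using h(2) by simp
    also have "\<dots> = (\<Sum>P\<in>{R}. b P)"
      unfolding edge_sum_def
    proof (rule sum.mono_neutral_right)
      show "finite {R. awalk s R t \<and> e \<in> set R}" using finite_awalks by simp
      show "{R} \<subseteq> {R. awalk s R t \<and> e \<in> set R}" using h(1) e(1) Rs_route by simp
      show "\<forall>P\<in>{R. awalk s R t \<and> e \<in> set R} - {R}. b P = 0"
      proof
        fix P assume P: "P \<in> {R. awalk s R t \<and> e \<in> set R} - {R}"
        then have "P \<notin> set Rs" using route_of_eq[of P e] route_of_eq[OF h(1) e(1)] by auto
        then show "b P = 0" using P e(2) by auto
      qed
    qed
    finally show ?thesis by simp
  qed
  have Rs_eq: "a R = b R" if "R \<in> set Rs" for R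
    using le[OF that eq a(1) b(2)] le[OF that eq[symmetric] b(1) a(2)] by simp
  let ?r = "\<lambda>a R. if R \<in> set Rs then 0 else a R"
  have "?r a = ?r b"
  proof (rule crossfree_weights_unique)
    have split: "edge_sum (?r a) e = edge_sum a e - edge_sum (\<lambda>R. if R \<in> set Rs then a R else 0) e"
      for a :: "'e list \<Rightarrow> real" and e
      unfolding edge_sum_def by (auto simp: sum_subtractf[symmetric] intro!: sum.cong)
    show "(\<Sum>R | awalk s R t \<and> e \<in> set R. ?r a R) = (\<Sum>R | awalk s R t \<and> e \<in> set R. ?r b R)" for e
      using split[of a e] split[of b e] eq Rs_eq[OF route_of(1)]
      by (simp add: edge_sum_Rs) (simp add: edge_sum_def)
    have "{R. ?r a R \<noteq> 0} = {R. a R \<noteq> 0} - set Rs" for a :: "'e list \<Rightarrow> real" by auto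
    then show "crossfree {R. ?r a R \<noteq> 0}" "crossfree {R. ?r b R \<noteq> 0}"
      "{R. ?r a R \<noteq> 0} \<subseteq> {R. awalk s R t}" "{R. ?r b R \<noteq> 0} \<subseteq> {R. awalk s R t}"
      using a(2) b(2) by (auto simp: equatorial_sets_def)
  qed (use a(1) b(1) in auto)
  then show ?thesis using Rs_eq by (auto simp: fun_eq_iff split: if_splits)
qed

text \<open>Adding one large integer \<open>n\<close> to all coefficients makes them nonnegative and
  changes the edge sums by integers. The resulting integral flow has integral weights by existence,
  and by uniqueness they are the shifted coefficients.\<close>

lemma equatorial_weights_integral:
  assumes D: "D \<in> equatorial_sets" and int: "\<forall>e. (\<Sum>R\<in>D. c R * route_vec R $ e) \<in> \<int>" and P: "P \<in> D"
  shows "c P \<in> \<int>"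
proof -
  have Dr: "D \<subseteq> {R. awalk s R t}" using D by (simp add: equatorial_sets_def)
  have fin: "finite D" using Dr finite_awalks by (rule finite_subset)
  define n where "n = \<lceil>\<Sum>R\<in>D. \<bar>c R\<bar>\<rceil>"
  have n: "0 \<le> c R + n" if "R \<in> D" for R
  proof -
    have "\<bar>c R\<bar> \<le> (\<Sum>R\<in>D. \<bar>c R\<bar>)" using that fin by (intro member_le_sum) auto
    also have "\<dots> \<le> n" by (simp add: n_def)
    finally show ?thesis by linarith
  qed
  define a where "a R = (if R \<in> D then c R + n else 0)" for R
  have "{R. a R \<noteq> 0} \<subseteq> D" by (auto simp: a_def)
  then have a: "\<forall>R. 0 \<le> a R" "{R. a R \<noteq> 0} \<in> equatorial_sets"
    using n equatorial_sets_mono[OF D] by (auto simp: a_def)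
  have "edge_sum a e \<in> \<int>" for e
  proof -
    have "edge_sum a e = (\<Sum>R\<in>D. (c R + n) * route_vec R $ e)"
      unfolding edge_sum_route_vec a_def using Dr finite_awalks
      by (intro sum.mono_neutral_cong_right) auto
    also have "\<dots> = (\<Sum>R\<in>D. c R * route_vec R $ e) + (\<Sum>R\<in>D. n * route_vec R $ e)"
      by (simp add: distrib_right sum.distrib)
    also have "\<dots> \<in> \<int>"
      using int by (intro Ints_add[OF _ Ints_sum]) (auto simp: route_vec_def)
    finally show ?thesis .
  qed
  then obtain a' where a': "\<forall>R. 0 \<le> a' R" "{R. a' R \<noteq> 0} \<in> equatorial_sets" "edge_sum a' = edge_sum a"
      "\<forall>R. a' R \<in> \<int>"
    using equatorial_weights_exist[of "edge_sum a"] edge_sum_nonneg[OF a(1)] conserved_edge_sum by blast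
  have "a' = a" by (rule equatorial_weights_unique[OF a'(1,2) a a'(3)])
  then have "c P + n \<in> \<int>" using a'(4) P by (metis a_def)
  then show ?thesis by (metis Ints_diff Ints_of_int add_diff_cancel_right')
qed

lemma route_weights:
  assumes "{R. a R \<noteq> 0} \<in> equatorial_sets"
  shows "(\<Sum>R\<in>\<Union>equatorial_sets. a R *\<^sub>R f R) = (\<Sum>R | awalk s R t. a R *\<^sub>R (f R :: 'a :: real_vector))"
  using assms Union_equatorial_sets finite_awalks by (intro sum.mono_neutral_left) auto

lemma weights_unique_route_vec:
  assumes a: "\<forall>R. 0 \<le> a R" "{R. a R \<noteq> 0} \<in> equatorial_sets"
    and b: "\<forall>R. 0 \<le> b R" "{R. b R \<noteq> 0} \<in> equatorial_sets"
    and eq: "(\<Sum>R\<in>\<Union>equatorial_sets. a R *\<^sub>R route_vec R) = (\<Sum>R\<in>\<Union>equatorial_sets. b R *\<^sub>R route_vec R)"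
  shows "a = b"
proof (rule equatorial_weights_unique[OF a b])
  show "edge_sum a = edge_sum b"
    using eq unfolding route_weights[OF a(2)] route_weights[OF b(2)] edge_sum_vec
    by (simp add: vec_eq_iff fun_eq_iff)
qed

lemma equatorial_affine_independent:
  assumes "D \<in> equatorial_sets"
  shows "\<not> affine_dependent (route_vec ` D :: (real ^ 'e) set)"
  by (rule affine_independent_of_unique_decompositions(2)[OF finite_equatorial equatorial_sets_mono _ assms])
    (auto intro: weights_unique_route_vec)

lemma flow_polytope_weights:
  assumes "x \<in> flow_polytope G s t"
  shows "\<exists>a. (\<forall>R. 0 \<le> a R) \<and> {R. a R \<noteq> 0} \<in> equatorial_sets \<and>
    sum a {R. awalk s R t} = 1 \<and> (\<Sum>R | awalk s R t. a R *\<^sub>R route_vec R) = x"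
proof -
  from assms have x: "\<forall>e. 0 \<le> x $ e" "conserved (\<lambda>e. x $ e)" "(\<Sum>e\<in>out_arcs G s. x $ e) = 1"
    by (simp_all add: flow_polytope_iff)
  from equatorial_weights_exist[OF x(1,2)]
  obtain a where a: "\<forall>R. 0 \<le> a R" "{R. a R \<noteq> 0} \<in> equatorial_sets" "edge_sum a = (\<lambda>e. x $ e)" by blast
  have "sum a {R. awalk s R t} = 1" using x(3) by (simp add: a(3) flip: edge_sum_total)
  moreover have "(\<Sum>R | awalk s R t. a R *\<^sub>R route_vec R) = x"
    by (simp add: edge_sum_vec a(3) vec_lambda_eta)
  ultimately show ?thesis using a by blast
qed

lemma flow_polytope_hull: "flow_polytope G s t = convex hull (route_vec ` {R. awalk s R t})"
proof
  show "convex hull (route_vec ` {R. awalk s R t}) \<subseteq> flow_polytope G s t"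
    using route_vec_in_flow_polytope by (intro hull_minimal convex_flow_polytope) auto
  show "flow_polytope G s t \<subseteq> convex hull (route_vec ` {R. awalk s R t})"
  proof
    fix x assume "x \<in> flow_polytope G s t"
    from flow_polytope_weights[OF this] obtain a where "\<forall>R. 0 \<le> a R"
        "sum a {R. awalk s R t} = 1" "(\<Sum>R | awalk s R t. a R *\<^sub>R route_vec R) = x" by blast
    then show "x \<in> convex hull (route_vec ` {R. awalk s R t})"
      using convex_sum[OF finite_awalks[of s t] convex_convex_hull, of a route_vec "route_vec ` {R. awalk s R t}"]
      by (simp add: hull_inc)
  qed
qed

lemma polytope_flow_polytope: "polytope (flow_polytope G s t)"
  unfolding flow_polytope_hull by (intro polytope_convex_hull finite_imageI finite_awalks)

lemma zero_edge_face: "{x \<in> flow_polytope G s t. x $ e = 0} face_of flow_polytope G s t"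
proof -
  have "flow_polytope G s t \<inter> {x. axis e 1 \<bullet> x = 0} face_of flow_polytope G s t"
    by (rule face_of_Int_supporting_hyperplane_ge[OF convex_flow_polytope])
      (simp add: inner_axis' flow_polytope_iff)
  moreover have "flow_polytope G s t \<inter> {x. axis e 1 \<bullet> x = 0} = {x \<in> flow_polytope G s t. x $ e = 0}"
    by (auto simp: inner_axis')
  ultimately show ?thesis by simp
qed

text \<open>A small multiple of the vector of \<open>R\<close> fits under the barycentre of
  \<open>C\<close>, so the barycentre lies strictly between that vector and another flow, unless it
  equals the vector. A face containing the barycentre contains both ends of such a segment.\<close>

lemma covered_route_in_face:
  assumes F: "F face_of flow_polytope G s t" and C: "C \<subseteq> {R. awalk s R t}" "route_vec ` C \<subseteq> F"
    and R: "awalk s R t" and cov: "\<forall>e\<in>set R. \<exists>P\<in>C. e \<in> set P"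
  shows "route_vec R \<in> F"
proof -
  have fin: "finite C" using C(1) finite_awalks by (rule finite_subset)
  obtain e where "e \<in> set R" using R s_ne_t by (cases R) (auto simp: awalk_Nil_iff)
  then have ne: "C \<noteq> {}" using cov by blast
  \<comment> \<open>Half of the barycentric weight, so that \<open>1 - \<epsilon>\<close> is
    positive even if \<open>C\<close> has a single element.\<close>
  define \<epsilon> where "\<epsilon> = 1 / (2 * real (card C))"
  have card: "0 < card C" using fin ne by (simp add: card_gt_0_iff)
  then have \<epsilon>: "0 < \<epsilon>" "\<epsilon> < 1" "2 * \<epsilon> * card C = 1" by (auto simp: \<epsilon>_def field_simps)
  define z where "z = (\<Sum>P\<in>C. (2 * \<epsilon>) *\<^sub>R (route_vec P :: real ^ 'e))"
  have "convex F" using F by (rule face_of_imp_convex)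
  then have z: "z \<in> F"
    unfolding z_def using C(2) \<epsilon> fin by (intro convex_sum) (auto simp: mult.commute mult.left_commute)
  then have zQ: "z \<in> flow_polytope G s t" using face_of_imp_subset[OF F] by blast
  have RQ: "route_vec R \<in> flow_polytope G s t" by (rule route_vec_in_flow_polytope[OF R])
  have ge: "\<epsilon> * route_vec R $ e \<le> z $ e" for e
  proof (cases "e \<in> set R")
    case True
    then obtain P where P: "P \<in> C" "e \<in> set P" using cov by blast
    have "2 * \<epsilon> * route_vec P $ e \<le> z $ e"
    proof -
      have "2 * \<epsilon> * route_vec P $ e \<le> (\<Sum>P\<in>C. 2 * \<epsilon> * route_vec P $ e)"
        using P fin \<epsilon> by (intro member_le_sum) (auto simp: route_vec_def)
      then show ?thesis by (simp add: z_def)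
    qed
    then show ?thesis using P True \<epsilon> by (simp add: route_vec_def)
  next
    case False
    then show ?thesis using zQ by (simp add: route_vec_def flow_polytope_iff)
  qed
  define z' where "z' = (1 / (1 - \<epsilon>)) *\<^sub>R (z - \<epsilon> *\<^sub>R route_vec R)"
  have z'z: "z = (1 - \<epsilon>) *\<^sub>R z' + \<epsilon> *\<^sub>R route_vec R" using \<epsilon> by (simp add: z'_def)
  have "z' \<in> flow_polytope G s t"
    unfolding flow_polytope_iff
  proof (intro conjI allI)
    show "0 \<le> z' $ e" for e using ge[of e] \<epsilon> by (simp add: z'_def)
    have sums: "(\<Sum>e\<in>A. z' $ e) = ((\<Sum>e\<in>A. z $ e) - \<epsilon> * (\<Sum>e\<in>A. route_vec R $ e)) / (1 - \<epsilon>)" for A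
      by (simp add: z'_def sum_subtractf sum_distrib_left sum_divide_distrib[symmetric])
    show "conserved (($) z')"
      using zQ RQ by (simp add: flow_polytope_iff conserved_def sums)
    show "(\<Sum>e\<in>out_arcs G s. z' $ e) = 1"
      using zQ RQ \<epsilon> by (simp add: flow_polytope_iff sums)
  qed
  show ?thesis
  proof (cases "z' = route_vec R")
    case True
    then have "z = route_vec R" using z'z by (simp flip: scaleR_left_distrib)
    then show ?thesis using z by simp
  next
    case False
    then have "z \<in> open_segment z' (route_vec R)"
      using \<epsilon> z'z by (auto simp: in_segment)
    then show ?thesis
      using F \<open>z' \<in> _\<close> RQ z unfolding face_of_def by blast
  qed
qed

text \<open>A facet containing the simplex of \<open>C\<close> but not the vector of
  \<open>R\<close> exists exactly when \<open>C\<close> avoids some edge of \<open>R\<close>. Such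
  an edge gives the face where its coordinate vanishes, which extends to a facet; the converse is
  \<open>covered_route_in_face\<close>.\<close>

lemma equatorial_part_eq:
  "equatorial_part G s t Rs =
    {convex hull (route_vec ` C) | C. C \<subseteq> {R. awalk s R t} \<and> crossfree C \<and> covers_no_route C}"
proof (intro equalityI subsetI)
  fix S assume "S \<in> equatorial_part G s t Rs"
  then obtain C F where C: "C \<subseteq> {R. awalk s R t}" "crossfree C" "S = convex hull (route_vec ` C)"
    and F: "F \<in> equatorial_complex G s t Rs" "S \<subseteq> F"
    unfolding equatorial_part_def DKK_triangulation_def clique_iff by blast
  from F(1) obtain facet where facet: "\<forall>R\<in>set Rs. polytope_facet (facet R) (flow_polytope G s t) \<and>
      route_vec R \<notin> facet R" "F face_of (\<Inter>R\<in>set Rs. facet R)"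
    unfolding equatorial_complex_def by blast
  have "covers_no_route C"
    unfolding covers_no_route_def
  proof (rule ballI, rule ccontr)
    fix R assume R: "R \<in> set Rs" and "\<not> (\<exists>e\<in>set R. \<forall>P\<in>C. e \<notin> set P)"
    then have "\<forall>e\<in>set R. \<exists>P\<in>C. e \<in> set P" by blast
    moreover have "route_vec ` C \<subseteq> facet R"
      using C(3) F(2) face_of_imp_subset[OF facet(2)] R hull_subset[of "route_vec ` C" convex] by blast
    moreover have "facet R face_of flow_polytope G s t"
      using facet(1) R by (simp add: polytope_facet_def)
    ultimately have "route_vec R \<in> facet R"
      using covered_route_in_face C(1) Rs_route[OF R] by blast
    then show False using facet(1) R by blast
  qed
  with C show "S \<in> {convex hull (route_vec ` C) | C. C \<subseteq> {R. awalk s R t} \<and> crossfree C \<and> covers_no_route C}"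
    by blast
next
  fix S :: "(real ^ 'e) set"
  assume "S \<in> {convex hull (route_vec ` C) | C. C \<subseteq> {R. awalk s R t} \<and> crossfree C \<and> covers_no_route C}"
  then obtain C where C: "C \<subseteq> {R. awalk s R t}" "crossfree C" "covers_no_route C"
    "S = convex hull (route_vec ` C)" by blast
  have "\<exists>F. polytope_facet F (flow_polytope G s t) \<and> route_vec R \<notin> F \<and> S \<subseteq> F" if R: "R \<in> set Rs" for R
  proof -
    obtain e where e: "e \<in> set R" "\<forall>P\<in>C. e \<notin> set P" using C(3) R unfolding covers_no_route_def by blast
    let ?c = "{x \<in> flow_polytope G s t. x $ e = 0}"
    have "route_vec R \<notin> ?c" using e(1) by (simp add: route_vec_def)
    then obtain F where "polytope_facet F (flow_polytope G s t)" "?c \<subseteq> F" "route_vec R \<notin> F"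
      using polytope_facet_avoiding[OF polytope_flow_polytope zero_edge_face
          route_vec_in_flow_polytope[OF Rs_route[OF R]]] by blast
    moreover have "S \<subseteq> ?c"
      unfolding C(4) using C(1) e(2) route_vec_in_flow_polytope
      by (intro hull_minimal face_of_imp_convex[OF zero_edge_face]) (auto simp: route_vec_def)
    ultimately show ?thesis by blast
  qed
  then obtain facet where facet: "\<And>R. R \<in> set Rs \<Longrightarrow> polytope_facet (facet R) (flow_polytope G s t) \<and>
      route_vec R \<notin> facet R \<and> S \<subseteq> facet R" by metis
  have "convex (\<Inter>R\<in>set Rs. facet R)"
    using facet by (intro convex_INT) (auto simp: polytope_facet_def dest: face_of_imp_convex)
  then have "(\<Inter>R\<in>set Rs. facet R) face_of (\<Inter>R\<in>set Rs. facet R)"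
    by (rule face_of_refl)
  then have "(\<Inter>R\<in>set Rs. facet R) \<in> equatorial_complex G s t Rs"
    unfolding equatorial_complex_def using facet by blast
  moreover have "S \<subseteq> (\<Inter>R\<in>set Rs. facet R)" using facet by blast
  ultimately show "S \<in> equatorial_part G s t Rs"
    unfolding equatorial_part_def DKK_triangulation_def clique_iff using C by blast
qed

text \<open>The vertices of a join are affinely independent, so its faces are exactly the hulls of
  subsets, and \<open>equatorial_sets\<close> is closed under subsets.\<close>

theorem equatorial_flow_triangulation_eq:
  "equatorial_flow_triangulation G s t Rs = {convex hull (route_vec ` D) | D. D \<in> equatorial_sets}"
proof -
  have join: "convex hull (convex hull (route_vec ` C) \<union> decomposition_simplex Rs) =
      convex hull (route_vec ` (C \<union> set Rs) :: (real ^ 'e) set)" for C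
    unfolding decomposition_simplex_def image_Un
    using hull_Un[of convex "route_vec ` C" "route_vec ` set Rs"] convex_Inter by metis
  have in_eq: "C \<union> set Rs \<in> equatorial_sets"
    if "C \<subseteq> {R. awalk s R t} \<and> crossfree C \<and> covers_no_route C" for C
  proof -
    have sub: "C \<union> set Rs - set Rs \<subseteq> C" by blast
    have "C \<union> set Rs \<subseteq> {R. awalk s R t}" using that Rs_route by auto
    moreover have "crossfree (C \<union> set Rs - set Rs)" using that sub by (blast intro: crossfree_mono)
    moreover have "covers_no_route (C \<union> set Rs - set Rs)"
      using that sub unfolding covers_no_route_def by (meson subsetD)
    ultimately show ?thesis by (simp add: equatorial_sets_def)
  qed
  show ?thesis
  proof (intro equalityI subsetI)
    fix S assume "S \<in> equatorial_flow_triangulation G s t Rs"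
    then obtain C where C: "C \<subseteq> {R. awalk s R t} \<and> crossfree C \<and> covers_no_route C"
      and S: "S face_of convex hull (route_vec ` (C \<union> set Rs))"
      unfolding equatorial_flow_triangulation_def equatorial_part_eq using join by auto
    from S obtain c where c: "c \<subseteq> route_vec ` (C \<union> set Rs)" "S = convex hull c"
      unfolding face_of_convex_hull_affine_independent[OF equatorial_affine_independent[OF in_eq[OF C]]]
      by blast
    then obtain D where "D \<subseteq> C \<union> set Rs" "c = route_vec ` D" by (auto simp: subset_image_iff)
    with c equatorial_sets_mono[OF in_eq[OF C]]
    show "S \<in> {convex hull (route_vec ` D) | D. D \<in> equatorial_sets}" by blast
  next
    fix S :: "(real ^ 'e) set" assume "S \<in> {convex hull (route_vec ` D) | D. D \<in> equatorial_sets}"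
    then obtain D where D: "D \<in> equatorial_sets" "S = convex hull (route_vec ` D)" by blast
    define C where "C = D - set Rs"
    have C: "C \<subseteq> {R. awalk s R t} \<and> crossfree C \<and> covers_no_route C"
      using D(1) by (auto simp: equatorial_sets_def C_def)
    have "route_vec ` D \<subseteq> route_vec ` (C \<union> set Rs)" by (auto simp: C_def)
    then have "S face_of convex hull (route_vec ` (C \<union> set Rs))"
      unfolding face_of_convex_hull_affine_independent[OF equatorial_affine_independent[OF in_eq[OF C]]]
      using D(2) by blast
    then have "S face_of convex hull (convex hull (route_vec ` C) \<union> decomposition_simplex Rs)"
      by (simp only: join)
    moreover have "convex hull (route_vec ` C) \<in> equatorial_part G s t Rs"
      unfolding equatorial_part_eq using C by blast
    ultimately show "S \<in> equatorial_flow_triangulation G s t Rs"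
      unfolding equatorial_flow_triangulation_def by blast
  qed
qed

end

section \<open>Regions of a strongly planar drawing\<close>

locale planar_st_dag = st_dag G s t for G :: "('v, 'e::finite) pre_digraph" and s t +
  fixes pos :: "'v \<Rightarrow> real \<times> real" and g :: "'e \<Rightarrow> real \<Rightarrow> real"
  assumes realization: "strongly_planar_realization G pos g"
begin

abbreviation xc :: "'v \<Rightarrow> real" where "xc v \<equiv> fst (pos v)"
abbreviation yc :: "'v \<Rightarrow> real" where "yc v \<equiv> snd (pos v)"

abbreviation cdom :: "'e \<Rightarrow> real set" where "cdom e \<equiv> {xc (tail G e)..xc (head G e)}"
abbreviation odom :: "'e \<Rightarrow> real set" where "odom e \<equiv> {xc (tail G e)<..<xc (head G e)}"
abbreviation pic :: "(real \<times> real) set" where "pic \<equiv> drawing G pos g"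

lemma edge_facts:
  shows xc_less: "xc (tail G e) < xc (head G e)"
    and cont_g: "continuous_on (cdom e) (g e)"
    and g_tail: "g e (xc (tail G e)) = yc (tail G e)"
    and g_head: "g e (xc (head G e)) = yc (head G e)"
  using realization
  by (auto simp: strongly_planar_realization_def arcs_UNIV edge_dom_def
      intro: piecewise_differentiable_on_imp_continuous_on)

lemma edge_curve_iff: "(x, y) \<in> edge_curve G pos g e \<longleftrightarrow> x \<in> cdom e \<and> y = g e x"
  unfolding edge_curve_def edge_dom_def by blast

lemma vertex_on_edge:
  assumes "v \<in> verts G" "xc v \<in> cdom e" "g e (xc v) = yc v"
  shows "v = tail G e \<or> v = head G e"
proof -
  have "pos v \<in> edge_curve G pos g e"
    using assms(2,3) edge_curve_iff[of "xc v" "yc v" e] by simp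
  then show ?thesis
    using realization assms(1) by (simp add: strongly_planar_realization_def arcs_UNIV)
qed

lemma edges_disjoint:
  assumes "e \<noteq> e'" "x \<in> odom e" "x \<in> cdom e'"
  shows "g e x \<noteq> g e' x"
proof
  assume eq: "g e x = g e' x"
  have "(x, g e x) \<in> edge_curve G pos g e \<inter> edge_curve G pos g e'"
    using assms eq by (simp add: edge_curve_iff)
  moreover have "edge_curve G pos g e \<inter> edge_curve G pos g e'
      \<subseteq> pos ` ({tail G e, head G e} \<inter> {tail G e', head G e'})"
    using realization assms(1) by (simp add: strongly_planar_realization_def arcs_UNIV)
  ultimately have "(x, g e x) = pos (tail G e) \<or> (x, g e x) = pos (head G e)" by blast
  then have "x = xc (tail G e) \<or> x = xc (head G e)" by (metis fst_conv)
  with assms(2) show False by auto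
qed

text \<open>Every vertex is an end of some edge, so the edge curves alone make up the
  drawing.\<close>

lemma drawing_iff: "(x, y) \<in> pic \<longleftrightarrow> (\<exists>e. x \<in> cdom e \<and> y = g e x)"
proof
  assume "(x, y) \<in> pic"
  then consider v where "v \<in> verts G" "(x, y) = pos v" | e where "(x, y) \<in> edge_curve G pos g e"
    by (auto simp: drawing_def)
  then show "\<exists>e. x \<in> cdom e \<and> y = g e x"
  proof cases
    case 1
    then have xy: "x = xc v" "y = yc v" by (simp_all add: prod_eq_iff)
    show ?thesis
    proof (cases "v = t")
      case False
      then obtain e where "tail G e = v" using arc_out_of 1 by blast
      then show ?thesis using xc_less[of e] g_tail[of e] xy by (intro exI[of _ e]) auto
    next
      case True
      then obtain e where "head G e = v" using arc_into 1 s_ne_t by metis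
      then show ?thesis using xc_less[of e] g_head[of e] xy by (intro exI[of _ e]) auto
    qed
  next
    case 2
    then show ?thesis by (auto simp: edge_curve_iff)
  qed
next
  assume "\<exists>e. x \<in> cdom e \<and> y = g e x"
  then show "(x, y) \<in> pic"
    unfolding drawing_def arcs_UNIV using edge_curve_iff by blast
qed

lemma compact_edge_curve: "compact (edge_curve G pos g e)"
  unfolding edge_curve_def edge_dom_def
  by (intro compact_continuous_image continuous_intros cont_g) auto

lemma closed_edges: "closed (\<Union>e\<in>A. edge_curve G pos g e)"
  by (intro closed_UN) (auto intro: compact_imp_closed compact_edge_curve)

lemma closed_drawing: "closed pic"
proof -
  have "pic = (\<Union>e. edge_curve G pos g e)"
  proof (intro set_eqI)
    fix z show "z \<in> pic \<longleftrightarrow> z \<in> (\<Union>e. edge_curve G pos g e)"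
      by (cases z) (auto simp: drawing_iff edge_curve_iff)
  qed
  then show ?thesis using closed_edges[of UNIV] by simp
qed

lemma awalk_xc: "awalk u p v \<Longrightarrow> xc u \<le> xc v"
proof (induction p arbitrary: u)
  case (Cons e p)
  then show ?case using xc_less[of e] by (fastforce simp: awalk_Cons)
qed (simp add: awalk_Nil_iff)

lemma xc_range:
  assumes "v \<in> verts G"
  shows "xc s \<le> xc v" "xc v \<le> xc t" "v \<noteq> s \<Longrightarrow> xc s < xc v"
proof -
  show "xc s \<le> xc v" "xc v \<le> xc t"
    using awalk_from_s[OF assms] awalk_to_t[OF assms] awalk_xc by blast+
  assume "v \<noteq> s"
  then obtain e where e: "head G e = v" using arc_into assms by blast
  then have "xc s \<le> xc (tail G e)" using awalk_from_s[OF in_verts(2)] awalk_xc by blast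
  then show "xc s < xc v" using xc_less[of e] e by simp
qed

lemma cdom_subset: "cdom e \<subseteq> {xc s..xc t}"
  using xc_range(1)[OF in_verts(2), of e] xc_range(2)[OF in_verts(1), of e] by auto

lemma walk_curve:
  assumes "awalk u p v" "p \<noteq> []"
  shows "\<exists>h. continuous_on {xc u..xc v} h \<and> h (xc u) = yc u \<and>
    (\<forall>e\<in>set p. cdom e \<subseteq> {xc u..xc v} \<and> (\<forall>x\<in>cdom e. h x = g e x)) \<and>
    (\<forall>x\<in>{xc u..xc v}. \<exists>e\<in>set p. x \<in> cdom e)"
  using assms
proof (induction p arbitrary: u)
  case (Cons e p)
  then have e: "tail G e = u" and p: "awalk (head G e) p v" by (auto simp: awalk_Cons)
  show ?case
  proof (cases "p = []")
    case True
    then have "head G e = v" using p by (simp add: awalk_Nil_iff)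
    then show ?thesis
      using cont_g[of e] g_tail[of e] True e by (intro exI[of _ "g e"]) auto
  next
    case False
    let ?m = "xc (head G e)"
    from Cons.IH[OF p False] obtain h where h: "continuous_on {?m..xc v} h" "h ?m = yc (head G e)"
      "\<forall>e'\<in>set p. cdom e' \<subseteq> {?m..xc v} \<and> (\<forall>x\<in>cdom e'. h x = g e' x)"
      "\<forall>x\<in>{?m..xc v}. \<exists>e'\<in>set p. x \<in> cdom e'" by blast
    have m: "xc u < ?m" "?m \<le> xc v" using xc_less[of e] e awalk_xc[OF p] by auto
    define k where "k x = (if x \<le> ?m then g e x else h x)" for x
    have eq: "g e ?m = h ?m" using g_head h(2) by simp
    have "{x \<in> {xc u..xc v}. x \<le> ?m} = cdom e" "{x \<in> {xc u..xc v}. ?m \<le> x} = {?m..xc v}"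
      using m e by auto
    then have "continuous_on {xc u..xc v} k"
      unfolding k_def using cont_g[of e] h(1) eq
      by (intro continuous_on_cases_le continuous_on_id) auto
    moreover have "k (xc u) = yc u" using m g_tail[of e] e by (simp add: k_def)
    moreover have "cdom e' \<subseteq> {xc u..xc v} \<and> (\<forall>x\<in>cdom e'. k x = g e' x)" if "e' \<in> set (e # p)" for e'
    proof (cases "e' = e")
      case True
      then show ?thesis using m e by (auto simp: k_def)
    next
      case False
      then have e': "cdom e' \<subseteq> {?m..xc v}" "\<forall>x\<in>cdom e'. h x = g e' x" using h(3) that by auto
      have "k x = h x" if "x \<in> {?m..xc v}" for x using that eq by (auto simp: k_def)
      then show ?thesis using e' m by (auto simp: subset_iff)
    qed
    moreover have "\<exists>e'\<in>set (e # p). x \<in> cdom e'" if "x \<in> {xc u..xc v}" for x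
      using that h(4) e by (cases "x \<le> ?m") auto
    ultimately show ?thesis by blast
  qed
qed simp

text \<open>\<open>walk_curve\<close> supplies such a function for every route. Its values are
  specified only over the strip between \<open>s\<close> and \<open>t\<close>.\<close>

definition curve :: "'e list \<Rightarrow> real \<Rightarrow> real" where
  "curve R = (SOME h. continuous_on {xc s..xc t} h \<and> h (xc s) = yc s \<and>
    (\<forall>e\<in>set R. cdom e \<subseteq> {xc s..xc t} \<and> (\<forall>x\<in>cdom e. h x = g e x)) \<and>
    (\<forall>x\<in>{xc s..xc t}. \<exists>e\<in>set R. x \<in> cdom e))"

lemma curve:
  assumes "awalk s R t"
  shows "continuous_on {xc s..xc t} (curve R)"
    and "e \<in> set R \<Longrightarrow> x \<in> cdom e \<Longrightarrow> curve R x = g e x"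
    and "x \<in> {xc s..xc t} \<Longrightarrow> \<exists>e\<in>set R. x \<in> cdom e"
proof -
  have "R \<noteq> []" using assms s_ne_t by (auto simp: awalk_Nil_iff)
  from someI_ex[OF walk_curve[OF assms this]]
  have *: "continuous_on {xc s..xc t} (curve R) \<and> curve R (xc s) = yc s \<and>
    (\<forall>e\<in>set R. cdom e \<subseteq> {xc s..xc t} \<and> (\<forall>x\<in>cdom e. curve R x = g e x)) \<and>
    (\<forall>x\<in>{xc s..xc t}. \<exists>e\<in>set R. x \<in> cdom e)"
    unfolding curve_def .
  then show "continuous_on {xc s..xc t} (curve R)"
    "e \<in> set R \<Longrightarrow> x \<in> cdom e \<Longrightarrow> curve R x = g e x"
    "x \<in> {xc s..xc t} \<Longrightarrow> \<exists>e\<in>set R. x \<in> cdom e" by blast+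
qed

lemma curve_in_drawing: "awalk s R t \<Longrightarrow> x \<in> {xc s..xc t} \<Longrightarrow> (x, curve R x) \<in> pic"
  using curve(2,3) drawing_iff by metis

lemma edge_on_route: "\<exists>R. awalk s R t \<and> e \<in> set R"
proof -
  obtain p where "awalk s p (tail G e)" using awalk_from_s in_verts by blast
  moreover obtain q where "awalk (head G e) q t" using awalk_to_t in_verts by blast
  ultimately have "awalk s (p @ e # q) t" by (auto simp: awalk_append awalk_Cons)
  then show ?thesis by (intro exI[of _ "p @ e # q"]) simp
qed

text \<open>Every edge extends to a route in both directions, so obstacles above and below a point
  can be taken to be route curves that cross the whole strip.\<close>

lemma drawing_on_route:
  assumes "(x, y) \<in> pic"
  shows "\<exists>R. awalk s R t \<and> curve R x = y \<and> x \<in> {xc s..xc t}"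
proof -
  obtain e where e: "x \<in> cdom e" "y = g e x" using assms drawing_iff by blast
  obtain R where "awalk s R t" "e \<in> set R" using edge_on_route by blast
  then show ?thesis using e cdom_subset[of e] curve(2) by blast
qed

text \<open>Every other vertex lies strictly between \<open>s\<close> and \<open>t\<close>, so an
  edge over the abscissa of \<open>s\<close> starts at \<open>s\<close>, and one over that of
  \<open>t\<close> ends at \<open>t\<close>. This closes the area between two routes at its
  ends.\<close>

lemma curve_ends:
  assumes "awalk s R t" "awalk s R' t"
  shows "curve R (xc s) = curve R' (xc s)" "curve R (xc t) = curve R' (xc t)"
proof -
  have "curve R (xc s) = yc s \<and> curve R (xc t) = yc t" if R: "awalk s R t" for R
  proof -
    have st: "xc s \<le> xc t" using awalk_xc[OF R] .
    obtain e where e: "e \<in> set R" "xc s \<in> cdom e" using curve(3)[OF R, of "xc s"] st by auto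
    then have "tail G e = s" using xc_range(3)[OF in_verts(2), of e] by force
    then have 1: "curve R (xc s) = yc s" using curve(2)[OF R e] g_tail[of e] by simp
    obtain e where e: "e \<in> set R" "xc t \<in> cdom e" using curve(3)[OF R, of "xc t"] st by auto
    have "head G e = t"
    proof (rule ccontr)
      assume "head G e \<noteq> t"
      then obtain e' where "tail G e' = head G e" using arc_out_of in_verts by blast
      then have "xc (head G e) < xc t"
        using xc_less[of e'] xc_range(2)[OF in_verts(1), of e'] by simp
      with e(2) show False by simp
    qed
    then show ?thesis using 1 curve(2)[OF R e] g_head[of e] by simp
  qed
  then show "curve R (xc s) = curve R' (xc s)" "curve R (xc t) = curve R' (xc t)" using assms by simp_all
qed

lemma region_props:
  assumes "c \<in> regions G pos g"
  shows "open c" "connected c" "c \<subseteq> - pic" "c \<noteq> {}"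
proof -
  from assms have c: "c \<in> components (- pic)" by (simp add: regions_def)
  show "open c" "connected c" "c \<subseteq> - pic" "c \<noteq> {}"
    using closed_drawing open_components[OF _ c] in_components_connected[OF c]
      in_components_subset[OF c] in_components_nonempty[OF c] by (simp_all add: open_Compl)
qed

text \<open>Routes through the drawing points below and above enclose an area. As they meet at
  \<open>s\<close> and at \<open>t\<close>, the closed area \<open>?K\<close> without the open one
  \<open>?U\<close> consists of drawing. The region is connected, avoids the drawing and meets
  \<open>?U\<close>, so it cannot leave \<open>?U\<close>.\<close>

lemma enclosed:
  assumes c: "c \<in> regions G pos g" "(x, y) \<in> c"
    and "(x, y1) \<in> pic" "y1 < y" "(x, y2) \<in> pic" "y < y2"
  shows "bounded c" "c \<subseteq> {xc s<..<xc t} \<times> UNIV"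
proof -
  obtain R1 where R1: "awalk s R1 t" "curve R1 x = y1" and x: "x \<in> {xc s..xc t}"
    using drawing_on_route assms(3) by blast
  obtain R2 where R2: "awalk s R2 t" "curve R2 x = y2"
    using drawing_on_route assms(5) by blast
  let ?I = "{xc s<..<xc t} \<times> (UNIV :: real set)" and ?J = "{xc s..xc t} \<times> (UNIV :: real set)"
  let ?U = "{z \<in> ?I. curve R1 (fst z) < snd z \<and> snd z < curve R2 (fst z)}"
  let ?K = "{z \<in> ?J. curve R1 (fst z) \<le> snd z \<and> snd z \<le> curve R2 (fst z)}"
  have cont: "continuous_on ?J (\<lambda>z. curve R (fst z))" if "awalk s R t" for R
    by (rule continuous_on_compose2[OF curve(1)[OF that] continuous_on_fst[OF continuous_on_id]]) auto
  have contI: "continuous_on ?I (\<lambda>z. curve R (fst z))" if "awalk s R t" for R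
    by (rule continuous_on_subset[OF cont[OF that]]) auto
  have "open ?U"
  proof -
    have "open ?I" by (intro open_Times) auto
    then have "open ({z \<in> ?I. 0 < snd z - curve R1 (fst z)} \<inter> {z \<in> ?I. 0 < curve R2 (fst z) - snd z})"
      by (intro open_Int continuous_open_preimage[of ?I _ "{0<..}", unfolded vimage_def Int_def, simplified]
          continuous_intros contI R1 R2)
    also have "\<dots> = ?U" by auto
    finally show ?thesis .
  qed
  have "closed ?K"
  proof -
    have "closed ?J" by (intro closed_Times) auto
    then have "closed ({z \<in> ?J. 0 \<le> snd z - curve R1 (fst z)} \<inter> {z \<in> ?J. 0 \<le> curve R2 (fst z) - snd z})"
      by (intro closed_Int continuous_closed_preimage[of ?J _ "{0..}", unfolded vimage_def Int_def, simplified]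
          continuous_intros cont R1 R2)
    also have "\<dots> = ?K" by auto
    finally show ?thesis .
  qed
  have boundary: "?K - ?U \<subseteq> pic"
  proof
    fix z assume z: "z \<in> ?K - ?U"
    obtain a b where ab: "z = (a, b)" by force
    have "b = curve R1 a \<or> b = curve R2 a"
      using z curve_ends[OF R1(1) R2(1)] unfolding ab by (cases "a = xc s \<or> a = xc t") auto
    then show "z \<in> pic" using z curve_in_drawing R1(1) R2(1) unfolding ab by auto
  qed
  have "(x, y) \<in> ?U"
  proof -
    have "(x, y) \<in> ?K" using x R1 R2 assms(4,6) by simp
    moreover have "(x, y) \<notin> pic" using region_props(3)[OF c(1)] c(2) by blast
    ultimately show ?thesis using boundary by blast
  qed
  moreover have "?U \<inter> c = {} \<or> - ?K \<inter> c = {}"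
  proof (rule connectedD)
    show "connected c" by (rule region_props(2)[OF c(1)])
    show "open (- ?K)" using \<open>closed ?K\<close> by (rule open_Compl)
    show "c \<subseteq> ?U \<union> (- ?K)" using region_props(3)[OF c(1)] boundary by blast
    show "?U \<inter> (- ?K) \<inter> c = {}" by auto
  qed (fact \<open>open ?U\<close>)
  ultimately have "- ?K \<inter> c = {}" using c(2) by (metis (no_types, lifting) IntI emptyE)
  then have cU: "c \<subseteq> ?U" using region_props(3)[OF c(1)] boundary by blast
  then show "c \<subseteq> {xc s<..<xc t} \<times> UNIV" by blast
  obtain b1 where b1: "\<And>x. x \<in> {xc s..xc t} \<Longrightarrow> \<bar>curve R1 x\<bar> \<le> b1"
    using compact_imp_bounded[OF compact_continuous_image[OF curve(1)[OF R1(1)] compact_Icc]]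
    by (force simp: bounded_iff)
  obtain b2 where b2: "\<And>x. x \<in> {xc s..xc t} \<Longrightarrow> \<bar>curve R2 x\<bar> \<le> b2"
    using compact_imp_bounded[OF compact_continuous_image[OF curve(1)[OF R2(1)] compact_Icc]]
    by (force simp: bounded_iff)
  have "c \<subseteq> {xc s..xc t} \<times> {- b1..b2}"
  proof
    fix z assume "z \<in> c"
    then have "z \<in> ?U" using cU by blast
    then show "z \<in> {xc s..xc t} \<times> {- b1..b2}"
      using b1[of "fst z"] b2[of "fst z"] by (cases z) (simp, linarith)
  qed
  then show "bounded c"
    by (rule bounded_subset[OF bounded_Times[OF bounded_closed_interval bounded_closed_interval]])
qed

text \<open>A ray that misses the drawing is connected and hence stays in the region of its starting
  point.\<close>

lemma vertical_ray_unbounded: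
  assumes c: "c \<in> regions G pos g" "(x, y) \<in> c"
  shows "(\<And>y'. y < y' \<Longrightarrow> (x, y') \<notin> pic) \<Longrightarrow> \<not> bounded c"
    and "(\<And>y'. y' < y \<Longrightarrow> (x, y') \<notin> pic) \<Longrightarrow> \<not> bounded c"
proof -
  have notD: "(x, y) \<notin> pic" using c region_props(3) by blast
  have ray: "\<not> bounded c" if Y: "connected Y" "y \<in> Y" "\<not> bounded Y" "\<And>y'. y' \<in> Y \<Longrightarrow> (x, y') \<notin> pic" for Y
  proof
    assume b: "bounded c"
    have "connected ({x} \<times> Y)" using Y(1) by (intro connected_Times) auto
    then have "{x} \<times> Y \<subseteq> c"
      using c Y by (intro components_maximal[of c "- pic"]) (auto simp: regions_def)
    then have "bounded ({x} \<times> Y)" by (rule bounded_subset[OF b])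
    then have "bounded (snd ` ({x} \<times> Y))" by (rule bounded_snd)
    then show False using Y(3) by simp
  qed
  have unb: "\<not> bounded {y..}" "\<not> bounded {..y}"
  proof -
    have "\<exists>z\<in>{y..}. B < norm z" "\<exists>z\<in>{..y}. B < norm z" for B
      by (rule bexI[of _ "max y (B + 1)"], auto simp: max_def)
        (rule bexI[of _ "min y (- B - 1)"], auto simp: min_def)
    then show "\<not> bounded {y..}" "\<not> bounded {..y}"
      unfolding bounded_iff by (meson not_less)+
  qed
  show "(\<And>y'. y < y' \<Longrightarrow> (x, y') \<notin> pic) \<Longrightarrow> \<not> bounded c"
    by (rule ray[of "{y..}"]) (use notD unb(1) in \<open>auto simp: le_less\<close>)
  show "(\<And>y'. y' < y \<Longrightarrow> (x, y') \<notin> pic) \<Longrightarrow> \<not> bounded c"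
    by (rule ray[of "{..y}"]) (use notD unb(2) in \<open>auto simp: le_less\<close>)
qed

lemma bounded_region_iff:
  assumes c: "c \<in> regions G pos g" "(x, y) \<in> c"
  shows "bounded c \<longleftrightarrow> (\<exists>y'<y. (x, y') \<in> pic) \<and> (\<exists>y'>y. (x, y') \<in> pic)"
  using enclosed(1)[OF c] vertical_ray_unbounded[OF c] by blast

lemma bounded_region_strip:
  assumes "c \<in> regions G pos g" "bounded c"
  shows "c \<subseteq> {xc s<..<xc t} \<times> UNIV"
proof -
  obtain x y where xy: "(x, y) \<in> c" using region_props(4)[OF assms(1)] by auto
  then obtain y1 y2 where "(x, y1) \<in> pic" "y1 < y" "(x, y2) \<in> pic" "y < y2"
    using bounded_region_iff[OF assms(1) xy] assms(2) by blast
  then show ?thesis by (rule enclosed(2)[OF assms(1) xy])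
qed

text \<open>The height over the route curve is continuous on the region and vanishes nowhere there.
  Boundedness confines the region to the strip over which the curve is specified.\<close>

lemma region_one_side:
  assumes c: "c \<in> regions G pos g" "bounded c" and R: "awalk s R t"
    and z: "(x, y) \<in> c" "(x', y') \<in> c" "curve R x < y"
  shows "curve R x' < y'"
proof (rule ccontr)
  assume "\<not> curve R x' < y'"
  let ?h = "\<lambda>z. snd z - curve R (fst z)"
  have strip: "c \<subseteq> {xc s<..<xc t} \<times> UNIV" by (rule bounded_region_strip[OF c])
  have "continuous_on c ?h"
    by (intro continuous_intros continuous_on_compose2[OF curve(1)[OF R] continuous_on_fst[OF continuous_on_id]])
      (use strip in auto)
  then have "connected (?h ` c)"
    by (rule connected_continuous_image) (rule region_props(2)[OF c(1)])
  moreover have "y' - curve R x' \<in> ?h ` c" "y - curve R x \<in> ?h ` c"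
    using z by (auto intro: rev_image_eqI)
  ultimately have "0 \<in> ?h ` c"
    using connectedD_interval[of "?h ` c" "y' - curve R x'" "y - curve R x" 0] z(3) \<open>\<not> _\<close> by simp
  then obtain a b where ab: "(a, b) \<in> c" "b = curve R a" by auto
  then have "(a, b) \<in> pic" using curve_in_drawing[OF R, of a] strip by auto
  then show False using ab(1) region_props(3)[OF c(1)] by blast
qed

text \<open>The sign \<open>\<sigma>\<close> selects the side of an edge: 1 for above, -1 for below.\<close>

lemma local_side_region:
  assumes \<sigma>: "\<sigma> = 1 \<or> \<sigma> = -1" and x0: "x0 \<in> odom e"
  shows "\<exists>c\<in>regions G pos g. \<exists>\<rho>>0. {x0 - \<rho><..<x0 + \<rho>} \<subseteq> odom e \<and>
    (\<forall>x\<in>{x0 - \<rho><..<x0 + \<rho>}. \<forall>d\<in>{0<..<\<rho>}. (x, g e x + \<sigma> * d) \<in> c)"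
proof -
  \<comment> \<open>The other edges form a closed set that misses the given interior point of
    \<open>e\<close>, so a small ball around the point meets only \<open>e\<close>.\<close>
  define K where "K = (\<Union>e'\<in>- {e}. edge_curve G pos g e')"
  have "(x0, g e x0) \<in> - K"
    using x0 edges_disjoint[of e _ x0] by (fastforce simp: edge_curve_iff K_def)
  moreover have "open (- K)" unfolding K_def using closed_edges[of "- {e}"] by (rule open_Compl)
  ultimately obtain r where r: "0 < r" "ball (x0, g e x0) r \<subseteq> - K"
    by (metis openE)
  have "continuous_on (odom e) (g e)" by (rule continuous_on_subset[OF cont_g]) auto
  then have "isCont (g e) x0" using x0 by (simp add: continuous_on_eq_continuous_at)
  then obtain \<delta> where \<delta>: "0 < \<delta>" "\<And>x. dist x x0 < \<delta> \<Longrightarrow> dist (g e x) (g e x0) < r / 4"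
    using r(1) unfolding continuous_at_eps_delta by (metis divide_pos_pos zero_less_numeral)
  \<comment> \<open>The displacements along the axis, along the edge and off the edge are each below
    \<open>r / 4\<close>, which keeps the point in the ball of radius \<open>r\<close>. The last two
    entries keep it over the open edge.\<close>
  define \<rho> where "\<rho> = Min {\<delta>, r / 4, x0 - xc (tail G e), xc (head G e) - x0}"
  have \<rho>: "0 < \<rho>" "\<rho> \<le> \<delta>" "\<rho> \<le> r / 4" "\<rho> \<le> x0 - xc (tail G e)" "\<rho> \<le> xc (head G e) - x0"
    using \<delta>(1) r(1) x0 unfolding \<rho>_def by (simp, (intro Min_le; simp)+)
  then have sub: "{x0 - \<rho><..<x0 + \<rho>} \<subseteq> odom e" by auto
  let ?T = "(\<lambda>z. (fst z, g e (fst z) + \<sigma> * snd z)) ` ({x0 - \<rho><..<x0 + \<rho>} \<times> {0<..<\<rho>})"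
  have "connected ?T"
  proof (rule connected_continuous_image)
    have "continuous_on {x0 - \<rho><..<x0 + \<rho>} (g e)"
      by (rule continuous_on_subset[OF \<open>continuous_on (odom e) (g e)\<close> sub])
    then have "continuous_on ({x0 - \<rho><..<x0 + \<rho>} \<times> {0<..<\<rho>}) (\<lambda>z. g e (fst z))"
      by (rule continuous_on_compose2[OF _ continuous_on_fst[OF continuous_on_id]]) auto
    then show "continuous_on ({x0 - \<rho><..<x0 + \<rho>} \<times> {0<..<\<rho>}) (\<lambda>z. (fst z, g e (fst z) + \<sigma> * snd z))"
      by (intro continuous_intros)
    show "connected ({x0 - \<rho><..<x0 + \<rho>} \<times> {0<..<\<rho>})" by (intro connected_Times) auto
  qed
  moreover have "?T \<subseteq> - pic"
  proof
    fix z assume "z \<in> ?T"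
    then obtain w where w: "w \<in> {x0 - \<rho><..<x0 + \<rho>} \<times> {0<..<\<rho>}" "z = (fst w, g e (fst w) + \<sigma> * snd w)"
      by blast
    obtain x d where "w = (x, d)" by force
    with w have z: "z = (x, g e x + \<sigma> * d)" "x \<in> {x0 - \<rho><..<x0 + \<rho>}" "d \<in> {0<..<\<rho>}" by simp_all
    have "dist x x0 < \<delta>" using z(2) \<rho> by (auto simp: dist_real_def)
    then have "\<bar>g e x - g e x0\<bar> < r / 4" using \<delta>(2) by (simp add: dist_real_def)
    moreover have "\<bar>x - x0\<bar> < \<rho>" "\<bar>\<sigma> * d\<bar> < \<rho>" using z(2,3) \<sigma> by (auto simp: abs_less_iff)
    moreover note \<rho>(3)
    ultimately have "\<bar>x0 - x\<bar> + \<bar>g e x0 - (g e x + \<sigma> * d)\<bar> < r" using r(1) by linarith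
    then have "z \<in> ball (x0, g e x0) r"
      using sqrt_sum_squares_le_sum_abs[of "x0 - x" "g e x0 - (g e x + \<sigma> * d)"]
      by (simp add: z(1) dist_Pair_Pair dist_real_def)
    then have notK: "z \<notin> K" using r(2) by blast
    show "z \<in> - pic"
    proof
      assume "z \<in> pic"
      then obtain e' where e': "x \<in> cdom e'" "g e x + \<sigma> * d = g e' x"
        using drawing_iff z(1) by blast
      then have "e' = e" using notK z(1) by (auto simp: edge_curve_iff K_def)
      then show False using e' z(3) \<sigma> by auto
    qed
  qed
  moreover have "?T \<noteq> {}" using \<rho>(1) by (auto intro!: exI[of _ x0] dense)
  ultimately obtain c where c: "c \<in> components (- pic)" "?T \<subseteq> c"
    using exists_component_superset[of ?T "- pic"] by blast
  have "(x, g e x + \<sigma> * d) \<in> c" if "x \<in> {x0 - \<rho><..<x0 + \<rho>}" "d \<in> {0<..<\<rho>}" for x d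
    using c(2) that by (force intro: image_eqI[of _ _ "(x, d)"])
  then show ?thesis using c(1) \<rho>(1) sub unfolding regions_def by blast
qed

text \<open>The region met near one point of the edge is locally constant along the open edge, hence
  constant on an interval. Two regions with the property would share a point near the edge.\<close>

lemma side_region:
  assumes \<sigma>: "\<sigma> = 1 \<or> \<sigma> = -1"
  shows "\<exists>!c. c \<in> regions G pos g \<and> (\<forall>x\<in>odom e. \<forall>\<^sub>F d in at_right 0. (x, g e x + \<sigma> * d) \<in> c)"
proof -
  have "\<forall>x\<in>odom e. \<exists>c. c \<in> regions G pos g \<and> (\<exists>\<rho>>0. {x - \<rho><..<x + \<rho>} \<subseteq> odom e \<and>
      (\<forall>x'\<in>{x - \<rho><..<x + \<rho>}. \<forall>d\<in>{0<..<\<rho>}. (x', g e x' + \<sigma> * d) \<in> c))"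
    using local_side_region[OF \<sigma>] by blast
  from bchoice[OF this] obtain C where C: "\<And>x. x \<in> odom e \<Longrightarrow> C x \<in> regions G pos g"
    "\<And>x. x \<in> odom e \<Longrightarrow> \<exists>\<rho>>0. {x - \<rho><..<x + \<rho>} \<subseteq> odom e \<and>
      (\<forall>x'\<in>{x - \<rho><..<x + \<rho>}. \<forall>d\<in>{0<..<\<rho>}. (x', g e x' + \<sigma> * d) \<in> C x)" by blast
  have eq: "c = c'" if "c \<in> regions G pos g" "c' \<in> regions G pos g" "z \<in> c" "z \<in> c'" for c c' z
    using that components_eq[of c "- pic" c'] unfolding regions_def by blast
  have "C constant_on odom e"
  proof (rule locally_constant_imp_constant)
    fix x assume x: "x \<in> odom e"
    then obtain \<rho> where \<rho>: "0 < \<rho>" "{x - \<rho><..<x + \<rho>} \<subseteq> odom e"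
      "\<And>x' d. x' \<in> {x - \<rho><..<x + \<rho>} \<Longrightarrow> d \<in> {0<..<\<rho>} \<Longrightarrow> (x', g e x' + \<sigma> * d) \<in> C x"
      using C(2) by blast
    have "C x' = C x" if x': "x' \<in> {x - \<rho><..<x + \<rho>}" for x'
    proof -
      have x'o: "x' \<in> odom e" using x' \<rho>(2) by blast
      then obtain \<rho>' where \<rho>': "0 < \<rho>'"
        "\<And>x'' d. x'' \<in> {x' - \<rho>'<..<x' + \<rho>'} \<Longrightarrow> d \<in> {0<..<\<rho>'} \<Longrightarrow> (x'', g e x'' + \<sigma> * d) \<in> C x'"
        using C(2) by blast
      obtain d where d: "0 < d" "d < min \<rho> \<rho>'" using dense[of 0 "min \<rho> \<rho>'"] \<rho>(1) \<rho>'(1) by auto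
      show ?thesis
        using eq[OF C(1)[OF x'o] C(1)[OF x], of "(x', g e x' + \<sigma> * d)"] \<rho>(3)[OF x', of d] \<rho>'(2)[of x' d] d \<rho>'(1)
        by simp
    qed
    moreover have "openin (top_of_set (odom e)) {x - \<rho><..<x + \<rho>}"
      by (rule open_subset[OF \<rho>(2)]) simp
    moreover have "x \<in> {x - \<rho><..<x + \<rho>}" using \<rho>(1) by simp
    ultimately show "\<exists>T. openin (top_of_set (odom e)) T \<and> x \<in> T \<and> (\<forall>x'\<in>T. C x' = C x)"
      by (intro exI conjI ballI) assumption+
  qed simp
  then obtain c where c: "\<And>x. x \<in> odom e \<Longrightarrow> C x = c" unfolding constant_on_def by blast
  obtain x0 where x0: "x0 \<in> odom e" using dense[OF xc_less[of e]] by auto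
  have ev: "\<forall>\<^sub>F d in at_right 0. (x, g e x + \<sigma> * d) \<in> c" if x: "x \<in> odom e" for x
  proof -
    obtain \<rho> where "0 < \<rho>"
      "\<And>x' d. x' \<in> {x - \<rho><..<x + \<rho>} \<Longrightarrow> d \<in> {0<..<\<rho>} \<Longrightarrow> (x', g e x' + \<sigma> * d) \<in> C x"
      using C(2)[OF x] by blast
    then show ?thesis
      using c[OF x] unfolding eventually_at_right_field by (intro exI[of _ \<rho>]) auto
  qed
  show ?thesis
  proof (rule ex1I[of _ c])
    show "c \<in> regions G pos g \<and> (\<forall>x\<in>odom e. \<forall>\<^sub>F d in at_right 0. (x, g e x + \<sigma> * d) \<in> c)"
      using C(1)[OF x0] c[OF x0] ev by simp
    fix c' assume c': "c' \<in> regions G pos g \<and> (\<forall>x\<in>odom e. \<forall>\<^sub>F d in at_right 0. (x, g e x + \<sigma> * d) \<in> c')"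
    then have "\<forall>\<^sub>F d in at_right 0. (x0, g e x0 + \<sigma> * d) \<in> c' \<and> (x0, g e x0 + \<sigma> * d) \<in> c"
      using ev[OF x0] x0 by (intro eventually_conj) auto
    then obtain d where "(x0, g e x0 + \<sigma> * d) \<in> c' \<and> (x0, g e x0 + \<sigma> * d) \<in> c"
      using eventually_happens[of _ "at_right (0::real)"] trivial_limit_at_right_real by blast
    then show "c' = c" using eq c' C(1)[OF x0] c[OF x0] by blast
  qed
qed

end

locale indexed_planar_st_dag = planar_st_dag G s t pos g
  for G :: "('v, 'e::finite) pre_digraph" and s t pos g +
  fixes reg :: "'r::finite \<Rightarrow> (real \<times> real) set"
  assumes reg_bij: "bij_betw reg UNIV (regions G pos g)"
begin

lemma reg_region: "reg r \<in> regions G pos g"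
  using reg_bij by (auto simp: bij_betw_def)

lemma reg_surj: "c \<in> regions G pos g \<Longrightarrow> \<exists>r. reg r = c"
  using reg_bij unfolding bij_betw_def by (metis rangeE)

lemma reg_inj: "reg r = reg r' \<longleftrightarrow> r = r'"
  using reg_bij by (auto simp: bij_betw_def inj_on_def)

lemma reg_overlap: "z \<in> reg r \<Longrightarrow> z \<in> reg r' \<Longrightarrow> r = r'"
  using components_eq[of "reg r" "- pic" "reg r'"] reg_region reg_inj unfolding regions_def by blast

lemma ex1_reg: "z \<notin> pic \<Longrightarrow> \<exists>!r. z \<in> reg r"
proof -
  assume "z \<notin> pic"
  then have "z \<in> \<Union>(components (- pic))" by (simp add: Union_components)
  then obtain r where "z \<in> reg r" using reg_surj unfolding regions_def by blast
  then show ?thesis using reg_overlap by blast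
qed

lemma reg_not_D: "z \<in> reg r \<Longrightarrow> z \<notin> pic"
  using region_props(3)[OF reg_region] by blast

lemma ex1_side:
  assumes "\<sigma> = 1 \<or> \<sigma> = -1"
  shows "\<exists>!r. \<forall>x\<in>odom e. \<forall>\<^sub>F d in at_right 0. (x, g e x + \<sigma> * d) \<in> reg r"
proof -
  obtain c where c: "c \<in> regions G pos g" "\<forall>x\<in>odom e. \<forall>\<^sub>F d in at_right 0. (x, g e x + \<sigma> * d) \<in> c"
    using side_region[OF assms] by blast
  obtain r where "reg r = c" using reg_surj[OF c(1)] by blast
  with c(2) have "\<forall>x\<in>odom e. \<forall>\<^sub>F d in at_right 0. (x, g e x + \<sigma> * d) \<in> reg r" by simp
  moreover have "r' = r''" if "\<forall>x\<in>odom e. \<forall>\<^sub>F d in at_right 0. (x, g e x + \<sigma> * d) \<in> reg r'"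
    "\<forall>x\<in>odom e. \<forall>\<^sub>F d in at_right 0. (x, g e x + \<sigma> * d) \<in> reg r''" for r' r''
    using side_region[OF assms, of e] that reg_region reg_inj by blast
  ultimately show ?thesis by blast
qed

definition upper :: "'e \<Rightarrow> 'r" where
  "upper e = (THE q. directly_above G pos g e (reg q))"

definition lower :: "'e \<Rightarrow> 'r" where
  "lower e = (THE p. directly_below G pos g e (reg p))"

lemma directly_above_iff: "directly_above G pos g e (reg q) \<longleftrightarrow> q = upper e"
proof -
  have "\<exists>!q. directly_above G pos g e (reg q)"
    using ex1_side[of 1 e] by (simp add: directly_above_def)
  then show ?thesis unfolding upper_def by (metis theI_unique)
qed

lemma directly_below_iff: "directly_below G pos g e (reg p) \<longleftrightarrow> p = lower e"
proof -
  have "\<exists>!p. directly_below G pos g e (reg p)"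
    using ex1_side[of "-1" e] by (simp add: directly_below_def)
  then show ?thesis unfolding lower_def by (metis theI_unique)
qed

lemma near_upper: "x \<in> odom e \<Longrightarrow> \<forall>\<^sub>F d in at_right 0. (x, g e x + d) \<in> reg (upper e)"
  using directly_above_iff[of e "upper e"] by (simp add: directly_above_def)

lemma near_lower: "x \<in> odom e \<Longrightarrow> \<forall>\<^sub>F d in at_right 0. (x, g e x - d) \<in> reg (lower e)"
  using directly_below_iff[of e "lower e"] by (simp add: directly_below_def)

end

section \<open>Maps on regions and flows\<close>

context indexed_planar_st_dag
begin

abbreviation flow :: "real ^ 'r \<Rightarrow> real ^ 'e" where "flow \<equiv> flow_of_map G pos g reg"
abbreviation above :: "real ^ 'r \<Rightarrow> 'e \<Rightarrow> real" where "above \<equiv> value_above G pos g reg"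
abbreviation below :: "real ^ 'r \<Rightarrow> 'e \<Rightarrow> real" where "below \<equiv> value_below G pos g reg"

lemma above_eq: "above f e = (if bounded (reg (upper e)) then f $ upper e else 1)"
  by (simp add: value_above_def upper_def dual_poset_def Let_def)

lemma below_eq: "below f e = (if bounded (reg (lower e)) then f $ lower e else 0)"
  by (simp add: value_below_def lower_def dual_poset_def Let_def)

lemma flow_eq: "flow f $ e = above f e - below f e"
  by (simp add: flow_of_map_def)

text \<open>With value 1 for points of the unbounded region above the drawing and 0 for the others, the
  value increases along a vertical line by the flow on each edge that is crossed.\<close>

definition val :: "real ^ 'r \<Rightarrow> real \<times> real \<Rightarrow> real" where
  "val f z = (let r = THE r. z \<in> reg r in
     if bounded (reg r) then f $ r else if \<exists>y < snd z. (fst z, y) \<in> pic then 1 else 0)"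

lemma val_eq:
  assumes "(x, y) \<in> reg r"
  shows "val f (x, y) = (if bounded (reg r) then f $ r else if \<exists>y' < y. (x, y') \<in> pic then 1 else 0)"
proof -
  have "(THE r. (x, y) \<in> reg r) = r"
    using assms reg_overlap by (intro the_equality) auto
  then show ?thesis by (simp add: val_def)
qed

text \<open>The unbounded region surrounds the drawing, so there \<open>val\<close> depends on the
  point. The last assumption, drawing below both points or above both, puts them on the same
  side.\<close>

lemma val_cong:
  assumes "(x, y) \<in> reg r" "(x', y') \<in> reg r"
    and "(\<exists>u<y. (x, u) \<in> pic) \<and> (\<exists>u<y'. (x', u) \<in> pic) \<or> (\<exists>u>y. (x, u) \<in> pic) \<and> (\<exists>u>y'. (x', u) \<in> pic)"
  shows "val f (x, y) = val f (x', y')"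
  using assms(3) bounded_region_iff[OF reg_region assms(1)] bounded_region_iff[OF reg_region assms(2)]
  unfolding val_eq[OF assms(1)] val_eq[OF assms(2)] by auto

lemma in_drawing: "x \<in> odom e \<Longrightarrow> (x, g e x) \<in> pic"
  using drawing_iff by force

lemma val_upper:
  assumes "x \<in> odom e" "0 < d" "(x, g e x + d) \<in> reg (upper e)"
  shows "val f (x, g e x + d) = above f e"
  using assms in_drawing[OF assms(1)] unfolding val_eq[OF assms(3)] above_eq by force

lemma val_lower:
  assumes "x \<in> odom e" "0 < d" "(x, g e x - d) \<in> reg (lower e)"
  shows "val f (x, g e x - d) = below f e"
proof -
  have "(x, g e x) \<in> pic \<and> g e x > g e x - d" using assms in_drawing by simp
  then show ?thesis
    using bounded_region_iff[OF reg_region assms(3)] unfolding val_eq[OF assms(3)] below_eq by auto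
qed

lemma same_reg:
  assumes "connected S" "S \<inter> pic = {}" "z \<in> S" "z \<in> reg r" "z' \<in> S"
  shows "z' \<in> reg r"
proof -
  have "S \<subseteq> reg r"
    using assms reg_region[of r] by (intro components_maximal[of "reg r" "- pic"]) (auto simp: regions_def)
  then show ?thesis using assms(5) by blast
qed

lemma val_vertical:
  assumes "b \<le> b'" "\<And>y. b \<le> y \<Longrightarrow> y \<le> b' \<Longrightarrow> (x, y) \<notin> pic"
  shows "val f (x, b) = val f (x, b')"
proof -
  obtain r where r: "(x, b) \<in> reg r" using ex1_reg[of "(x, b)"] assms by blast
  have "connected ({x} \<times> {b..b'})" by (intro connected_Times) auto
  then have r': "(x, b') \<in> reg r"
    by (rule same_reg[OF _ _ _ r]) (use assms in auto)
  have "(\<exists>y<b. (x, y) \<in> pic) \<longleftrightarrow> (\<exists>y<b'. (x, y) \<in> pic)"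
    using assms by (meson le_less_trans less_le_not_le linear order_trans)
  then show ?thesis unfolding val_eq[OF r] val_eq[OF r'] by simp
qed

definition crossing :: "real \<Rightarrow> real \<Rightarrow> real \<Rightarrow> 'e set" where
  "crossing x b b' = {e. x \<in> odom e \<and> b < g e x \<and> g e x < b'}"

lemma eventually_less_at_right_0: "0 < c \<Longrightarrow> \<forall>\<^sub>F d in at_right 0. d < (c::real)"
  by (auto simp: eventually_at_right_field)

lemma eventually_pos_at_right_0: "\<forall>\<^sub>F d in at_right 0. 0 < (d::real)"
  by (auto simp: eventually_at_right_field intro: exI[of _ 1])

text \<open>Induction on the number of crossed edges: the value is constant up to the lowest edge
  \<open>e0\<close>, rises there by the flow on \<open>e0\<close>, and the induction continues just
  above it. The assumption \<open>generic\<close> keeps the line away from vertices, where several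
  edges meet.\<close>

lemma val_telescope:
  assumes "b < b'" "(x, b) \<notin> pic" "(x, b') \<notin> pic"
    and generic: "\<And>y. b \<le> y \<Longrightarrow> y \<le> b' \<Longrightarrow> (x, y) \<in> pic \<Longrightarrow> \<exists>e. x \<in> odom e \<and> y = g e x"
  shows "val f (x, b') - val f (x, b) = (\<Sum>e\<in>crossing x b b'. flow f $ e)"
  using assms
proof (induction "card (crossing x b b')" arbitrary: b rule: less_induct)
  case less
  let ?C = "crossing x b b'"
  have inC: "\<exists>e\<in>?C. y = g e x" if y: "b \<le> y" "y \<le> b'" "(x, y) \<in> pic" for y
  proof -
    obtain e where "x \<in> odom e" "y = g e x" using less.prems(4)[OF y] by blast
    moreover have "y \<noteq> b" "y \<noteq> b'" using less.prems(2,3) y(3) by auto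
    ultimately show ?thesis using y by (intro bexI[of _ e]) (auto simp: crossing_def)
  qed
  show ?case
  proof (cases "?C = {}")
    case True
    then have "val f (x, b) = val f (x, b')"
      using inC less.prems(1) by (intro val_vertical) auto
    then show ?thesis using True by simp
  next
    case False
    have "Min ((\<lambda>e. g e x) ` ?C) \<in> (\<lambda>e. g e x) ` ?C" using False by (intro Min_in) auto
    then obtain e0 where e0: "e0 \<in> ?C" "g e0 x = Min ((\<lambda>e. g e x) ` ?C)" by auto
    have le: "g e0 x \<le> g e x" if "e \<in> ?C" for e using that e0(2) by simp
    have o: "x \<in> odom e" "b < g e x" "g e x < b'" if "e \<in> ?C" for e using that by (auto simp: crossing_def)
    have lt: "g e0 x < g e x" if "e \<in> ?C - {e0}" for e
      using le[of e] that edges_disjoint[of e0 e x] o(1)[OF e0(1)] o(1)[of e] by force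
    have "\<forall>\<^sub>F d in at_right 0. 0 < d \<and> (x, g e0 x + d) \<in> reg (upper e0) \<and> (x, g e0 x - d) \<in> reg (lower e0) \<and>
        d < g e0 x - b \<and> d < b' - g e0 x \<and> (\<forall>e\<in>?C - {e0}. d < g e x - g e0 x)"
      using o[OF e0(1)] lt
      by (intro eventually_conj near_upper near_lower eventually_ball_finite ballI
          eventually_less_at_right_0 eventually_pos_at_right_0) auto
    \<comment> \<open>Small enough to reach the regions on both sides of \<open>e0\<close>, but
      neither an end of the segment nor the next edge.\<close>
    then obtain d where d: "0 < d" "(x, g e0 x + d) \<in> reg (upper e0)" "(x, g e0 x - d) \<in> reg (lower e0)"
        "d < g e0 x - b" "d < b' - g e0 x" "\<And>e. e \<in> ?C - {e0} \<Longrightarrow> d < g e x - g e0 x"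
      using eventually_happens[of _ "at_right (0::real)"] trivial_limit_at_right_real by blast
    let ?c = "g e0 x + d"
    have C': "crossing x ?c b' = ?C - {e0}"
      using d(1,4,5,6) by (force simp: crossing_def)
    have "val f (x, b') - val f (x, ?c) = (\<Sum>e\<in>crossing x ?c b'. flow f $ e)"
    proof (rule less.hyps)
      show "card (crossing x ?c b') < card ?C"
        unfolding C' using e0(1) by (intro psubset_card_mono) auto
      show "?c < b'" using d(5) by simp
      show "(x, ?c) \<notin> pic" using d(2) by (rule reg_not_D)
      show "(x, b') \<notin> pic" by (rule less.prems(3))
      show "\<exists>e. x \<in> odom e \<and> y = g e x" if "?c \<le> y" "y \<le> b'" "(x, y) \<in> pic" for y
        using less.prems(4)[of y] that d(1,4) by simp
    qed
    moreover have "val f (x, b) = val f (x, g e0 x - d)"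
    proof (rule val_vertical)
      show "b \<le> g e0 x - d" using d(4) by simp
      fix y assume y: "b \<le> y" "y \<le> g e0 x - d"
      show "(x, y) \<notin> pic"
        using inC[of y] le y d(1,5) by force
    qed
    moreover have "val f (x, ?c) = above f e0" "val f (x, g e0 x - d) = below f e0"
      using val_upper val_lower o(1)[OF e0(1)] d(1,2,3) by blast+
    moreover have "(\<Sum>e\<in>?C. flow f $ e) = flow f $ e0 + (\<Sum>e\<in>?C - {e0}. flow f $ e)"
      using e0(1) by (intro sum.remove) auto
    ultimately show ?thesis by (simp add: C' flow_eq)
  qed
qed

lemma generic_odom:
  assumes "x \<notin> xc ` verts G" "(x, y) \<in> pic"
  shows "\<exists>e. x \<in> odom e \<and> y = g e x"
proof -
  obtain e where e: "x \<in> cdom e" "y = g e x" using assms(2) drawing_iff by blast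
  moreover have "x \<noteq> xc (tail G e)" "x \<noteq> xc (head G e)" using assms(1) in_verts by auto
  ultimately have "x \<in> odom e" by auto
  then show ?thesis using e(2) by blast
qed

lemma ex_bounds:
  obtains b b' :: real where "b < b'" "\<And>e. b < g e x \<and> g e x < b'" "b < c" "c < b'"
proof
  let ?S = "insert c (range (\<lambda>e. g e x))"
  have "Min ?S \<le> y" "y \<le> Max ?S" if "y \<in> ?S" for y
    using that by (auto simp del: Min_insert Max_insert intro!: Min_le Max_ge)
  then have *: "Min ?S - 1 < y" "y < Max ?S + 1" if "y \<in> ?S" for y using that by (smt (verit))+
  show "Min ?S - 1 < g e x \<and> g e x < Max ?S + 1" for e using * by blast
  show "Min ?S - 1 < c" "c < Max ?S + 1" using * by blast+
  then show "Min ?S - 1 < Max ?S + 1" by linarith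
qed

lemma val_top:
  assumes "\<And>e. g e x < b'" "(x, y) \<in> pic"
  shows "val f (x, b') = 1"
proof -
  have no: "(x, y') \<notin> pic" if "b' \<le> y'" for y'
    using that assms(1) drawing_iff by (metis not_less)
  obtain r where r: "(x, b') \<in> reg r" using ex1_reg[OF no[of b']] by blast
  have "\<not> bounded (reg r)" by (rule vertical_ray_unbounded(1)[OF reg_region r]) (simp add: no)
  moreover have "y < b'" using assms drawing_iff by auto
  ultimately show ?thesis unfolding val_eq[OF r] using assms(2) by auto
qed

lemma val_bottom:
  assumes "\<And>e. b < g e x"
  shows "val f (x, b) = 0"
proof -
  have no: "(x, y') \<notin> pic" if "y' \<le> b" for y'
    using that assms(1) drawing_iff by (metis not_less)
  obtain r where r: "(x, b) \<in> reg r" using ex1_reg[OF no[of b]] by blast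
  have "\<not> bounded (reg r)" by (rule vertical_ray_unbounded(2)[OF reg_region r]) (simp add: no)
  then show ?thesis unfolding val_eq[OF r] using no by auto
qed

text \<open>Upwards from a point of the region, the flows on the crossed edges add up to 1 minus the
  value of the region. The point can be moved off the finitely many abscissas of vertices because
  regions are open.\<close>

lemma flow_determines_map:
  assumes eq: "flow f = flow f'" and r: "bounded (reg r)"
  shows "f $ r = f' $ r"
proof -
  obtain a b where ab: "(a, b) \<in> reg r" using region_props(4)[OF reg_region[of r]] by auto
  obtain \<rho> where \<rho>: "0 < \<rho>" "ball (a, b) \<rho> \<subseteq> reg r"
    using region_props(1)[OF reg_region[of r]] ab by (metis openE)
  have "infinite ({a<..<a + \<rho>} - xc ` verts G)"
    using \<rho>(1) by (intro Diff_infinite_finite) (auto simp: infinite_Ioo)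
  then obtain x where x: "x \<in> {a<..<a + \<rho>}" "x \<notin> xc ` verts G"
    using infinite_imp_nonempty by blast
  have xb: "(x, b) \<in> reg r"
    using \<rho>(2) x(1) by (auto simp: subset_iff dist_Pair_Pair dist_real_def)
  obtain b0 b' where b': "\<And>e. b0 < g e x \<and> g e x < b'" "b < b'"
    using ex_bounds[of x b] by metis
  obtain y where y: "(x, y) \<in> pic" using bounded_region_iff[OF reg_region xb] r by blast
  have "val h (x, b') - val h (x, b) = (\<Sum>e\<in>crossing x b b'. flow h $ e)" for h
  proof (rule val_telescope[OF b'(2)])
    show "(x, b) \<notin> pic" using xb by (rule reg_not_D)
    show "(x, b') \<notin> pic" using b'(1) drawing_iff by (metis less_irrefl)
  qed (rule generic_odom[OF x(2)])
  moreover have "val h (x, b') = 1" for h using val_top b'(1) y by blast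
  moreover have "val h (x, b) = h $ r" for h using val_eq[OF xb] r by simp
  ultimately have "1 - h $ r = (\<Sum>e\<in>crossing x b b'. flow h $ e)" for h by simp
  from this[of f] this[of f'] eq show ?thesis by simp
qed

text \<open>The vertical line at distance \<open>d / 2\<close> to the right of \<open>s\<close> is
  left of all other vertices, so it crosses exactly the edges leaving \<open>s\<close>, and the
  value rises from 0 to 1 along it.\<close>

lemma flow_total: "(\<Sum>e\<in>out_arcs G s. flow f $ e) = 1"
proof -
  have "finite (xc ` verts G)" by simp
  from finite_set_avoid[OF this, of "xc s"]
  obtain d where d: "0 < d" "\<And>v. v \<in> verts G \<Longrightarrow> xc v \<noteq> xc s \<Longrightarrow> d \<le> \<bar>xc v - xc s\<bar>"
    by (auto simp: dist_real_def abs_minus_commute)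
  define x where "x = xc s + d / 2"
  have far: "x < xc v" if "v \<in> verts G" "v \<noteq> s" for v
    using d(2)[of v] d(1) xc_range(3)[OF that] that by (simp add: x_def)
  then have x: "x \<notin> xc ` verts G" using d(1) by (force simp: x_def)
  obtain b b' where b: "b < b'" "\<And>e. b < g e x \<and> g e x < b'" using ex_bounds by metis
  have cr: "crossing x b b' = out_arcs G s"
  proof (intro set_eqI iffI)
    fix e assume "e \<in> crossing x b b'"
    then have "xc (tail G e) < x" by (simp add: crossing_def)
    then show "e \<in> out_arcs G s" using far[of "tail G e"] in_verts by (force simp: arcs_UNIV)
  next
    fix e assume "e \<in> out_arcs G s"
    then have "tail G e = s" by simp
    then show "e \<in> crossing x b b'"
      using far[OF in_verts(1) head_ne_s, of e] d(1) b(2)[of e] by (simp add: crossing_def x_def)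
  qed
  obtain e where e: "tail G e = s" using arc_out_of s_in(1) s_ne_t by metis
  then have "x \<in> odom e" using far[OF in_verts(1) head_ne_s, of e] d(1) by (simp add: x_def)
  then have "val f (x, b') = 1" using val_top b(2) in_drawing by blast
  moreover have "val f (x, b) = 0" using val_bottom b(2) by blast
  moreover have "val f (x, b') - val f (x, b) = (\<Sum>e\<in>crossing x b b'. flow f $ e)"
  proof (rule val_telescope[OF b(1)])
    show "(x, b) \<notin> pic" "(x, b') \<notin> pic" using b(2) drawing_iff by (metis less_irrefl)+
  qed (rule generic_odom[OF x])
  ultimately show ?thesis by (simp add: cr)
qed

text \<open>In a small box around \<open>v\<close> whose top and bottom sides miss the drawing, a
  vertical line left of \<open>v\<close> crosses exactly the edges into \<open>v\<close>, and one
  right of \<open>v\<close> exactly those out of it. The values at the top and at the bottom are the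
  same for both lines, hence so are the sums of flows.\<close>

lemma flow_conserved:
  assumes v: "v \<in> inner_verts G s t"
  shows "(\<Sum>e\<in>in_arcs G v. flow f $ e) = (\<Sum>e\<in>out_arcs G v. flow f $ e)"
proof -
  have vG: "v \<in> verts G" "v \<noteq> s" "v \<noteq> t" using v by (auto simp: inner_verts_def)
  define x0 y0 where "x0 = xc v" and "y0 = yc v"
  have "finite (range (\<lambda>e. g e x0))" by simp
  from finite_set_avoid[OF this, of y0]
  obtain \<epsilon>' where \<epsilon>': "0 < \<epsilon>'" "\<And>e. g e x0 \<noteq> y0 \<Longrightarrow> \<epsilon>' \<le> \<bar>g e x0 - y0\<bar>"
    by (auto simp: dist_real_def abs_minus_commute)
  \<comment> \<open>Halving makes the inequality strict: each value \<open>g e x0\<close> other than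
    \<open>y0\<close> lies strictly outside the box, and none lies on its sides.\<close>
  define \<epsilon> where "\<epsilon> = \<epsilon>' / 2"
  have \<epsilon>: "0 < \<epsilon>" "\<And>e. g e x0 \<noteq> y0 \<Longrightarrow> \<epsilon> < \<bar>g e x0 - y0\<bar>"
    using \<epsilon>' by (auto simp: \<epsilon>_def) (smt (verit) field_sum_of_halves)
  have notD: "(x0, y0 + \<sigma> * \<epsilon>) \<notin> pic" if "\<sigma> = 1 \<or> \<sigma> = -1" for \<sigma>
  proof
    assume "(x0, y0 + \<sigma> * \<epsilon>) \<in> pic"
    then obtain e where "y0 + \<sigma> * \<epsilon> = g e x0" using drawing_iff by blast
    then show False using \<epsilon>(1) \<epsilon>(2)[of e] that by auto
  qed
  have "\<exists>\<delta>>0. \<forall>x. \<bar>x - x0\<bar> < \<delta> \<longrightarrow> (x, y0 + \<sigma> * \<epsilon>) \<notin> pic" if \<sigma>: "\<sigma> = 1 \<or> \<sigma> = -1" for \<sigma>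
  proof -
    obtain \<delta> where "0 < \<delta>" "ball (x0, y0 + \<sigma> * \<epsilon>) \<delta> \<subseteq> - pic"
      using openE[OF open_Compl[OF closed_drawing]] notD[OF \<sigma>] by (metis ComplI)
    then show ?thesis
      by (intro exI[of _ \<delta>]) (auto simp: subset_iff dist_Pair_Pair dist_real_def abs_minus_commute)
  qed
  from this[of 1] this[of "-1"] obtain \<delta>1 \<delta>2 where \<delta>1: "0 < \<delta>1" "\<forall>x. \<bar>x - x0\<bar> < \<delta>1 \<longrightarrow> (x, y0 + \<epsilon>) \<notin> pic"
    and \<delta>2: "0 < \<delta>2" "\<forall>x. \<bar>x - x0\<bar> < \<delta>2 \<longrightarrow> (x, y0 - \<epsilon>) \<notin> pic"
    by auto
  have "finite (xc ` verts G)" by simp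
  from finite_set_avoid[OF this, of x0]
  obtain \<delta>3 where \<delta>3: "0 < \<delta>3" "\<And>w. w \<in> verts G \<Longrightarrow> xc w \<noteq> x0 \<Longrightarrow> \<delta>3 \<le> \<bar>xc w - x0\<bar>"
    by (auto simp: dist_real_def abs_minus_commute)
  define \<delta> where "\<delta> = min \<delta>1 (min \<delta>2 \<delta>3)"
  have \<delta>: "0 < \<delta>" "\<And>x. \<bar>x - x0\<bar> < \<delta> \<Longrightarrow> (x, y0 + \<epsilon>) \<notin> pic" "\<And>x. \<bar>x - x0\<bar> < \<delta> \<Longrightarrow> (x, y0 - \<epsilon>) \<notin> pic"
    "\<And>w. w \<in> verts G \<Longrightarrow> xc w \<noteq> x0 \<Longrightarrow> \<delta> \<le> \<bar>xc w - x0\<bar>"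
    using \<delta>1 \<delta>2 \<delta>3 by (auto simp: \<delta>_def min_le_iff_disj)
  \<comment> \<open>By the intermediate value theorem, an edge could leave the box vertically only
    through a side that misses the drawing.\<close>
  have stay: "y0 - \<epsilon> < g e x' \<and> g e x' < y0 + \<epsilon>"
    if "\<bar>x - x0\<bar> < \<delta>" "\<bar>x' - x0\<bar> < \<delta>" "closed_segment x x' \<subseteq> cdom e" "y0 - \<epsilon> < g e x" "g e x < y0 + \<epsilon>" for e x x'
  proof -
    have conn: "connected (g e ` closed_segment x x')"
      by (intro connected_continuous_image continuous_on_subset[OF cont_g that(3)] connected_segment)
    have in': "g e x \<in> g e ` closed_segment x x'" "g e x' \<in> g e ` closed_segment x x'" by auto
    have avoid: "y0 + \<epsilon> \<notin> g e ` closed_segment x x'" "y0 - \<epsilon> \<notin> g e ` closed_segment x x'"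
    proof -
      have "\<bar>u - x0\<bar> < \<delta>" if "u \<in> closed_segment x x'" for u
        using that \<open>\<bar>x - x0\<bar> < \<delta>\<close> \<open>\<bar>x' - x0\<bar> < \<delta>\<close>
        by (auto simp: closed_segment_eq_real_ivl split: if_splits)
      moreover have "(u, g e u) \<in> pic" if "u \<in> closed_segment x x'" for u
        using that \<open>closed_segment x x' \<subseteq> cdom e\<close> drawing_iff by blast
      ultimately have "\<bar>u - x0\<bar> < \<delta> \<and> (u, g e u) \<in> pic" if "u \<in> closed_segment x x'" for u
        using that by blast
      then show "y0 + \<epsilon> \<notin> g e ` closed_segment x x'" "y0 - \<epsilon> \<notin> g e ` closed_segment x x'"
        using \<delta>(2,3) by (metis imageE)+
    qed
    show ?thesis
    proof (rule ccontr)
      assume "\<not> ?thesis"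
      then consider "g e x' \<le> y0 - \<epsilon>" | "y0 + \<epsilon> \<le> g e x'" by linarith
      then show False
        using connectedD_interval[OF conn in'(2,1), of "y0 - \<epsilon>"] connectedD_interval[OF conn in', of "y0 + \<epsilon>"]
          that(4,5) avoid by cases auto
    qed
  qed
  have at_v: "head G e = v \<or> tail G e = v" if "x0 \<in> cdom e" "y0 - \<epsilon> < g e x0" "g e x0 < y0 + \<epsilon>" for e
  proof -
    have "g e x0 = y0" using \<epsilon>(2)[of e] that by (smt (verit))
    then show ?thesis using vertex_on_edge[OF vG(1), of e] that by (auto simp: x0_def y0_def)
  qed
  have cr_left: "crossing x (y0 - \<epsilon>) (y0 + \<epsilon>) = in_arcs G v" if x: "x0 - \<delta> < x" "x < x0" for x
  proof (intro set_eqI iffI)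
    fix e assume "e \<in> crossing x (y0 - \<epsilon>) (y0 + \<epsilon>)"
    then have e: "x \<in> odom e" "y0 - \<epsilon> < g e x" "g e x < y0 + \<epsilon>" by (auto simp: crossing_def)
    then have "x0 \<le> xc (head G e)" using \<delta>(4)[OF in_verts(1), of e] x by (cases "xc (head G e) = x0") auto
    then have "closed_segment x x0 \<subseteq> cdom e" using e x by (auto simp: closed_segment_eq_real_ivl)
    then have "y0 - \<epsilon> < g e x0 \<and> g e x0 < y0 + \<epsilon>" "x0 \<in> cdom e"
      using stay[of x x0 e] x e \<delta>(1) by auto
    then have "head G e = v \<or> tail G e = v" using at_v by blast
    moreover have "tail G e \<noteq> v" using e x by (auto simp: x0_def)
    ultimately show "e \<in> in_arcs G v" by (simp add: arcs_UNIV)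
  next
    fix e assume "e \<in> in_arcs G v"
    then have e: "head G e = v" by simp
    then have "xc (tail G e) \<le> x0 - \<delta>"
      using \<delta>(4)[OF in_verts(2), of e] xc_less[of e] by (simp add: x0_def)
    then have xo: "x \<in> odom e" "closed_segment x0 x \<subseteq> cdom e"
      using x e by (auto simp: closed_segment_eq_real_ivl x0_def)
    moreover have "g e x0 = y0" using g_head[of e] e by (simp add: x0_def y0_def)
    ultimately show "e \<in> crossing x (y0 - \<epsilon>) (y0 + \<epsilon>)"
      using stay[of x0 x e] x \<epsilon>(1) \<delta>(1) by (simp add: crossing_def)
  qed
  have cr_right: "crossing x (y0 - \<epsilon>) (y0 + \<epsilon>) = out_arcs G v" if x: "x0 < x" "x < x0 + \<delta>" for x
  proof (intro set_eqI iffI)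
    fix e assume "e \<in> crossing x (y0 - \<epsilon>) (y0 + \<epsilon>)"
    then have e: "x \<in> odom e" "y0 - \<epsilon> < g e x" "g e x < y0 + \<epsilon>" by (auto simp: crossing_def)
    then have "xc (tail G e) \<le> x0" using \<delta>(4)[OF in_verts(2), of e] x by (cases "xc (tail G e) = x0") auto
    then have "closed_segment x x0 \<subseteq> cdom e" using e x by (auto simp: closed_segment_eq_real_ivl)
    then have "y0 - \<epsilon> < g e x0 \<and> g e x0 < y0 + \<epsilon>" "x0 \<in> cdom e"
      using stay[of x x0 e] x e \<delta>(1) by auto
    then have "head G e = v \<or> tail G e = v" using at_v by blast
    moreover have "head G e \<noteq> v" using e x by (auto simp: x0_def)
    ultimately show "e \<in> out_arcs G v" by (simp add: arcs_UNIV)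
  next
    fix e assume "e \<in> out_arcs G v"
    then have e: "tail G e = v" by simp
    then have "x0 + \<delta> \<le> xc (head G e)"
      using \<delta>(4)[OF in_verts(1), of e] xc_less[of e] by (simp add: x0_def)
    then have xo: "x \<in> odom e" "closed_segment x0 x \<subseteq> cdom e"
      using x e by (auto simp: closed_segment_eq_real_ivl x0_def)
    moreover have "g e x0 = y0" using g_tail[of e] e by (simp add: x0_def y0_def)
    ultimately show "e \<in> crossing x (y0 - \<epsilon>) (y0 + \<epsilon>)"
      using stay[of x0 x e] x \<epsilon>(1) \<delta>(1) by (simp add: crossing_def)
  qed
  have vD: "(x0, y0) \<in> pic" using vG(1) by (simp add: drawing_def x0_def y0_def)
  \<comment> \<open>A crossed edge shows that there is drawing between the two sides over
    \<open>x\<close>; over \<open>x0\<close> this is the point of \<open>v\<close> itself. Thus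
    \<open>val_cong\<close> applies to each side.\<close>
  have sum: "(\<Sum>e\<in>crossing x (y0 - \<epsilon>) (y0 + \<epsilon>). flow f $ e) = val f (x0, y0 + \<epsilon>) - val f (x0, y0 - \<epsilon>)"
    if x: "\<bar>x - x0\<bar> < \<delta>" "x \<noteq> x0" and ne: "crossing x (y0 - \<epsilon>) (y0 + \<epsilon>) \<noteq> {}" for x
  proof -
    have "x \<notin> xc ` verts G" using \<delta>(4) x by force
    then have "val f (x, y0 + \<epsilon>) - val f (x, y0 - \<epsilon>) = (\<Sum>e\<in>crossing x (y0 - \<epsilon>) (y0 + \<epsilon>). flow f $ e)"
      using \<epsilon>(1) \<delta>(2,3)[OF x(1)] generic_odom by (intro val_telescope) auto
    moreover obtain u where u: "(x, u) \<in> pic" "y0 - \<epsilon> < u" "u < y0 + \<epsilon>"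
      using ne in_drawing by (auto simp: crossing_def)
    have seg: "connected (closed_segment x x0 \<times> {b})" for b :: real by (intro connected_Times) auto
    have sub: "\<bar>x' - x0\<bar> < \<delta>" if "x' \<in> closed_segment x x0" for x'
      using that x(1) \<delta>(1) by (auto simp: closed_segment_eq_real_ivl split: if_splits)
    have "val f (x, y0 + \<epsilon>) = val f (x0, y0 + \<epsilon>)"
    proof -
      obtain r where r: "(x, y0 + \<epsilon>) \<in> reg r" using ex1_reg \<delta>(2)[OF x(1)] by blast
      have "(x0, y0 + \<epsilon>) \<in> reg r"
        by (rule same_reg[OF seg[of "y0 + \<epsilon>"] _ _ r]) (use sub \<delta>(2) in auto)
      with r show ?thesis
        by (rule val_cong) (use u vD \<epsilon>(1) in \<open>auto intro: exI[of _ u] exI[of _ y0]\<close>)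
    qed
    moreover have "val f (x, y0 - \<epsilon>) = val f (x0, y0 - \<epsilon>)"
    proof -
      obtain r where r: "(x, y0 - \<epsilon>) \<in> reg r" using ex1_reg \<delta>(3)[OF x(1)] by blast
      have "(x0, y0 - \<epsilon>) \<in> reg r"
        by (rule same_reg[OF seg[of "y0 - \<epsilon>"] _ _ r]) (use sub \<delta>(3) in auto)
      with r show ?thesis
        by (rule val_cong) (use u vD \<epsilon>(1) in \<open>auto intro: exI[of _ u] exI[of _ y0]\<close>)
    qed
    ultimately show ?thesis by simp
  qed
  have "in_arcs G v \<noteq> {}" "out_arcs G v \<noteq> {}"
    using arc_into[OF vG(1,2)] arc_out_of[OF vG(1,3)] in_out_iff by blast+
  then show ?thesis
    using sum[of "x0 - \<delta> / 2"] sum[of "x0 + \<delta> / 2"] cr_left[of "x0 - \<delta> / 2"] cr_right[of "x0 + \<delta> / 2"] \<delta>(1)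
    by simp
qed

section \<open>The order polytope and the preimages of the routes\<close>

abbreviation PG :: "'r set" where "PG \<equiv> dual_poset reg"
abbreviation LE :: "('r \<times> 'r) set" where "LE \<equiv> dual_le G pos g reg"

lemma flow_in_flow_polytope:
  assumes f: "f \<in> order_polytope PG LE"
  shows "flow f \<in> flow_polytope G s t"
proof -
  have range: "0 \<le> f $ r \<and> f $ r \<le> 1" if "bounded (reg r)" for r
    using f that by (simp add: order_polytope_def dual_poset_def)
  have "0 \<le> flow f $ e" for e
  proof (cases "bounded (reg (lower e)) \<and> bounded (reg (upper e))")
    case True
    then have "(lower e, upper e) \<in> LE"
      unfolding dual_le_def
      by (intro r_into_rtrancl)
        (auto simp: dual_poset_def arcs_UNIV directly_above_iff directly_below_iff)
    then have "f $ lower e \<le> f $ upper e"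
      using f True by (simp add: order_polytope_def dual_poset_def)
    with True show ?thesis by (simp add: flow_eq above_eq below_eq)
  next
    case False
    then show ?thesis using range by (auto simp: flow_eq above_eq below_eq)
  qed
  then show ?thesis
    using flow_conserved flow_total by (simp add: flow_polytope_def)
qed

text \<open>By \<open>region_one_side\<close>, a single point of a bounded region decides on which
  side of the route the region lies.\<close>

definition potential :: "'e list \<Rightarrow> real ^ 'r" where
  "potential R = (\<chi> r. if bounded (reg r) \<and> (\<exists>x y. (x, y) \<in> reg r \<and> curve R x < y) then 1 else 0)"

lemma potential_at:
  assumes R: "awalk s R t" and r: "bounded (reg r)" "(x, y) \<in> reg r"
  shows "potential R $ r = (if curve R x < y then 1 else 0)"
  using region_one_side[OF reg_region r(1) R _ r(2)] r by (auto simp: potential_def)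

lemma potential_above:
  assumes R: "awalk s R t" and x: "x \<in> odom e" and le: "curve R x \<le> g e x"
  shows "above (potential R) e = 1"
proof (cases "bounded (reg (upper e))")
  case True
  have "\<forall>\<^sub>F d in at_right 0. 0 < d \<and> (x, g e x + d) \<in> reg (upper e)"
    by (intro eventually_conj eventually_pos_at_right_0 near_upper x)
  then obtain d where "0 < d" "(x, g e x + d) \<in> reg (upper e)"
    using eventually_happens[of _ "at_right (0::real)"] trivial_limit_at_right_real by blast
  then show ?thesis using potential_at[OF R True] True le by (simp add: above_eq)
qed (simp add: above_eq)

lemma potential_below:
  assumes R: "awalk s R t" and x: "x \<in> odom e" and le: "g e x \<le> curve R x"
  shows "below (potential R) e = 0"
proof (cases "bounded (reg (lower e))")
  case True
  have "\<forall>\<^sub>F d in at_right 0. 0 < d \<and> (x, g e x - d) \<in> reg (lower e)"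
    by (intro eventually_conj eventually_pos_at_right_0 near_lower x)
  then obtain d where "0 < d" "(x, g e x - d) \<in> reg (lower e)"
    using eventually_happens[of _ "at_right (0::real)"] trivial_limit_at_right_real by blast
  then show ?thesis using potential_at[OF R True] True le by (simp add: below_eq)
qed (simp add: below_eq)

lemma odom_range: "x \<in> odom e \<Longrightarrow> x \<in> {xc s..xc t}"
  using cdom_subset[of e] by auto

text \<open>Just below \<open>e\<close> there are points between the route and \<open>e\<close>, so
  \<open>lower e\<close> is bounded and the default value 0 is not read off. The next lemma excludes
  the default value 1 in the same way.\<close>

lemma potential_below_edge_above:
  assumes R: "awalk s R t" and x: "x \<in> odom e" and lt: "curve R x < g e x"
  shows "below (potential R) e = 1"
proof -
  have "\<forall>\<^sub>F d in at_right 0. 0 < d \<and> d < g e x - curve R x \<and> (x, g e x - d) \<in> reg (lower e)"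
    using lt by (intro eventually_conj eventually_pos_at_right_0 eventually_less_at_right_0 near_lower x) simp
  then obtain d where d: "0 < d" "d < g e x - curve R x" "(x, g e x - d) \<in> reg (lower e)"
    using eventually_happens[of _ "at_right (0::real)"] trivial_limit_at_right_real by blast
  have "bounded (reg (lower e))"
    using d(1,2) in_drawing[OF x] curve_in_drawing[OF R odom_range[OF x]]
    by (intro enclosed(1)[OF reg_region d(3), of "curve R x" "g e x"]) auto
  then show ?thesis using potential_at[OF R _ d(3)] d(2) by (simp add: below_eq)
qed

lemma potential_above_edge_below:
  assumes R: "awalk s R t" and x: "x \<in> odom e" and lt: "g e x < curve R x"
  shows "above (potential R) e = 0"
proof -
  have "\<forall>\<^sub>F d in at_right 0. 0 < d \<and> d < curve R x - g e x \<and> (x, g e x + d) \<in> reg (upper e)"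
    using lt by (intro eventually_conj eventually_pos_at_right_0 eventually_less_at_right_0 near_upper x) simp
  then obtain d where d: "0 < d" "d < curve R x - g e x" "(x, g e x + d) \<in> reg (upper e)"
    using eventually_happens[of _ "at_right (0::real)"] trivial_limit_at_right_real by blast
  have "bounded (reg (upper e))"
    using d(1,2) in_drawing[OF x] curve_in_drawing[OF R odom_range[OF x]]
    by (intro enclosed(1)[OF reg_region d(3), of "g e x" "curve R x"]) auto
  then show ?thesis using potential_at[OF R _ d(3)] d(2) by (simp add: above_eq)
qed

text \<open>One abscissa of each edge is enough: an edge of the route has value 0 below and 1 above,
  and any other edge lies strictly on one side of the route there, with the same value on both of
  its own sides.\<close>

lemma flow_potential:
  assumes R: "awalk s R t"
  shows "flow (potential R) = route_vec R"
proof (subst vec_eq_iff, rule allI)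
  fix e
  obtain x where x: "x \<in> odom e" using dense[OF xc_less[of e]] by auto
  show "flow (potential R) $ e = route_vec R $ e"
  proof (cases "e \<in> set R")
    case True
    then have "curve R x = g e x" using x by (intro curve(2)[OF R]) auto
    then show ?thesis
      using True potential_above[OF R x] potential_below[OF R x] by (simp add: flow_eq route_vec_def)
  next
    case False
    obtain e' where e': "e' \<in> set R" "x \<in> cdom e'" using curve(3)[OF R odom_range[OF x]] by blast
    then have "e \<noteq> e'" using False by auto
    then have "curve R x \<noteq> g e x"
      using edges_disjoint[OF _ x e'(2)] curve(2)[OF R e'] by simp
    then consider "curve R x < g e x" | "g e x < curve R x" by linarith
    then have "above (potential R) e = below (potential R) e"
      using potential_above[OF R x] potential_below[OF R x]
        potential_below_edge_above[OF R x] potential_above_edge_below[OF R x] by cases auto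
    then show ?thesis using False by (simp add: flow_eq route_vec_def)
  qed
qed

text \<open>Monotonicity along a cover relation is the nonnegativity of the flow on the dual edge,
  here an entry of an indicator vector.\<close>

lemma potential_in_order_polytope:
  assumes R: "awalk s R t"
  shows "potential R \<in> order_polytope PG LE"
proof -
  have mono_step: "potential R $ p \<le> potential R $ q"
    if "p \<in> PG" "q \<in> PG" "directly_below G pos g e (reg p)" "directly_above G pos g e (reg q)" for p q e
  proof -
    have "0 \<le> flow (potential R) $ e" by (simp add: flow_potential[OF R] route_vec_def)
    then show ?thesis
      using that by (simp add: directly_below_iff directly_above_iff flow_eq above_eq below_eq dual_poset_def)
  qed
  have "potential R $ p \<le> potential R $ q" if "(p, q) \<in> LE" for p q
    using that unfolding dual_le_def
  proof (induction rule: rtrancl_induct)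
    case (step y z)
    then show ?case using mono_step by (auto intro: order_trans)
  qed simp
  moreover have "0 \<le> potential R $ r" "potential R $ r \<le> 1" "r \<notin> PG \<Longrightarrow> potential R $ r = 0" for r
    by (simp_all add: potential_def dual_poset_def)
  ultimately show ?thesis
    by (simp add: order_polytope_def)
qed

text \<open>The constant 1 above the drawing is respected only by weights of total 1.\<close>

lemma flow_affine:
  assumes "sum a A = 1"
  shows "flow (\<Sum>i\<in>A. a i *\<^sub>R f i) = (\<Sum>i\<in>A. a i *\<^sub>R flow (f i))"
proof (subst vec_eq_iff, rule allI)
  fix e
  have "above (\<Sum>i\<in>A. a i *\<^sub>R f i) e = (\<Sum>i\<in>A. a i * above (f i) e)"
    "below (\<Sum>i\<in>A. a i *\<^sub>R f i) e = (\<Sum>i\<in>A. a i * below (f i) e)"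
    using assms by (simp_all add: above_eq below_eq)
  then show "flow (\<Sum>i\<in>A. a i *\<^sub>R f i) $ e = (\<Sum>i\<in>A. a i *\<^sub>R flow (f i)) $ e"
    by (simp add: flow_eq right_diff_distrib sum_subtractf)
qed

text \<open>For equal totals the constant 1 cancels and only the linear part of \<open>flow\<close>
  remains. This serves the uniqueness of weights as well as, with total 0, their
  integrality.\<close>

lemma flow_diff:
  assumes "sum a A = sum b A"
  shows "(\<Sum>i\<in>A. a i *\<^sub>R flow (f i)) $ e - (\<Sum>i\<in>A. b i *\<^sub>R flow (f i)) $ e =
    (if bounded (reg (upper e)) then ((\<Sum>i\<in>A. a i *\<^sub>R f i) - (\<Sum>i\<in>A. b i *\<^sub>R f i)) $ upper e else 0) -
    (if bounded (reg (lower e)) then ((\<Sum>i\<in>A. a i *\<^sub>R f i) - (\<Sum>i\<in>A. b i *\<^sub>R f i)) $ lower e else 0)"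
  using assms
  by (simp add: flow_eq above_eq below_eq right_diff_distrib sum_subtractf)

lemma convex_order_polytope: "convex (order_polytope PG LE)"
proof (rule convexI)
  fix x y :: "real ^ 'r" and u v :: real
  assume x: "x \<in> order_polytope PG LE" and y: "y \<in> order_polytope PG LE"
    and uv: "0 \<le> u" "0 \<le> v" "u + v = 1"
  have le: "u * a + v * b \<le> u * a' + v * b'" if "a \<le> a'" "b \<le> b'" for a b a' b'
    using that uv by (intro add_mono mult_left_mono)
  have le1: "u * a + v * b \<le> 1" if "a \<le> 1" "b \<le> 1" for a b
    using le[OF that] uv by simp
  show "u *\<^sub>R x + v *\<^sub>R y \<in> order_polytope PG LE"
    using x y uv by (auto simp: order_polytope_def intro!: le le1 add_nonneg_nonneg)
qed

lemma flow_inj_order_polytope: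
  assumes "f \<in> order_polytope PG LE" "f' \<in> order_polytope PG LE" "flow f = flow f'"
  shows "f = f'"
proof (subst vec_eq_iff, rule allI)
  fix r show "f $ r = f' $ r"
    using flow_determines_map[OF assms(3), of r] assms(1,2)
    by (cases "bounded (reg r)") (auto simp: order_polytope_def dual_poset_def)
qed

end

section \<open>Transfer of the triangulation to the order polytope\<close>

locale decomposed_planar_st_dag =
  decomposed_st_dag G s t Rs + indexed_planar_st_dag G s t pos g reg
  for G :: "('v, 'e::finite) pre_digraph" and s t Rs pos g and reg :: "'r::finite \<Rightarrow> (real \<times> real) set"
begin

text \<open>The weights that decompose \<open>flow f\<close> are put on the potentials; the point
  obtained has the same flow as \<open>f\<close>, hence it is \<open>f\<close>.\<close>

lemma order_polytope_cover:
  assumes f: "f \<in> order_polytope PG LE"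
  shows "\<exists>D\<in>equatorial_sets. f \<in> convex hull (potential ` D)"
proof -
  obtain a where a: "\<forall>R. 0 \<le> a R" "{R. a R \<noteq> 0} \<in> equatorial_sets" "sum a {R. awalk s R t} = 1"
      "(\<Sum>R | awalk s R t. a R *\<^sub>R route_vec R) = flow f"
    using flow_polytope_weights[OF flow_in_flow_polytope[OF f]] by blast
  define D where "D = {R. a R \<noteq> 0}"
  have Dr: "D \<subseteq> {R. awalk s R t}" using a(2) by (simp add: equatorial_sets_def D_def)
  have fin: "finite D" using Dr finite_awalks by (rule finite_subset)
  have sumD: "sum a D = 1" "(\<Sum>R\<in>D. a R *\<^sub>R route_vec R) = flow f"
    using a(3,4) Dr finite_awalks by (simp_all add: D_def sum.mono_neutral_left[of "{R. awalk s R t}" "{R. a R \<noteq> 0}"])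
  have "(\<Sum>R\<in>D. a R *\<^sub>R potential R) = f"
  proof (rule flow_inj_order_polytope)
    show "(\<Sum>R\<in>D. a R *\<^sub>R potential R) \<in> order_polytope PG LE"
      using a(1) Dr potential_in_order_polytope
      by (intro convex_sum[OF fin convex_order_polytope sumD(1)]) auto
    have "flow (\<Sum>R\<in>D. a R *\<^sub>R potential R) = (\<Sum>R\<in>D. a R *\<^sub>R flow (potential R))"
      by (rule flow_affine[OF sumD(1)])
    also have "\<dots> = (\<Sum>R\<in>D. a R *\<^sub>R route_vec R)"
      using Dr flow_potential by (intro sum.cong) auto
    finally show "flow (\<Sum>R\<in>D. a R *\<^sub>R potential R) = flow f" using sumD(2) by simp
  qed (fact f)
  moreover have "(\<Sum>R\<in>D. a R *\<^sub>R potential R) \<in> convex hull (potential ` D)"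
    using a(1) by (intro convex_sum[OF fin convex_convex_hull sumD(1)]) (auto intro: hull_inc)
  ultimately show ?thesis using a(2) D_def by auto
qed

text \<open>\<open>flow\<close> is injective on the order polytope, affine, and sends potentials to
  route vectors, so the same weights describe a point and its flow.\<close>

lemma preimage_simplex:
  assumes D: "D \<in> equatorial_sets"
  shows "{f \<in> order_polytope PG LE. flow f \<in> convex hull (route_vec ` D)} = convex hull (potential ` D)"
proof -
  have Dr: "D \<subseteq> {R. awalk s R t}" using D by (simp add: equatorial_sets_def)
  have fin: "finite D" using Dr finite_awalks by (rule finite_subset)
  have inO: "convex hull (potential ` D) \<subseteq> order_polytope PG LE"
    using Dr potential_in_order_polytope by (intro hull_minimal convex_order_polytope) auto
  have flow_comb: "flow (\<Sum>R\<in>D. a R *\<^sub>R potential R) = (\<Sum>R\<in>D. a R *\<^sub>R route_vec R)" if "sum a D = 1" for a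
    unfolding flow_affine[OF that] using Dr flow_potential by (intro sum.cong) auto
  show ?thesis
  proof (intro equalityI subsetI)
    fix f assume f: "f \<in> convex hull (potential ` D)"
    then obtain a where a: "\<forall>R\<in>D. 0 \<le> a R" "sum a D = 1" "(\<Sum>R\<in>D. a R *\<^sub>R potential R) = f"
      using f convex_hull_image_finite[OF fin, of f potential] by blast
    have "flow f = (\<Sum>R\<in>D. a R *\<^sub>R route_vec R)" using flow_comb[OF a(2)] a(3) by simp
    then have "flow f \<in> convex hull (route_vec ` D)"
      using convex_sum[OF fin convex_convex_hull a(2), of route_vec "route_vec ` D"] a(1) by (simp add: hull_inc)
    then show "f \<in> {f \<in> order_polytope PG LE. flow f \<in> convex hull (route_vec ` D)}"
      using f inO by blast
  next
    fix f assume "f \<in> {f \<in> order_polytope PG LE. flow f \<in> convex hull (route_vec ` D)}"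
    then have f: "f \<in> order_polytope PG LE" "flow f \<in> convex hull (route_vec ` D)" by auto
    then obtain a where a: "\<forall>R\<in>D. 0 \<le> a R" "sum a D = 1" "(\<Sum>R\<in>D. a R *\<^sub>R route_vec R) = flow f"
      using convex_hull_image_finite[OF fin, of "flow f" route_vec] by blast
    have h: "(\<Sum>R\<in>D. a R *\<^sub>R potential R) \<in> convex hull (potential ` D)"
      using convex_sum[OF fin convex_convex_hull a(2), of potential "potential ` D"] a(1) by (simp add: hull_inc)
    then have "(\<Sum>R\<in>D. a R *\<^sub>R potential R) = f"
      using inO f(1) flow_comb[OF a(2)] a(3) by (intro flow_inj_order_polytope) auto
    then show "f \<in> convex hull (potential ` D)" using h by simp
  qed
qed

theorem unimodular_induced_triangulation:
  "unimodular_triangulation (induced_triangulation G s t pos g reg Rs) (order_polytope PG LE)"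
proof -
  have "induced_triangulation G s t pos g reg Rs = {convex hull (potential ` D) | D. D \<in> equatorial_sets}"
    unfolding induced_triangulation_def equatorial_flow_triangulation_eq
    proof (intro equalityI subsetI)
    fix T assume "T \<in> (\<lambda>S. {f \<in> order_polytope PG LE. flow f \<in> S}) ` {convex hull (route_vec ` D) |D. D \<in> equatorial_sets}"
    then obtain D where "D \<in> equatorial_sets" "T = {f \<in> order_polytope PG LE. flow f \<in> convex hull (route_vec ` D)}"
      by blast
    then show "T \<in> {convex hull (potential ` D) | D. D \<in> equatorial_sets}"
      using preimage_simplex by blast
  next
    fix T assume "T \<in> {convex hull (potential ` D) | D. D \<in> equatorial_sets}"
    then obtain D where D: "D \<in> equatorial_sets" "T = convex hull (potential ` D)" by blast
    then have "T = {f \<in> order_polytope PG LE. flow f \<in> convex hull (route_vec ` D)}"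
      using preimage_simplex by simp
    then show "T \<in> (\<lambda>S. {f \<in> order_polytope PG LE. flow f \<in> S}) ` {convex hull (route_vec ` D) |D. D \<in> equatorial_sets}"
      using D(1) by blast
  qed
  moreover have "unimodular_triangulation {convex hull (potential ` D) | D. D \<in> equatorial_sets} (order_polytope PG LE)"
  proof (rule unimodular_triangulation_of_unique_decompositions)
    have U: "awalk s R t" if "R \<in> \<Union>equatorial_sets" for R using that Union_equatorial_sets by blast
    show "finite (\<Union>equatorial_sets)" by (rule finite_equatorial)
    show "\<And>D D'. D \<in> equatorial_sets \<Longrightarrow> D' \<subseteq> D \<Longrightarrow> D' \<in> equatorial_sets" by (rule equatorial_sets_mono)
    show "convex (order_polytope PG LE)" by (rule convex_order_polytope)
    obtain R where "awalk s R t" using edge_on_route by blast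
    then show "order_polytope PG LE \<noteq> {}" using potential_in_order_polytope by blast
    show "potential P \<in> order_polytope PG LE" if "P \<in> \<Union>equatorial_sets" for P
      using U[OF that] by (rule potential_in_order_polytope)
    show "potential P $ i \<in> \<int>" for P i by (simp add: potential_def)
    show "\<exists>D\<in>equatorial_sets. x \<in> convex hull (potential ` D)" if "x \<in> order_polytope PG LE" for x
      using that by (rule order_polytope_cover)
  next
    fix a b :: "'e list \<Rightarrow> real"
    assume a: "\<forall>P. 0 \<le> a P" and b: "\<forall>P. 0 \<le> b P"
      and Da: "{P. a P \<noteq> 0} \<in> equatorial_sets" and Db: "{P. b P \<noteq> 0} \<in> equatorial_sets"
      and eq: "(\<Sum>P\<in>\<Union>equatorial_sets. a P *\<^sub>R potential P) = (\<Sum>P\<in>\<Union>equatorial_sets. b P *\<^sub>R potential P)"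
      and sums: "sum a (\<Union>equatorial_sets) = sum b (\<Union>equatorial_sets)"
    have vec: "(\<Sum>P\<in>\<Union>equatorial_sets. c P *\<^sub>R flow (potential P)) = (\<Sum>P\<in>\<Union>equatorial_sets. c P *\<^sub>R route_vec P)" for c
      using Union_equatorial_sets flow_potential by (intro sum.cong) auto
    have "(\<Sum>P\<in>\<Union>equatorial_sets. a P *\<^sub>R route_vec P) $ e = (\<Sum>P\<in>\<Union>equatorial_sets. b P *\<^sub>R route_vec P) $ e" for e
      using flow_diff[OF sums, of potential e] unfolding vec eq diff_self zero_index if_cancel
      by (simp only: right_minus_eq)
    then show "a = b"
      by (intro weights_unique_route_vec[OF a Da b Db]) (simp add: vec_eq_iff)
  next
    fix D c P
    assume D: "D \<in> equatorial_sets" and c: "sum c D = 0" "\<forall>i. (\<Sum>P\<in>D. c P *\<^sub>R potential P) $ i \<in> \<int>" and P: "P \<in> D"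
    have "(\<Sum>R\<in>D. c R * route_vec R $ e) \<in> \<int>" for e
    proof -
      \<comment> \<open>The zero weights serve as the second family: both totals are 0, so
        \<open>flow_diff\<close> expresses the flow on \<open>e\<close> by coordinates that are
        integers.\<close>
      have "(\<Sum>R\<in>D. c R * route_vec R $ e) = (\<Sum>R\<in>D. c R *\<^sub>R flow (potential R)) $ e - (\<Sum>R\<in>D. 0 *\<^sub>R flow (potential R)) $ e"
        using D flow_potential by (auto simp: equatorial_sets_def intro!: sum.cong)
      also have "\<dots> \<in> \<int>"
        using c by (subst flow_diff) auto
      finally show ?thesis .
    qed
    then show "c P \<in> \<int>" using equatorial_weights_integral[OF D _ P] by blast
  qed
  ultimately show ?thesis by simp
qed

end

theorem theorem6p11:
  fixes G :: "('v, 'e::finite) pre_digraph" and s t :: 'v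
    and pos :: "'v \<Rightarrow> real \<times> real" and g :: "'e \<Rightarrow> real \<Rightarrow> real"
    and reg :: "'r::finite \<Rightarrow> (real \<times> real) set"
    and Rs :: "'e list list"
  assumes "fin_digraph G" and "arcs G = UNIV" and "acyclic (arcs_ends G)"
    and "unique_source G s" and "unique_sink G t"
    and "\<forall>e\<in>arcs G. \<not> idle G s t e"
    and "degree_equality G s t"
    and "strongly_planar_realization G pos g"
    and "bij_betw reg UNIV (regions G pos g)"
    and "route_decomposition G s t Rs"
  shows "unimodular_triangulation (induced_triangulation G s t pos g reg Rs)
           (order_polytope (dual_poset reg) (dual_le G pos g reg))"
proof -
  interpret fin_digraph G by fact
  interpret decomposed_planar_st_dag G s t Rs pos g reg
    by unfold_locales (fact assms)+
  show ?thesis by (rule unimodular_induced_triangulation)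
qed

end
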